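(* Let $J(\cdot,\cdot)$ and $j(\cdot,\cdot)$ be Carathéodory functions on $D\times\mathbb{R}$, bounded from below by a constant. Let $\mathcal{F}$ be a bounded subset of $\mathcal{C}^2(\overline{D})$ such that every $g\in\mathcal{F}$ satisfies $g\le0$ on $E$ and $g>0$ on $\partial D$, and such that for some given constant $\mathsf{m}>0$, $|\nabla g(\mathbf{x})|\ge \mathsf{m}$ for all $g\in\mathcal{F}$ and all $\mathbf{x}\in D$ with $g(\mathbf{x})=0$. For $\epsilon>0$ let $[y_n^\epsilon,g_n^\epsilon,u_n^\epsilon]$ be (the subsequence $n=n(m)$, described in the context, of) a minimizing sequence of the penalized problem $(\mathcal{P}_\epsilon)$, and let $y_{n,\epsilon}$ denote the solution of the Neumann problem $-\Delta y+y=f$ in $\Omega_{g_n^\epsilon}$, $\partial y/\partial n=0$ on $\partial\Omega_{g_n^\epsilon}$. Then there is an absolute constant $C>0$ (independent of $n$ and $\epsilon$) such that $$|y_{n,\epsilon}-y_n^\epsilon|_{H^1(\Omega_{g_n^\epsilon})}\le C\,\epsilon^{1/4}.$$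
   Context: $D\subset\mathbb{R}^2$ is a bounded domain with $\mathcal{C}^{1,1}$ boundary, $E\subset\subset D$ is a given subdomain, and $f\in L^p(D)$ with $p>2$ is given. For $g\in\mathcal{F}$, $\Omega_g$ denotes the connected component containing $E$ of the open set $\mathrm{int}\{\mathbf{x}\in D;\ g(\mathbf{x})\le 0\}$. It need not be simply connected. Its boundary has finitely many connected components. Problem $(\mathcal{P})$: minimize over $g\in\mathcal{F}$ the cost $\int_E J(\mathbf{x},y_{\Omega_g})\,d\mathbf{x}+\int_{\partial\Omega_g}j(\mathbf{x},y_{\Omega_g})\,d\sigma$, where $y_{\Omega_g}\in W^{2,p}(\Omega_g)$ solves $-\Delta y+y=f$ in $\Omega_g$, $\partial y/\partial n=0$ on $\partial\Omega_g$. Penalized problem $(\mathcal{P}_\epsilon)$, $\epsilon>0$: minimize over $g\in\mathcal{F}$ and measurable $u$ on $D$ with $g_+^2u\in L^p(D)$ (where $g_+=\max(g,0)$) the cost $$\int_E J(\mathbf{x},y(\mathbf{x}))\,d\mathbf{x}+\int_{I_g}j(\mathbf{z}(t),y(\mathbf{z}(t)))\,|\mathbf{z}'(t)|\,dt+\frac1\epsilon\int_{I_g}\left[\nabla y(\mathbf{z}(t))\cdot\frac{\nabla g(\mathbf{z}(t))}{|\nabla g(\mathbf{z}(t))|}\right]^2|\mathbf{z}'(t)|\,dt,$$ where $y\in W^{2,p}(D)\cap H^1_0(D)\subset\mathcal{C}^1(\overline D)$ solves $-\Delta y+y=f+g_+^2u$ in $D$, $y=0$ on $\partial D$. Here $\mathbf{z}=(z_1,z_2)$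 is the periodic solution of $z_1'=-\partial_{x_2}g(\mathbf{z})$, $z_2'=\partial_{x_1}g(\mathbf{z})$, $\mathbf{z}(0)=\mathbf{x}_0\in\partial\Omega_g$, and $I_g=[0,T_g]$ with $T_g$ its period. If $\partial\Omega_g$ has several components, the integrals over $I_g$ are replaced by the finite sum of the analogous integrals with one initial point on each component. Thus the last two integrals equal $\int_{\partial\Omega_g}j(\mathbf{x},y)\,d\sigma$ and $\frac1\epsilon\int_{\partial\Omega_g}|\partial y/\partial n|^2d\sigma$. A minimizing sequence $[y_n^\epsilon,g_n^\epsilon,u_n^\epsilon]$ of $(\mathcal{P}_\epsilon)$ consists of admissible pairs $(g_n^\epsilon,u_n^\epsilon)$ with corresponding states $y_n^\epsilon$ whose costs converge to the infimum of $(\mathcal{P}_\epsilon)$. The subsequence $n(m)$: given a minimizing sequence $(g_m)$ of $(\mathcal{P})$ (chosen independently of $\epsilon$), the index $n(m)$ is taken large enough that the penalized cost of $[y_{n(m)}^\epsilon,g_{n(m)}^\epsilon,u_{n(m)}^\epsilon]$ is at most the $(\mathcal{P})$-cost of $\Omega_{g_m}$.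
   Formalization: The constant C is independent of n and of ε for 0 < ε ≤ ε₀, with ε₀ > 0 arbitrary, but may depend on ε₀; uniformity over all ε > 0 is false as ε → ∞ (e.g. discs, f = 0, J = 0, j = 1/(1+|s|)). *)

theory Defs
  imports "HOL-Analysis.Analysis"
begin

section \<open>Classical and weak derivatives, Sobolev spaces\<close>

definition grad :: "('a::real_inner \<Rightarrow> real) \<Rightarrow> 'a \<Rightarrow> 'a" where
  "grad f x = (THE G. GDERIV f x :> G)"

text \<open>\<open>Ck_closure k S f\<close>, for open \<open>S\<close>, is membership of \<open>f\<close> in \<open>C\<^sup>k\<close> of the closure of \<open>S\<close>:
  the derivatives up to order \<open>k\<close> exist on \<open>S\<close> and extend continuously to the closure
  (\<open>G\<close> is the extended gradient).\<close>

primrec Ck_closure :: "nat \<Rightarrow> (real^'n) set \<Rightarrow> (real^'n \<Rightarrow> real) \<Rightarrow> bool" where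
  "Ck_closure 0 S f \<longleftrightarrow> continuous_on (closure S) f"
| "Ck_closure (Suc k) S f \<longleftrightarrow> continuous_on (closure S) f \<and>
     (\<exists>G. (\<forall>x\<in>S. GDERIV f x :> G x) \<and> (\<forall>i. Ck_closure k S (\<lambda>x. G x $ i)))"

definition bounded_in_C2 :: "(real^'n) set \<Rightarrow> (real^'n \<Rightarrow> real) set \<Rightarrow> bool" where
  "bounded_in_C2 D F \<longleftrightarrow> (\<forall>g\<in>F. Ck_closure 2 D g) \<and>
     (\<exists>M. \<forall>g\<in>F. \<forall>x\<in>D. \<bar>g x\<bar> \<le> M \<and> norm (grad g x) \<le> M \<and>
        (\<forall>i. norm (grad (\<lambda>y. grad g y $ i) x) \<le> M))"

definition test_function :: "(real^'n) set \<Rightarrow> (real^'n \<Rightarrow> real) \<Rightarrow> bool" where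
  "test_function S \<phi> \<longleftrightarrow> (\<forall>k. Ck_closure k UNIV \<phi>) \<and>
     compact (closure {x. \<phi> x \<noteq> 0}) \<and> closure {x. \<phi> x \<noteq> 0} \<subseteq> S"

definition in_Lp :: "real \<Rightarrow> (real^'n) set \<Rightarrow> (real^'n \<Rightarrow> real) \<Rightarrow> bool" where
  "in_Lp p S h \<longleftrightarrow> h \<in> borel_measurable (lebesgue_on S) \<and>
     integrable (lebesgue_on S) (\<lambda>x. \<bar>h x\<bar> powr p)"

definition weak_grad :: "real \<Rightarrow> (real^'n) set \<Rightarrow> (real^'n \<Rightarrow> real) \<Rightarrow> (real^'n \<Rightarrow> real^'n) \<Rightarrow> bool" where
  "weak_grad p S f V \<longleftrightarrow> in_Lp p S f \<and> (\<forall>i. in_Lp p S (\<lambda>x. V x $ i)) \<and>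
     (\<forall>\<phi> i. test_function S \<phi> \<longrightarrow>
        integral\<^sup>L (lebesgue_on S) (\<lambda>x. f x * grad \<phi> x $ i) =
        - integral\<^sup>L (lebesgue_on S) (\<lambda>x. V x $ i * \<phi> x))"

text \<open>\<open>W2p_derivs p S y V H\<close>: \<open>y\<close> is in \<open>W\<^sup>2\<^sup>,\<^sup>p(S)\<close>, with weak gradient \<open>V\<close> and weak Hessian \<open>H\<close>.\<close>

definition W2p_derivs :: "real \<Rightarrow> (real^'n) set \<Rightarrow> (real^'n \<Rightarrow> real) \<Rightarrow> (real^'n \<Rightarrow> real^'n) \<Rightarrow>
    (real^'n \<Rightarrow> real^'n^'n) \<Rightarrow> bool" where
  "W2p_derivs p S y V H \<longleftrightarrow> weak_grad p S y V \<and>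
     (\<forall>i. weak_grad p S (\<lambda>x. V x $ i) (\<lambda>x. H x $ i))"

definition in_H1 :: "(real^'n) set \<Rightarrow> (real^'n \<Rightarrow> real) \<Rightarrow> bool" where
  "in_H1 S f \<longleftrightarrow> (\<exists>V. weak_grad 2 S f V)"

definition H1_norm :: "(real^'n) set \<Rightarrow> (real^'n \<Rightarrow> real) \<Rightarrow> real" where
  "H1_norm S f = (let V = (SOME V. weak_grad 2 S f V) in
     sqrt (integral\<^sup>L (lebesgue_on S) (\<lambda>x. (f x)\<^sup>2) +
           integral\<^sup>L (lebesgue_on S) (\<lambda>x. (norm (V x))\<^sup>2)))"

definition in_H10 :: "(real^'n) set \<Rightarrow> (real^'n \<Rightarrow> real) \<Rightarrow> bool" where
  "in_H10 S f \<longleftrightarrow> in_H1 S f \<and>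
     (\<exists>\<phi>. (\<forall>k. test_function S (\<phi> k)) \<and>
          (\<lambda>k::nat. H1_norm S (\<lambda>x. f x - \<phi> k x)) \<longlonglongrightarrow> 0)"

section \<open>Domains and the two boundary value problems\<close>

definition domain :: "'a::topological_space set \<Rightarrow> bool" where
  "domain S \<longleftrightarrow> open S \<and> connected S \<and> S \<noteq> {}"

text \<open>Locally, after a rotation or reflection \<open>Q\<close>, the domain is the epigraph of a function
  \<open>h\<close> with Lipschitz derivative.\<close>

definition C11_boundary :: "(real^2) set \<Rightarrow> bool" where
  "C11_boundary D \<longleftrightarrow> (\<forall>x\<in>frontier D. \<exists>r>0. \<exists>Q h h' L. orthogonal_transformation Q \<and>
     (\<forall>s::real. (h has_real_derivative h' s) (at s)) \<and> L-lipschitz_on UNIV h' \<and>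
     (\<forall>y\<in>ball x r. y \<in> D \<longleftrightarrow> h ((Q y :: real^2) $ 1) < Q y $ 2))"

text \<open>\<open>n\<close> is the outward unit normal to \<open>S\<close> at the boundary point \<open>x\<close>: every open cone around
  \<open>-n\<close> (resp. \<open>n\<close>) with aperture less than a half-plane is, near \<open>x\<close>, inside (resp. outside) \<open>S\<close>.
  There is at most one such \<open>n\<close>, and exactly one at each point of a \<open>C\<^sup>1\<close> boundary.\<close>

definition outward_normal :: "'a::real_inner set \<Rightarrow> 'a \<Rightarrow> 'a \<Rightarrow> bool" where
  "outward_normal S x n \<longleftrightarrow> norm n = 1 \<and>
     (\<forall>c>0. \<exists>r>0. \<forall>h. norm h < r \<longrightarrow>
        (n \<bullet> h < - c * norm h \<longrightarrow> x + h \<in> S) \<and> (n \<bullet> h > c * norm h \<longrightarrow> x + h \<notin> S))"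

text \<open>\<open>y \<in> W\<^sup>2\<^sup>,\<^sup>p(S)\<close> solves \<open>-\<Delta>y + y = r\<close> almost everywhere in \<open>S\<close>. For \<open>p > 2\<close> in the plane such
  functions are in \<open>C\<^sup>1\<close> of the closure (on the domains considered); \<open>y\<close> is required to be this
  \<open>C\<^sup>1\<close> representative, so that its pointwise values and gradients on curves are meaningful.\<close>

definition strong_solution :: "real \<Rightarrow> (real^'n) set \<Rightarrow> (real^'n \<Rightarrow> real) \<Rightarrow> (real^'n \<Rightarrow> real) \<Rightarrow> bool" where
  "strong_solution p S r y \<longleftrightarrow> Ck_closure 1 S y \<and>
     (\<exists>V H. W2p_derivs p S y V H \<and>
        (AE x in lebesgue_on S. - (\<Sum>i\<in>UNIV. H x $ i $ i) + y x = r x))"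

definition neumann_solution :: "real \<Rightarrow> (real^'n) set \<Rightarrow> (real^'n \<Rightarrow> real) \<Rightarrow> (real^'n \<Rightarrow> real) \<Rightarrow> bool" where
  "neumann_solution p S f y \<longleftrightarrow> strong_solution p S f y \<and>
     (\<exists>G. continuous_on (closure S) G \<and> (\<forall>x\<in>S. GDERIV y x :> G x) \<and>
        (\<forall>x\<in>frontier S. \<forall>n. outward_normal S x n \<longrightarrow> G x \<bullet> n = 0))"

definition dirichlet_solution :: "real \<Rightarrow> (real^'n) set \<Rightarrow> (real^'n \<Rightarrow> real) \<Rightarrow> (real^'n \<Rightarrow> real) \<Rightarrow> bool" where
  "dirichlet_solution p S r y \<longleftrightarrow> strong_solution p S r y \<and> in_H10 S y \<and> (\<forall>x\<in>frontier S. y x = 0)"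

definition Omega :: "(real^2) set \<Rightarrow> (real^2) set \<Rightarrow> (real^2 \<Rightarrow> real) \<Rightarrow> (real^2) set" where
  "Omega D E g = (THE C. C \<in> components (interior {x\<in>D. g x \<le> 0}) \<and> E \<subseteq> C)"

section \<open>Cost functionals\<close>

text \<open>Measurability in the first argument is with respect to Lebesgue measurable sets.\<close>

definition caratheodory :: "(real^'n) set \<Rightarrow> (real^'n \<Rightarrow> real \<Rightarrow> real) \<Rightarrow> bool" where
  "caratheodory D h \<longleftrightarrow> (\<forall>s. (\<lambda>x. h x s) \<in> borel_measurable (lebesgue_on D)) \<and>
     (AE x in lebesgue_on D. continuous_on UNIV (h x))"

text \<open>Costs take the value \<open>\<infinity>\<close> where an integrand (bounded from below) is not integrable. The
  Bochner integral would return 0 there.\<close>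

definition ext_integral :: "'a measure \<Rightarrow> ('a \<Rightarrow> real) \<Rightarrow> ereal" where
  "ext_integral M h =
     enn2ereal (\<integral>\<^sup>+x. ennreal (h x) \<partial>M) - enn2ereal (\<integral>\<^sup>+x. ennreal (- h x) \<partial>M)"

text \<open>\<open>z\<close> is a trajectory of the Hamiltonian system of \<open>g\<close>, and \<open>T\<close> is its least period.\<close>

definition hamiltonian_orbit :: "(real^2) set \<Rightarrow> (real^2 \<Rightarrow> real) \<Rightarrow> (real \<Rightarrow> real^2) \<Rightarrow> real \<Rightarrow> bool" where
  "hamiltonian_orbit D g z T \<longleftrightarrow>
     (\<forall>t. z t \<in> D \<and>
        (z has_vector_derivative vector [- (grad g (z t) $ 2), grad g (z t) $ 1]) (at t)) \<and>
     T > 0 \<and> (\<forall>t. z (t + T) = z t) \<and> (\<forall>s. 0 < s \<and> s < T \<longrightarrow> (\<exists>t. z (t + s) \<noteq> z t))"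

text \<open>The line integral of \<open>\<phi>\<close> over the boundary of \<open>Omega D E g\<close>, computed with one Hamiltonian
  orbit on each of the (finitely many) components of the boundary. The orbit is unique up to the
  choice of the initial point \<open>z 0\<close>, which does not affect the value.\<close>

definition boundary_integral ::
    "(real^2) set \<Rightarrow> (real^2) set \<Rightarrow> (real^2 \<Rightarrow> real) \<Rightarrow> (real^2 \<Rightarrow> real) \<Rightarrow> ereal" where
  "boundary_integral D E g \<phi> = (\<Sum>K\<in>components (frontier (Omega D E g)).
     let (z, T) = (SOME (z, T). z 0 \<in> K \<and> hamiltonian_orbit D g z T) in
       ext_integral (lebesgue_on {0..T}) (\<lambda>t. \<phi> (z t) * norm (vector_derivative z (at t))))"

definition P_admissible :: "(real^2) set \<Rightarrow> (real^2) set \<Rightarrow> real \<Rightarrow> (real^2 \<Rightarrow> real) \<Rightarrow>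
    (real^2 \<Rightarrow> real) set \<Rightarrow> ((real^2 \<Rightarrow> real) \<times> (real^2 \<Rightarrow> real)) set" where
  "P_admissible D E p f F = {(y, g). g \<in> F \<and> neumann_solution p (Omega D E g) f y}"

definition P_cost :: "(real^2) set \<Rightarrow> (real^2) set \<Rightarrow> (real^2 \<Rightarrow> real \<Rightarrow> real) \<Rightarrow>
    (real^2 \<Rightarrow> real \<Rightarrow> real) \<Rightarrow> (real^2 \<Rightarrow> real) \<times> (real^2 \<Rightarrow> real) \<Rightarrow> ereal" where
  "P_cost D E J j = (\<lambda>(y, g).
     ext_integral (lebesgue_on E) (\<lambda>x. J x (y x)) + boundary_integral D E g (\<lambda>x. j x (y x)))"

definition Peps_admissible :: "(real^2) set \<Rightarrow> real \<Rightarrow> (real^2 \<Rightarrow> real) \<Rightarrow> (real^2 \<Rightarrow> real) set \<Rightarrow>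
    ((real^2 \<Rightarrow> real) \<times> (real^2 \<Rightarrow> real) \<times> (real^2 \<Rightarrow> real)) set" where
  "Peps_admissible D p f F = {(y, g, u). g \<in> F \<and> u \<in> borel_measurable (lebesgue_on D) \<and>
     in_Lp p D (\<lambda>x. (max (g x) 0)\<^sup>2 * u x) \<and>
     dirichlet_solution p D (\<lambda>x. f x + (max (g x) 0)\<^sup>2 * u x) y}"

definition Peps_cost :: "(real^2) set \<Rightarrow> (real^2) set \<Rightarrow> (real^2 \<Rightarrow> real \<Rightarrow> real) \<Rightarrow>
    (real^2 \<Rightarrow> real \<Rightarrow> real) \<Rightarrow> real \<Rightarrow>
    (real^2 \<Rightarrow> real) \<times> (real^2 \<Rightarrow> real) \<times> (real^2 \<Rightarrow> real) \<Rightarrow> ereal" where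
  "Peps_cost D E J j \<epsilon> = (\<lambda>(y, g, u).
     ext_integral (lebesgue_on E) (\<lambda>x. J x (y x)) + boundary_integral D E g (\<lambda>x. j x (y x)) +
     ereal (1 / \<epsilon>) *
       boundary_integral D E g (\<lambda>x. (grad y x \<bullet> (grad g x /\<^sub>R norm (grad g x)))\<^sup>2))"

text \<open>Costs along a minimizing sequence are finite; in particular the infimum is not \<open>\<infinity>\<close>.\<close>

definition minimizing_sequence :: "('a \<Rightarrow> ereal) \<Rightarrow> 'a set \<Rightarrow> (nat \<Rightarrow> 'a) \<Rightarrow> bool" where
  "minimizing_sequence cost A s \<longleftrightarrow> (\<forall>n. s n \<in> A \<and> cost (s n) < \<infinity>) \<and>
     (\<lambda>n. cost (s n)) \<longlonglongrightarrow> (INF a\<in>A. cost a)"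

end

theory Submission
  imports Defs "HOL-Computational_Algebra.Polynomial"
begin

text \<open>Put \<open>w = y\<^sub>n\<^sub>,\<^sub>\<epsilon> - y\<^sub>n\<^sup>\<epsilon>\<close> and let \<open>\<Omega>\<close> be the domain of the index \<open>g\<close>. On \<open>\<Omega>\<close> the control term
  \<open>g\<^sub>+\<^sup>2 u\<close> vanishes, so \<open>- \<Delta> w + w = 0\<close> and \<open>\<bar>w\<bar>\<^sup>2 = \<integral> w \<partial>w/\<partial>n\<close> over \<open>\<partial>\<Omega>\<close>, with \<open>\<bar>w\<bar>\<close> the \<open>H\<^sup>1\<close> norm and
  \<open>\<partial>w/\<partial>n = - \<partial>y\<^sub>n\<^sup>\<epsilon>/\<partial>n\<close>. The flux of \<open>w\<^sup>2 \<nabla>g\<close> through \<open>\<partial>\<Omega>\<close> bounds \<open>\<integral> w\<^sup>2\<close> over \<open>\<partial>\<Omega>\<close> by \<open>C \<bar>w\<bar>\<^sup>2\<close>,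
  where \<open>C\<close> depends only on \<open>m\<close> and the \<open>C\<^sup>2\<close> bound; hence \<open>\<bar>w\<bar>\<^sup>2 \<le> C \<integral> (\<partial>y\<^sub>n\<^sup>\<epsilon>/\<partial>n)\<^sup>2\<close>. The costs of the
  minimizing sequence are bounded uniformly in \<open>\<epsilon>\<close> and the other two integrals are bounded below (the
  length of \<open>\<partial>\<Omega>\<close> is controlled by the flux of \<open>\<nabla>g\<close>), so the penalty term forces the last integral to be
  \<open>O(\<epsilon>)\<close>.

  Integrals along the orbits that parametrize \<open>\<partial>\<Omega>\<close> are linked to volume integrals by the change of
  variables \<open>(t, s) \<mapsto> z t - \<delta> s \<nabla>g (z t)\<close>, which covers the strip \<open>\<delta> \<le> - g \<le> 2 \<delta>\<close>. Testing the weak equation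
  with functions cut off across this strip and letting \<open>\<delta>\<close> tend to 0 gives the divergence theorem
  on \<open>\<Omega>\<close> for the fields involved.\<close>

section \<open>Smooth bump functions\<close>

text \<open>Uniformity shapes the bookkeeping. The radii and thresholds \<open>R\<close>,
  \<open>r\<close>, \<open>s0\<close>, \<open>\<delta>0\<close>, the periods and the number of
  boundary components depend on the individual g, but they enter only through limits; the final
  constants retain just m, the common C^2 bound M and the area of D, besides the cost data. The
  equation is known only in weak form against smooth functions of compact support, while the
  boundary flux needs gradients up to the closure. The cut-off \<open>ramp (- g / \<delta>)\<close>
  mediates: its gradient is a multiple of the gradient of g, so the limit is a normal flux. Its
  product with a solution is merely C^1, which is why test functions are first extended from smooth
  to C^1 by mollification. Boundary integrals are integrals in orbit time, so it must be shown that
  one closed orbit runs through each component of the boundary, exactly once per period; this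
  follows from ODE uniqueness, compactness and a local graph argument. The argument bounds the H^1
  norm by a multiple of sqrt \<epsilon>; on the bounded range of \<epsilon> this implies the
  exponent 1/4.\<close>

abbreviation smooth :: "(real^'n \<Rightarrow> real) \<Rightarrow> bool" where
  "smooth f \<equiv> \<forall>k. Ck_closure k UNIV f"

lemma Ck_closure_continuous: "Ck_closure k S f \<Longrightarrow> continuous_on (closure S) f"
  by (cases k) auto

lemma Ck_closure_Suc_imp: "Ck_closure (Suc k) S f \<Longrightarrow> Ck_closure k S f"
proof (induction k arbitrary: f)
  case (Suc k)
  then obtain G where "\<forall>x\<in>S. GDERIV f x :> G x" "\<And>i. Ck_closure (Suc k) S (\<lambda>x. G x $ i)"
    by (auto simp del: Ck_closure.simps(2) simp: Ck_closure.simps(2)[of "Suc k"])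
  with Suc show ?case by auto
qed simp

lemma Ck_closure_const: "Ck_closure k UNIV (\<lambda>x. c)"
proof (induction k arbitrary: c)
  case (Suc k)
  then show ?case
    by (auto intro!: exI[of _ "\<lambda>x. 0"] GDERIV_const)
qed auto

lemma Ck_closure_add:
  "Ck_closure k S f \<Longrightarrow> Ck_closure k S g \<Longrightarrow> Ck_closure k S (\<lambda>x. f x + g x)"
proof (induction k arbitrary: f g)
  case 0 then show ?case by (auto intro: continuous_intros)
next
  case (Suc k)
  then obtain F G where "\<forall>x\<in>S. GDERIV f x :> F x" "\<forall>i. Ck_closure k S (\<lambda>x. F x $ i)"
     "\<forall>x\<in>S. GDERIV g x :> G x" "\<forall>i. Ck_closure k S (\<lambda>x. G x $ i)" by auto
  with Suc show ?case
    by (auto intro!: continuous_intros exI[of _ "\<lambda>x. F x + G x"] GDERIV_add)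
qed

lemma Ck_closure_mult:
  "Ck_closure k S f \<Longrightarrow> Ck_closure k S g \<Longrightarrow> Ck_closure k S (\<lambda>x. f x * g x)"
proof (induction k arbitrary: f g)
  case 0 then show ?case by (auto intro: continuous_intros)
next
  case (Suc k)
  then obtain F G where *: "\<forall>x\<in>S. GDERIV f x :> F x" "\<forall>i. Ck_closure k S (\<lambda>x. F x $ i)"
     "\<forall>x\<in>S. GDERIV g x :> G x" "\<forall>i. Ck_closure k S (\<lambda>x. G x $ i)" by auto
  have "Ck_closure k S f" "Ck_closure k S g" using Suc.prems Ck_closure_Suc_imp by blast+
  then have "Ck_closure k S (\<lambda>x. f x * G x $ i + g x * F x $ i)" for i
    using * Suc.IH by (intro Ck_closure_add) auto
  with Suc.prems * show ?case
    by (auto intro!: continuous_intros exI[of _ "\<lambda>x. f x *\<^sub>R G x + g x *\<^sub>R F x"] GDERIV_mult)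
qed

lemma Ck_closure_power: "Ck_closure k UNIV f \<Longrightarrow> Ck_closure k UNIV (\<lambda>x. f x ^ n)"
  by (induction n) (auto intro: Ck_closure_mult Ck_closure_const)

lemma Ck_closure_prod:
  "finite A \<Longrightarrow> (\<And>a. a \<in> A \<Longrightarrow> Ck_closure k UNIV (f a)) \<Longrightarrow> Ck_closure k UNIV (\<lambda>x. \<Prod>a\<in>A. f a x)"
  by (induction A rule: finite_induct) (auto intro: Ck_closure_mult Ck_closure_const)

lemma grad_eqI:
  assumes "GDERIV f x :> G" shows "grad f x = G"
proof -
  have "G' = G" if "GDERIV f x :> G'" for G'
  proof -
    have "(\<lambda>h. h \<bullet> G') = (\<lambda>h. h \<bullet> G)"
      using that assms unfolding gderiv_def by (rule has_derivative_unique)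
    then show ?thesis by (simp add: fun_eq_iff vector_eq_ldot)
  qed
  then show ?thesis unfolding grad_def using assms by blast
qed

lemma GDERIV_continuous: "GDERIV f x :> G \<Longrightarrow> isCont f x"
  unfolding gderiv_def by (rule has_derivative_continuous)

lemma continuous_on_vecI:
  fixes f :: "'a::topological_space \<Rightarrow> 'b::real_normed_vector^'n"
  assumes "\<And>i. continuous_on S (\<lambda>x. f x $ i)" shows "continuous_on S f"
  using continuous_on_vec_lambda[of S "\<lambda>i x. f x $ i"] assms by simp

lemma test_function_grad:
  assumes "test_function S \<phi>"
  shows "GDERIV \<phi> x :> grad \<phi> x" "continuous_on UNIV (grad \<phi>)"
proof -
  obtain G where G: "\<forall>x. GDERIV \<phi> x :> G x" "\<forall>i. continuous_on UNIV (\<lambda>x. G x $ i)"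
    using assms[unfolded test_function_def, THEN conjunct1, rule_format, of "Suc 0"] by auto
  then have "grad \<phi> = G" using grad_eqI by blast
  with G show "GDERIV \<phi> x :> grad \<phi> x" "continuous_on UNIV (grad \<phi>)"
    by (auto intro: continuous_on_vecI)
qed

text \<open>The span of these functions over all polynomials is closed under differentiation.\<close>

definition flat :: "real poly \<Rightarrow> real \<Rightarrow> real" where
  "flat P x = (if x \<le> 0 then 0 else poly P (1 / x) * exp (- (1 / x)))"

lemma tendsto_poly_exp_minus: "((\<lambda>u. poly P u * exp (- u)) \<longlongrightarrow> (0::real)) at_top"
proof -
  have "((\<lambda>u::real. \<Sum>i\<le>degree P. coeff P i * (u ^ i / exp u)) \<longlongrightarrow> (\<Sum>i\<le>degree P. coeff P i * 0)) at_top"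
    by (intro tendsto_intros tendsto_power_div_exp_0)
  then show ?thesis
    by (simp add: poly_altdef exp_minus sum_distrib_right divide_inverse mult.assoc)
qed

lemma flat_tendsto_right: "((flat P) \<longlongrightarrow> 0) (at_right 0)"
proof -
  have "((\<lambda>x. poly P (inverse x) * exp (- inverse x)) \<longlongrightarrow> 0) (at_right (0::real))"
    using filterlim_compose[OF tendsto_poly_exp_minus[of P] filterlim_inverse_at_top_right] by simp
  then show ?thesis
    by (rule Lim_transform_eventually)
      (auto simp: flat_def eventually_at_filter divide_inverse)
qed

text \<open>With u = 1/x one has d/dx = - u^2 d/du, and d/du turns P(u) exp (- u) into (P' - P)(u)
  exp (- u); hence the new polynomial u^2 (P - P').\<close>

lemma flat_DERIV: "(flat P has_real_derivative flat ([:0, 0, 1:] * (P - pderiv P)) x) (at x)"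
proof -
  consider "x < 0" | "x > 0" | "x = 0" by linarith
  then show ?thesis
  proof cases
    case 1
    have "((\<lambda>x. 0) has_real_derivative 0) (at x)" by simp
    then have "(flat P has_real_derivative 0) (at x)"
      by (rule has_field_derivative_transform_within_open[where S = "{..<0}"])
        (use 1 in \<open>auto simp: flat_def\<close>)
    with 1 show ?thesis by (simp add: flat_def)
  next
    case 2
    have "((\<lambda>x. poly P (1 / x) * exp (- (1 / x))) has_real_derivative
       flat ([:0, 0, 1:] * (P - pderiv P)) x) (at x)"
      using 2 by (auto intro!: derivative_eq_intros DERIV_chain2[OF poly_DERIV]
        simp: flat_def field_simps power2_eq_square)
    then show ?thesis
      by (rule has_field_derivative_transform_within_open[where S = "{0<..}"])
        (use 2 in \<open>auto simp: flat_def\<close>)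
  next
    case 3
    have "((\<lambda>h. flat P h / h) \<longlongrightarrow> 0) (at 0)"
    proof -
      \<comment> \<open>For h > 0 the difference quotient at 0 is \<open>flat\<close> of the
        polynomial u P(u), so it tends to 0 as well.\<close>
      have "((\<lambda>h. flat P h / h) \<longlongrightarrow> 0) (at_right 0)"
        by (rule Lim_transform_eventually[OF flat_tendsto_right[of "[:0, 1:] * P"]])
          (auto simp: flat_def eventually_at_filter)
      moreover have "((\<lambda>h. flat P h / h) \<longlongrightarrow> 0) (at_left 0)"
        by (rule tendsto_eventually) (auto simp: flat_def eventually_at_filter)
      ultimately show ?thesis by (simp add: filterlim_at_split)
    qed
    with 3 show ?thesis by (simp add: DERIV_def flat_def)
  qed
qed

text \<open>The affine argument serves both faces of a slab, x_i - a_i and b_i - x_i.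
  Differentiation only replaces P by another polynomial, so the induction on k runs over all P at
  once.\<close>

lemma flat_comp_smooth: "Ck_closure k UNIV (\<lambda>x. flat P (c * x $ i + d))"
proof (induction k arbitrary: P)
  case 0
  have "continuous_on UNIV (flat P)"
    using flat_DERIV DERIV_isCont continuous_at_imp_continuous_on by blast
  then show ?case
    by (auto intro!: continuous_intros continuous_on_compose2[of UNIV "flat P"])
next
  case (Suc k)
  let ?Q = "[:0, 0, 1:] * (P - pderiv P)"
  have der: "GDERIV (\<lambda>x. flat P (c * x $ i + d)) x :> (flat ?Q (c * x $ i + d) * c) *\<^sub>R axis i 1" for x
  proof -
    have "((\<lambda>x. c * x $ i + d) has_derivative (\<lambda>h. c * h $ i)) (at x)"
      by (auto intro!: derivative_eq_intros bounded_linear.has_derivative[OF bounded_linear_vec_nth])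
    from has_derivative_compose[OF this flat_DERIV[unfolded has_field_derivative_def]]
    show ?thesis
      unfolding gderiv_def by (simp add: inner_axis mult_ac inner_commute)
  qed
  have "Ck_closure k UNIV (\<lambda>x. ((flat ?Q (c * x $ i + d) * c) *\<^sub>R axis i (1::real)) $ j)" for j
    using Ck_closure_mult[OF Suc[of ?Q] Ck_closure_const[of k "c * (axis i 1 $ j)"]]
    by (simp add: mult_ac)
  moreover have "continuous_on UNIV (\<lambda>x. flat P (c * x $ i + d))"
    using der GDERIV_continuous continuous_at_imp_continuous_on by blast
  ultimately show ?case
    using der by (auto intro!: exI[of _ "\<lambda>x. (flat ?Q (c * x $ i + d) * c) *\<^sub>R axis i 1"])
qed

text \<open>Each factor is positive exactly on one side of a face, so the product is positive
  exactly on the open box. The odd forms \<open>1 *\<close> and \<open>+ -\<close> match the pattern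
  of \<open>flat_comp_smooth\<close>.\<close>

definition box_bump :: "real^'n \<Rightarrow> real^'n \<Rightarrow> real^'n \<Rightarrow> real" where
  "box_bump a b x = (\<Prod>i\<in>UNIV. flat 1 (1 * x $ i + - a $ i) * flat 1 (- 1 * x $ i + b $ i))"

lemma smooth_box_bump: "smooth (box_bump a b)"
  unfolding box_bump_def by (intro allI Ck_closure_prod Ck_closure_mult flat_comp_smooth) auto

lemma box_bump_nonneg: "box_bump a b x \<ge> 0"
  unfolding box_bump_def by (intro prod_nonneg) (auto simp: flat_def)

lemma box_bump_pos_iff: "box_bump a b x > 0 \<longleftrightarrow> x \<in> box a b"
proof -
  have "box_bump a b x > 0 \<longleftrightarrow> box_bump a b x \<noteq> 0" using box_bump_nonneg[of a b x] by linarith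
  also have "\<dots> \<longleftrightarrow> (\<forall>i. a $ i < x $ i \<and> x $ i < b $ i)"
    unfolding box_bump_def by (auto simp: flat_def not_le)
  finally show ?thesis by (auto simp: mem_box_cart)
qed

lemma box_bump_eq_0: "x \<notin> box a b \<Longrightarrow> box_bump a b x = 0"
  using box_bump_nonneg[of a b x] box_bump_pos_iff[of a b x] by linarith

lemma box_bump_le_1: "box_bump a b x \<le> 1"
  unfolding box_bump_def by (intro prod_le_1) (auto simp: flat_def mult_le_one)

lemma test_function_smooth_compact:
  assumes "smooth f" "compact K" "K \<subseteq> S" "\<And>x. x \<notin> K \<Longrightarrow> f x = 0"
  shows "test_function S f"
proof -
  have "closure {x. f x \<noteq> 0} \<subseteq> K"
    using assms by (intro closure_minimal) (auto intro: compact_imp_closed)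
  moreover from this have "compact (closure {x. f x \<noteq> 0})"
    using assms(2) by (meson closed_closure compact_Int_closed compact_eq_bounded_closed bounded_subset)
  ultimately show ?thesis using assms unfolding test_function_def by auto
qed

section \<open>Integration by parts and convolution\<close>

text \<open>Compactly supported C^1 functions, carried together with their gradient. The cut-off
  solutions used later need not be smooth, since g is only C^2 and the solutions only C^1, so
  \<open>test_function\<close> is too small a class for them.\<close>

definition C1c :: "(real^'n) set \<Rightarrow> (real^'n \<Rightarrow> real) \<Rightarrow> (real^'n \<Rightarrow> real^'n) \<Rightarrow> bool" where
  "C1c S \<psi> \<psi>' \<longleftrightarrow> (\<forall>x. GDERIV \<psi> x :> \<psi>' x) \<and> continuous_on UNIV \<psi>' \<and>
     (\<exists>K. compact K \<and> K \<subseteq> S \<and> (\<forall>x. x \<notin> K \<longrightarrow> \<psi> x = 0 \<and> \<psi>' x = 0))"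

lemma C1c_mono: "C1c S \<psi> \<psi>' \<Longrightarrow> S \<subseteq> T \<Longrightarrow> C1c T \<psi> \<psi>'"
  unfolding C1c_def by blast

lemma GDERIV_continuous_on: "(\<And>x. x \<in> S \<Longrightarrow> GDERIV f x :> G x) \<Longrightarrow> continuous_on S f"
  by (rule continuous_at_imp_continuous_on, rule ballI, rule GDERIV_continuous)

lemma C1c_continuous: "C1c S \<psi> \<psi>' \<Longrightarrow> continuous_on UNIV \<psi>"
  unfolding C1c_def by (rule GDERIV_continuous_on[of _ _ \<psi>']) auto

lemma GDERIV_transform_open:
  assumes "GDERIV f x :> d" "open U" "x \<in> U" "\<And>y. y \<in> U \<Longrightarrow> f y = g y"
  shows "GDERIV g x :> d"
  using assms unfolding gderiv_def by (rule has_derivative_transform_within_open)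

lemma GDERIV_zero_open:
  assumes "open U" "x \<in> U" "\<And>y. y \<in> U \<Longrightarrow> f y = 0"
  shows "GDERIV f x :> 0"
  by (rule GDERIV_transform_open[OF GDERIV_const[of 0] assms(1,2)]) (simp add: assms(3))

lemma GDERIV_unique: "GDERIV f x :> a \<Longrightarrow> GDERIV f x :> b \<Longrightarrow> a = b"
  using grad_eqI by metis

text \<open>S and the complement of K are open and cover the space. On their overlap f vanishes, so
  uniqueness of the gradient forces f' = 0 there and the two pieces fit together.\<close>

lemma C1c_extend:
  assumes S: "open S" and K: "compact K" "K \<subseteq> S"
    and f: "\<And>x. x \<in> S \<Longrightarrow> GDERIV f x :> f' x" and f': "continuous_on S f'"
    and 0: "\<And>x. x \<in> S - K \<Longrightarrow> f x = 0"
  shows "C1c S (\<lambda>x. if x \<in> S then f x else 0) (\<lambda>x. if x \<in> S then f' x else 0)"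
proof -
  let ?f = "\<lambda>x. if x \<in> S then f x else 0" and ?f' = "\<lambda>x. if x \<in> S then f' x else 0"
  have cK: "open (- K)" using K compact_imp_closed by auto
  have out: "GDERIV ?f x :> 0" if "x \<notin> K" for x
    by (rule GDERIV_zero_open[OF cK]) (use that 0 in auto)
  have ins: "GDERIV ?f x :> f' x" if "x \<in> S" for x
    by (rule GDERIV_transform_open[OF f[OF that] S that]) auto
  have z: "?f' x = 0" if "x \<notin> K" for x
    using GDERIV_unique[OF out[OF that] ins] by auto
  have "continuous_on S ?f'"
    using f' by (rule continuous_on_cong[THEN iffD1, rotated -1]) auto
  moreover have "continuous_on (- K) ?f'"
    by (rule continuous_on_cong[THEN iffD1, OF refl _ continuous_on_const[of _ 0]]) (use z in auto)
  ultimately have "continuous_on (S \<union> (- K)) ?f'"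
    using S cK by (intro continuous_on_open_Un)
  moreover have "S \<union> (- K) = UNIV" using K by auto
  moreover have "GDERIV ?f x :> ?f' x" for x
    using out[of x] ins[of x] K by auto
  moreover have "\<forall>x. x \<notin> K \<longrightarrow> ?f x = 0 \<and> ?f' x = 0" using z 0 by auto
  ultimately show ?thesis
    unfolding C1c_def by (intro conjI allI exI[of _ K] K) auto
qed

lemma test_function_C1c:
  assumes "test_function S \<phi>" shows "C1c S \<phi> (grad \<phi>)"
proof -
  obtain K where K: "compact K" "K \<subseteq> S" "closure {x. \<phi> x \<noteq> 0} \<subseteq> K"
    using assms unfolding test_function_def by blast
  have *: "\<phi> x = 0" if "x \<notin> K" for x
    using that K(3) closure_subset[of "{x. \<phi> x \<noteq> 0}"] by blast
  have "grad \<phi> x = 0" if "x \<notin> K" for x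
    using that K(1) by (intro grad_eqI GDERIV_zero_open[of "- K", OF _ _ *]) (auto dest: compact_imp_closed)
  with * show ?thesis
    using K(1,2) test_function_grad[OF assms] unfolding C1c_def by (intro conjI allI exI[of _ K]) simp_all
qed

lemma integrable_compact_support:
  fixes f :: "'a::euclidean_space \<Rightarrow> real"
  assumes "continuous_on UNIV f" "compact K" "\<And>x. x \<notin> K \<Longrightarrow> f x = 0"
  shows "integrable lborel f"
proof -
  have "integrable lborel (\<lambda>x. indicator K x *\<^sub>R f x)"
    using assms by (intro borel_integrable_compact) (auto intro: continuous_on_subset)
  moreover have "(\<lambda>x. indicator K x *\<^sub>R f x) = f" using assms(3) by (auto simp: indicator_def fun_eq_iff)
  ultimately show ?thesis by simp
qed

lemma lborel_integral_translate:
  fixes f :: "'a::euclidean_space \<Rightarrow> real"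
  assumes [measurable]: "f \<in> borel_measurable borel"
  shows "integral\<^sup>L lborel (\<lambda>x. f (c + x)) = integral\<^sup>L lborel f"
proof -
  have "integral\<^sup>L lborel f = integral\<^sup>L (distr lborel borel ((+) c)) f"
    by (simp add: lborel_distr_plus)
  also have "\<dots> = integral\<^sup>L lborel (\<lambda>x. f (c + x))"
    by (rule integral_distr) auto
  finally show ?thesis by simp
qed

text \<open>By translation invariance the integrals of the difference quotients of \<open>\<psi>\<close> vanish.\<close>

lemma integral_C1c_gradient:
  fixes \<psi> :: "real^'n \<Rightarrow> real"
  assumes "C1c UNIV \<psi> \<psi>'"
  shows "integral\<^sup>L lborel (\<lambda>x. \<psi>' x $ i) = 0"
proof -
  obtain K where K: "compact K" "\<And>x. x \<notin> K \<Longrightarrow> \<psi> x = 0 \<and> \<psi>' x = 0"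
    and der: "\<And>x. GDERIV \<psi> x :> \<psi>' x" and c': "continuous_on UNIV \<psi>'"
    using assms unfolding C1c_def by blast
  have c: "continuous_on UNIV \<psi>" by (rule C1c_continuous[OF assms])
  have [measurable]: "\<psi> \<in> borel_measurable borel" "(\<lambda>x. \<psi>' x $ i) \<in> borel_measurable borel"
    using c c' by (auto intro!: borel_measurable_continuous_onI continuous_intros)
  have int: "integrable lborel \<psi>" using c K by (blast intro: integrable_compact_support)
  obtain B where B: "\<And>x. norm (\<psi>' x) \<le> B" "B \<ge> 0"
  proof -
    have "bounded (\<psi>' ` K)"
      using K c' by (intro compact_imp_bounded compact_continuous_image) (auto intro: continuous_on_subset)
    then obtain B where "\<And>x. x \<in> K \<Longrightarrow> norm (\<psi>' x) \<le> B" by (auto simp: bounded_iff)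
    then have "norm (\<psi>' x) \<le> max B 0" for x using K(2)[of x] by (cases "x \<in> K") (auto intro: order_trans[OF _ max.cobounded1])
    then show thesis using that[of "max B 0"] by auto
  qed
  have lip: "\<bar>\<psi> x - \<psi> y\<bar> \<le> B * norm (x - y)" for x y
  proof -
    have "norm (\<psi> x - \<psi> y) \<le> B * norm (x - y)"
    proof (rule differentiable_bound[of UNIV \<psi> "\<lambda>x h. h \<bullet> \<psi>' x"])
      show "onorm (\<lambda>h. h \<bullet> \<psi>' z) \<le> B" for z
      proof (rule onorm_bound)
        show "norm (h \<bullet> \<psi>' z) \<le> B * norm h" for h
          using Cauchy_Schwarz_ineq2[of h "\<psi>' z"] mult_left_mono[OF B(1)[of z], of "norm h"]
          by (simp add: mult.commute)
      qed (rule B)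
    qed (use der in \<open>auto simp: gderiv_def\<close>)
    then show ?thesis by simp
  qed
  define e where "e = (axis i 1 :: real^'n)"
  define h where "h n = inverse (real (Suc n))" for n
  have h: "h n > 0" "h n \<le> 1" for n by (auto simp: h_def divide_simps)
  define d where "d n x = (\<psi> (h n *\<^sub>R e + x) - \<psi> x) / h n" for n x
  have "integral\<^sup>L lborel (d n) = 0" for n
  proof -
    have "integrable lborel (\<lambda>x. \<psi> (h n *\<^sub>R e + x))"
    proof (rule integrable_compact_support)
      show "continuous_on UNIV (\<lambda>x. \<psi> (h n *\<^sub>R e + x))"
        by (intro continuous_on_compose2[OF c] continuous_intros) auto
      show "compact ((+) (- (h n *\<^sub>R e)) ` K)" by (intro compact_translation K)
      show "\<psi> (h n *\<^sub>R e + x) = 0" if "x \<notin> (+) (- (h n *\<^sub>R e)) ` K" for x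
      proof (rule ccontr)
        assume "\<psi> (h n *\<^sub>R e + x) \<noteq> 0"
        then have "h n *\<^sub>R e + x \<in> K" using K by blast
        then have "- (h n *\<^sub>R e) + (h n *\<^sub>R e + x) \<in> (+) (- (h n *\<^sub>R e)) ` K" by (rule imageI)
        with that show False by simp
      qed
    qed
    then show ?thesis
      unfolding d_def using int by (simp add: lborel_integral_translate diff_divide_distrib)
  qed
  moreover have "(\<lambda>n. integral\<^sup>L lborel (d n)) \<longlonglongrightarrow> integral\<^sup>L lborel (\<lambda>x. \<psi>' x $ i)"
  proof (rule integral_dominated_convergence)
    \<comment> \<open>The shifts satisfy \<open>h n \<le> 1\<close>, so every difference quotient
      lives on the 1-neighbourhood of K, where the Lipschitz constant B dominates it.\<close>
    let ?K = "\<Union>x\<in>K. cball x 1"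
    show "integrable lborel (\<lambda>x. indicator ?K x *\<^sub>R B)"
      using borel_integrable_compact[of ?K "\<lambda>_. B"] compact_minkowski_sum_cball[OF K(1)] by auto
    show "AE x in lborel. (\<lambda>n. d n x) \<longlonglongrightarrow> \<psi>' x $ i"
    proof (rule AE_I2)
      fix x
      have "((\<lambda>t. \<psi> (t *\<^sub>R e + x)) has_real_derivative (\<psi>' x $ i)) (at 0)"
      proof -
        have "((\<lambda>t. t *\<^sub>R e + x) has_derivative (\<lambda>t. t *\<^sub>R e)) (at 0)"
          by (auto intro!: derivative_eq_intros)
        then have "((\<lambda>t. \<psi> (t *\<^sub>R e + x)) has_derivative (\<lambda>t. (t *\<^sub>R e) \<bullet> \<psi>' x)) (at 0)"
          using has_derivative_compose[of "\<lambda>t. t *\<^sub>R e + x" "\<lambda>t. t *\<^sub>R e" 0 UNIV \<psi> "\<lambda>h. h \<bullet> \<psi>' x"] der[of x]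
          by (simp add: gderiv_def)
        then show ?thesis
          unfolding has_field_derivative_def
          by (simp add: e_def inner_axis inner_commute mult.commute[of _ "\<psi>' x $ i"])
      qed
      then have "((\<lambda>t. (\<psi> (t *\<^sub>R e + x) - \<psi> x) / t) \<longlongrightarrow> \<psi>' x $ i) (at 0)"
        by (simp add: DERIV_def)
      moreover have "filterlim h (at 0) sequentially"
        unfolding filterlim_at h_def using LIMSEQ_inverse_real_of_nat by auto
      ultimately show "(\<lambda>n. d n x) \<longlonglongrightarrow> \<psi>' x $ i"
        unfolding d_def by (rule filterlim_compose)
    qed
    show "AE x in lborel. norm (d n x) \<le> indicator ?K x *\<^sub>R B" for n
    proof (rule AE_I2)
      fix x
      have ne: "norm e = 1" by (simp add: e_def)
      show "norm (d n x) \<le> indicator ?K x *\<^sub>R B"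
      proof (cases "x \<in> ?K")
        case True
        have "\<bar>d n x\<bar> \<le> (B * norm (h n *\<^sub>R e + x - x)) / h n"
          unfolding d_def abs_divide using divide_right_mono[OF lip[of "h n *\<^sub>R e + x" x], of "h n"] h[of n] by simp
        then show ?thesis using True ne h[of n] by simp
      next
        case False
        have "x \<in> cball x 1" "x \<in> cball (h n *\<^sub>R e + x) 1"
          using h[of n] ne by (simp_all add: dist_norm)
        with False have "x \<notin> K" "h n *\<^sub>R e + x \<notin> K" by blast+
        then have "d n x = 0" using K(2) by (simp add: d_def)
        then show ?thesis using B by simp
      qed
    qed
  qed (unfold d_def, measurable)
  ultimately show ?thesis by (simp add: LIMSEQ_const_iff)
qed

section \<open>Convolution with a smooth kernel\<close>

lemma lborel_eq_integral_cbox: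
  fixes f :: "'a::euclidean_space \<Rightarrow> real"
  assumes "continuous_on UNIV f" "\<And>x. x \<notin> cbox a b \<Longrightarrow> f x = 0"
  shows "integral\<^sup>L lborel f = integral (cbox a b) f"
proof -
  have "integrable lborel f" using assms by (intro integrable_compact_support[of f "cbox a b"]) auto
  then have "(f has_integral integral\<^sup>L lborel f) UNIV" by (rule has_integral_integral_lborel)
  moreover have "f = (\<lambda>x. if x \<in> cbox a b then f x else 0)" using assms(2) by auto
  ultimately show ?thesis
    by (metis has_integral_restrict_UNIV integral_unique)
qed

text \<open>The integral runs over a fixed box, meant to contain the support of \<psi>, so that
  differentiation under the integral takes place on a compact domain of integration.\<close>

definition conv :: "real^'n \<Rightarrow> real^'n \<Rightarrow> (real^'n \<Rightarrow> real) \<Rightarrow> (real^'n \<Rightarrow> real) \<Rightarrow> real^'n \<Rightarrow> real" where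
  "conv a b \<rho> \<psi> x = integral (cbox a b) (\<lambda>y. \<rho> (x - y) * \<psi> y)"

lemma GDERIV_conv:
  fixes \<rho> \<psi> :: "real^'n \<Rightarrow> real"
  assumes \<rho>: "\<And>x. GDERIV \<rho> x :> R x" "continuous_on UNIV R" and \<psi>: "continuous_on UNIV \<psi>"
  shows "GDERIV (conv a b \<rho> \<psi>) x :> (\<chi> i. conv a b (\<lambda>x. R x $ i) \<psi> x)"
proof -
  let ?F = "\<lambda>x y. \<psi> y *\<^sub>R blinfun_inner_left (R (x - y))"
  have c\<rho>: "continuous_on UNIV \<rho>" using \<rho>(1) by (rule GDERIV_continuous_on)
  have cF: "continuous_on (UNIV \<times> cbox a b) (\<lambda>(x, y). ?F x y)"
    unfolding split_def
    by (intro continuous_intros bounded_linear.continuous_on[OF bounded_linear_blinfun_inner_left]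
          continuous_on_compose2[OF \<rho>(2)] continuous_on_compose2[OF \<psi>]) auto
  have cFx: "continuous_on (cbox a b) (?F x)" for x
    by (intro continuous_intros bounded_linear.continuous_on[OF bounded_linear_blinfun_inner_left]
          continuous_on_compose2[OF \<rho>(2)] continuous_on_subset[OF \<psi>]) auto
  have "((\<lambda>x. integral (cbox a b) (\<lambda>y. \<rho> (x - y) * \<psi> y)) has_derivative
      blinfun_apply (integral (cbox a b) (?F x))) (at x within UNIV)"
  proof (rule leibniz_rule[OF _ _ cF])
    fix x t :: "real^'n"
    have "((\<lambda>x. x - t) has_derivative (\<lambda>h. h)) (at x)" by (auto intro!: derivative_eq_intros)
    from has_derivative_compose[OF this \<rho>(1)[unfolded gderiv_def]]
    show "((\<lambda>x. \<rho> (x - t) * \<psi> t) has_derivative blinfun_apply (?F x t)) (at x within UNIV)"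
      by (auto intro!: derivative_eq_intros simp: blinfun.scaleR_left mult.commute)
    show "(\<lambda>y. \<rho> (x - y) * \<psi> y) integrable_on cbox a b"
      by (intro integrable_continuous continuous_intros continuous_on_compose2[OF c\<rho>]
          continuous_on_subset[OF \<psi>]) auto
  qed auto
  moreover have "blinfun_apply (integral (cbox a b) (?F x)) = (\<lambda>h. h \<bullet> (\<chi> i. conv a b (\<lambda>x. R x $ i) \<psi> x))"
  proof
    fix h
    have "?F x integrable_on cbox a b" using cFx by (rule integrable_continuous)
    then have "blinfun_apply (integral (cbox a b) (?F x)) h = integral (cbox a b) (\<lambda>y. ?F x y h)"
      by (intro integral_linear[OF _ blinfun.bounded_linear_left, unfolded o_def, symmetric])
    also have "\<dots> = integral (cbox a b) (\<lambda>y. \<Sum>i\<in>UNIV. h $ i * (R (x - y) $ i * \<psi> y))"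
      by (simp add: blinfun.scaleR_left inner_vec_def sum_distrib_left mult_ac)
    also have "\<dots> = (\<Sum>i\<in>UNIV. integral (cbox a b) (\<lambda>y. h $ i * (R (x - y) $ i * \<psi> y)))"
      by (intro integral_sum finite integrable_continuous continuous_intros
          continuous_on_compose2[OF \<rho>(2)] continuous_on_subset[OF \<psi>]) auto
    finally show "blinfun_apply (integral (cbox a b) (?F x)) h = h \<bullet> (\<chi> i. conv a b (\<lambda>x. R x $ i) \<psi> x)"
      by (simp add: inner_vec_def conv_def)
  qed
  ultimately show ?thesis by (simp add: gderiv_def conv_def[abs_def])
qed

lemma smooth_grad:
  assumes "smooth \<rho>"
  shows "GDERIV \<rho> x :> grad \<rho> x" "smooth (\<lambda>x. grad \<rho> x $ i)"
proof -
  have *: "(\<forall>x. GDERIV \<rho> x :> grad \<rho> x) \<and> (\<forall>i. Ck_closure k UNIV (\<lambda>x. grad \<rho> x $ i))" for k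
  proof -
    obtain G where G: "\<forall>x. GDERIV \<rho> x :> G x" "\<forall>i. Ck_closure k UNIV (\<lambda>x. G x $ i)"
      using assms[rule_format, of "Suc k"] by auto
    then have "grad \<rho> = G" using grad_eqI by blast
    with G show ?thesis by simp
  qed
  then show "GDERIV \<rho> x :> grad \<rho> x" "smooth (\<lambda>x. grad \<rho> x $ i)" by auto
qed

lemma smooth_grad_continuous: "smooth \<rho> \<Longrightarrow> continuous_on UNIV (grad \<rho>)"
  using smooth_grad(2)[of \<rho>, rule_format, of 0] by (intro continuous_on_vecI) simp

text \<open>Derivatives fall on the kernel and leave \<psi> alone, so the induction ranges over all
  smooth kernels with \<psi> fixed and merely continuous.\<close>

lemma smooth_conv:
  assumes "smooth \<rho>" "continuous_on UNIV \<psi>"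
  shows "smooth (conv a b \<rho> \<psi>)"
proof -
  have "Ck_closure k UNIV (conv a b \<rho> \<psi>)" if "smooth \<rho>" for k \<rho>
    using that
  proof (induction k arbitrary: \<rho>)
    case (0 \<rho>)
    note * = GDERIV_conv[OF smooth_grad(1)[OF 0] smooth_grad_continuous[OF 0] assms(2), of a b]
    then show ?case using GDERIV_continuous_on[OF *] by simp
  next
    case (Suc k \<rho>)
    note * = GDERIV_conv[OF smooth_grad(1)[OF Suc.prems] smooth_grad_continuous[OF Suc.prems] assms(2), of a b]
    moreover have "continuous_on UNIV (conv a b \<rho> \<psi>)"
      by (rule GDERIV_continuous_on, rule *)
    ultimately show ?case
      using Suc.IH[OF smooth_grad(2)[OF Suc.prems]]
      by (auto intro!: exI[of _ "\<lambda>x. \<chi> i. conv a b (\<lambda>x. grad \<rho> x $ i) \<psi> x"])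
  qed
  with assms show ?thesis by blast
qed

text \<open>Integration by parts in y: the gradient of \<open>\<rho> (x - y) * \<psi> y\<close>
  integrates to zero, and the minus sign from the inner function turns this into an equality. Thus
  the gradient of a mollified function is the mollified gradient.\<close>

lemma conv_grad_swap:
  fixes \<rho> \<psi> :: "real^'n \<Rightarrow> real"
  assumes \<rho>: "smooth \<rho>" and \<psi>: "C1c UNIV \<psi> \<psi>'" and out: "\<And>x. x \<notin> cbox a b \<Longrightarrow> \<psi> x = 0 \<and> \<psi>' x = 0"
  shows "conv a b (\<lambda>x. grad \<rho> x $ i) \<psi> x = conv a b \<rho> (\<lambda>x. \<psi>' x $ i) x"
proof -
  have c: "continuous_on UNIV \<psi>" by (rule C1c_continuous[OF \<psi>])
  have c': "continuous_on UNIV \<psi>'" and d: "\<And>x. GDERIV \<psi> x :> \<psi>' x" using \<psi> by (auto simp: C1c_def)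
  have c\<rho>: "continuous_on UNIV \<rho>" using \<rho> Ck_closure_continuous[of 0 UNIV] by fastforce
  note cR = smooth_grad_continuous[OF \<rho>]
  let ?F = "\<lambda>y. \<rho> (x - y) * \<psi> y"
  let ?F' = "\<lambda>y. \<rho> (x - y) *\<^sub>R \<psi>' y - \<psi> y *\<^sub>R grad \<rho> (x - y)"
  have "GDERIV ?F y :> ?F' y" for y
  proof -
    have "((\<lambda>y. x - y) has_derivative (\<lambda>h. - h)) (at y)" by (auto intro!: derivative_eq_intros)
    from has_derivative_compose[OF this smooth_grad(1)[OF \<rho>, unfolded gderiv_def]]
    have "GDERIV (\<lambda>y. \<rho> (x - y)) y :> - grad \<rho> (x - y)" by (simp add: gderiv_def)
    from GDERIV_mult[OF this d] show ?thesis by simp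
  qed
  moreover have "continuous_on UNIV ?F'"
    by (intro continuous_intros continuous_on_compose2[OF c\<rho>] continuous_on_compose2[OF cR] c c') auto
  ultimately have "C1c UNIV ?F ?F'"
    unfolding C1c_def using out by (auto intro!: exI[of _ "cbox a b"])
  then have "integral\<^sup>L lborel (\<lambda>y. ?F' y $ i) = 0" by (rule integral_C1c_gradient)
  moreover have "integral\<^sup>L lborel (\<lambda>y. ?F' y $ i) = integral (cbox a b) (\<lambda>y. ?F' y $ i)"
    by (rule lborel_eq_integral_cbox)
      (use out in \<open>auto intro!: continuous_intros continuous_on_compose2[OF c\<rho>] continuous_on_compose2[OF cR] c c'\<close>)
  moreover have "integral (cbox a b) (\<lambda>y. ?F' y $ i) =
      integral (cbox a b) (\<lambda>y. \<rho> (x - y) * \<psi>' y $ i) - integral (cbox a b) (\<lambda>y. grad \<rho> (x - y) $ i * \<psi> y)"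
    by (subst integral_diff[symmetric])
      (auto intro!: integrable_continuous continuous_intros continuous_on_compose2[OF c\<rho>]
        continuous_on_compose2[OF cR] continuous_on_subset[OF c] continuous_on_subset[OF c'] simp: mult.commute)
  ultimately show ?thesis by (simp add: conv_def)
qed

section \<open>Mollification and weak gradients\<close>

lemma mollifier_exists:
  assumes "e > 0"
  obtains \<rho> :: "real^'n \<Rightarrow> real" where "smooth \<rho>" "\<And>x. \<rho> x \<ge> 0" "\<And>x. norm x > e \<Longrightarrow> \<rho> x = 0"
    "\<And>x. \<rho> (- x) = \<rho> x" "integral\<^sup>L lborel \<rho> = 1" "integrable lborel \<rho>"
proof -
  \<comment> \<open>The norm is at most the sum of the absolute values of the
    \<open>CARD('n)\<close> coordinates, so the cube of this half-side lies in the ball of radius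
    e.\<close>
  define r where "r = e / real CARD('n)"
  define b where "b = (\<chi> i. r :: real^'n)"
  have r: "r > 0" using assms by (simp add: r_def)
  let ?\<beta> = "box_bump (- b) b"
  have sm: "smooth ?\<beta>" by (rule smooth_box_bump)
  then have c: "continuous_on UNIV ?\<beta>" using Ck_closure_continuous[of 0 UNIV ?\<beta>] by simp
  have out: "?\<beta> x = 0" if "norm x > e" for x
  proof (rule box_bump_eq_0, rule notI)
    assume "x \<in> box (- b) b"
    then have "\<bar>x $ i\<bar> \<le> r" for i by (auto simp: mem_box_cart b_def less_imp_le abs_le_iff) (metis less_imp_le minus_le_iff)
    then have "(\<Sum>i\<in>UNIV. \<bar>x $ i\<bar>) \<le> (\<Sum>i\<in>(UNIV::'n set). r)" by (intro sum_mono) auto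
    then have "norm x \<le> e" using norm_le_l1_cart[of x] by (simp add: r_def)
    with that show False by simp
  qed
  have int: "integrable lborel ?\<beta>"
    using out by (intro integrable_compact_support[OF c compact_cball[of 0 e]]) auto
  have "integral\<^sup>L lborel ?\<beta> \<noteq> 0"
  proof
    assume "integral\<^sup>L lborel ?\<beta> = 0"
    then have "AE x in lborel. ?\<beta> x = 0"
      using integral_nonneg_eq_0_iff_AE[OF int] box_bump_nonneg by auto
    then have "AE x in lborel. x \<notin> box (- b) b"
      by (rule AE_mp) (auto intro!: AE_I2 simp: box_bump_pos_iff[symmetric])
    then have "box (- b) b \<in> null_sets lborel" by (simp add: AE_iff_null_sets)
    then have "negligible (box (- b) b)"
      unfolding negligible_iff_null_sets by (rule null_sets_completionI)
    then have "box (- b) b = {}" by (simp add: negligible_interval)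
    moreover have "0 \<in> box (- b) b" using r by (simp add: mem_box_cart b_def)
    ultimately show False by blast
  qed
  moreover have "integral\<^sup>L lborel ?\<beta> \<ge> 0" using box_bump_nonneg by (intro Bochner_Integration.integral_nonneg) auto
  ultimately have I: "integral\<^sup>L lborel ?\<beta> > 0" by linarith
  let ?\<rho> = "\<lambda>x. (1 / integral\<^sup>L lborel ?\<beta>) * ?\<beta> x"
  show thesis
  proof
    show "smooth ?\<rho>" using sm by (intro allI Ck_closure_mult Ck_closure_const) auto
    show "?\<rho> (- x) = ?\<rho> x" for x
      unfolding box_bump_def by (simp add: add.commute mult.commute)
    show "integral\<^sup>L lborel ?\<rho> = 1" "integrable lborel ?\<rho>" using int I by simp_all
  qed (use I out box_bump_nonneg[of "- b" b] in simp_all)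
qed

text \<open>A nonnegative kernel of mass 1 supported in the ball of radius e makes
  \<open>conv\<close> an average of values of \<psi> within distance e. Evenness of \<rho> rewrites
  \<open>\<rho> (x - y)\<close> as a translate, to which translation invariance applies.\<close>

lemma conv_approx:
  fixes \<rho> \<psi> :: "real^'n \<Rightarrow> real"
  assumes \<rho>: "smooth \<rho>" "\<And>x. \<rho> x \<ge> 0" "\<And>x. norm x > e \<Longrightarrow> \<rho> x = 0" "\<And>x. \<rho> (- x) = \<rho> x"
      "integral\<^sup>L lborel \<rho> = 1" "integrable lborel \<rho>"
    and \<psi>: "continuous_on UNIV \<psi>" "\<And>x. x \<notin> cbox a b \<Longrightarrow> \<psi> x = 0"
    and close: "\<And>y. norm (y - x) \<le> e \<Longrightarrow> \<bar>\<psi> y - \<psi> x\<bar> \<le> d"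
  shows "\<bar>conv a b \<rho> \<psi> x - \<psi> x\<bar> \<le> d"
proof -
  have c\<rho>: "continuous_on UNIV \<rho>" using \<rho>(1) Ck_closure_continuous[of 0 UNIV] by fastforce
  have [measurable]: "\<rho> \<in> borel_measurable borel" using c\<rho> by (rule borel_measurable_continuous_onI)
  have sym: "\<rho> (x - y) = \<rho> (- x + y)" for y using \<rho>(4)[of "x - y"] by simp
  have int1: "integrable lborel (\<lambda>y. \<rho> (x - y))"
  proof -
    have "integrable (distr lborel borel ((+) (- x))) \<rho>" using \<rho>(6) by (simp only: lborel_distr_plus)
    then show ?thesis by (subst (asm) integrable_distr_eq) (auto simp: sym)
  qed
  have one: "integral\<^sup>L lborel (\<lambda>y. \<rho> (x - y)) = 1"
    unfolding sym using \<rho>(5) by (simp only: lborel_integral_translate[OF \<open>\<rho> \<in> borel_measurable borel\<close>])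
  have cp: "continuous_on UNIV (\<lambda>y. \<rho> (x - y) * \<psi> y)"
    by (intro continuous_intros continuous_on_compose2[OF c\<rho>] \<psi>) auto
  have int2: "integrable lborel (\<lambda>y. \<rho> (x - y) * \<psi> y)"
    using \<psi>(2) by (intro integrable_compact_support[OF cp, of "cbox a b"]) auto
  have "conv a b \<rho> \<psi> x = integral\<^sup>L lborel (\<lambda>y. \<rho> (x - y) * \<psi> y)"
    unfolding conv_def using \<psi>(2) by (intro lborel_eq_integral_cbox[OF cp, symmetric]) auto
  then have "conv a b \<rho> \<psi> x - \<psi> x = integral\<^sup>L lborel (\<lambda>y. \<rho> (x - y) * \<psi> y) - integral\<^sup>L lborel (\<lambda>y. \<rho> (x - y) * \<psi> x)"
    using one by simp
  also have "\<dots> = integral\<^sup>L lborel (\<lambda>y. \<rho> (x - y) * (\<psi> y - \<psi> x))"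
    using int1 int2 by (subst Bochner_Integration.integral_diff[symmetric]) (auto simp: algebra_simps)
  finally have "\<bar>conv a b \<rho> \<psi> x - \<psi> x\<bar> = \<bar>integral\<^sup>L lborel (\<lambda>y. \<rho> (x - y) * (\<psi> y - \<psi> x))\<bar>" by simp
  also have "\<dots> \<le> integral\<^sup>L lborel (\<lambda>y. \<rho> (x - y) * d)"
  proof (rule integral_abs_bound_integral)
    show "integrable lborel (\<lambda>y. \<rho> (x - y) * (\<psi> y - \<psi> x))"
      using int1 int2 by (auto simp: right_diff_distrib)
    show "\<bar>\<rho> (x - y) * (\<psi> y - \<psi> x)\<bar> \<le> \<rho> (x - y) * d" for y
    proof (cases "norm (y - x) \<le> e")
      case True
      then show ?thesis using close[OF True] \<rho>(2) by (auto simp: abs_mult mult_left_mono)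
    next
      case False
      then have "\<rho> (x - y) = 0" using \<rho>(3)[of "x - y"] by (simp add: norm_minus_commute)
      then show ?thesis by simp
    qed
  qed (use int1 in auto)
  also have "\<dots> = d" using one by simp
  finally show ?thesis .
qed

lemma conv_support:
  assumes "\<And>x. norm x > e \<Longrightarrow> \<rho> x = 0" "\<And>y. y \<notin> K \<Longrightarrow> \<psi> y = 0" "x \<notin> (\<Union>y\<in>K. cball y e)"
  shows "conv a b \<rho> \<psi> x = 0"
proof -
  have "\<rho> (x - y) * \<psi> y = 0" for y
    using assms(1)[of "x - y"] assms(2)[of y] assms(3)
    by (cases "y \<in> K") (auto simp: dist_norm norm_minus_commute[of x y] not_le)
  then have "(\<lambda>y. \<rho> (x - y) * \<psi> y) = (\<lambda>y. 0)" by (rule ext)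
  then show ?thesis by (simp add: conv_def)
qed

lemma compact_support_uniform:
  fixes \<psi> :: "'a::euclidean_space \<Rightarrow> 'b::euclidean_space"
  assumes "continuous_on UNIV \<psi>" "compact K" "\<And>x. x \<notin> K \<Longrightarrow> \<psi> x = 0" "d > 0"
  obtains e where "e > 0" "\<And>x y. norm (y - x) \<le> e \<Longrightarrow> norm (\<psi> y - \<psi> x) \<le> d"
proof -
  let ?K = "\<Union>x\<in>K. cball x 1"
  have "compact ?K" using assms(2) by (rule compact_minkowski_sum_cball)
  then have "uniformly_continuous_on ?K \<psi>"
    using assms(1) by (intro compact_uniformly_continuous) (auto intro: continuous_on_subset)
  then obtain r where r: "r > 0" "\<And>x y. x \<in> ?K \<Longrightarrow> y \<in> ?K \<Longrightarrow> dist y x < r \<Longrightarrow> dist (\<psi> y) (\<psi> x) < d"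
    using assms(4) unfolding uniformly_continuous_on_def by meson
  show thesis
  proof (rule that[of "min 1 (r / 2)"])
    fix x y :: 'a assume *: "norm (y - x) \<le> min 1 (r / 2)"
    show "norm (\<psi> y - \<psi> x) \<le> d"
    proof (cases "x \<in> K \<or> y \<in> K")
      case True
      then have "x \<in> ?K \<and> y \<in> ?K"
      proof
        assume "x \<in> K" then show ?thesis using * by (auto intro!: bexI[of _ x] simp: dist_norm norm_minus_commute)
      next
        assume "y \<in> K" then show ?thesis using * by (auto intro!: bexI[of _ y] simp: dist_norm norm_minus_commute)
      qed
      then have "dist (\<psi> y) (\<psi> x) < d" using * r(1) by (intro r(2)) (auto simp: dist_norm)
      then show ?thesis by (simp add: dist_norm)
    qed (use assms in auto)
  qed (use r in auto)
qed

text \<open>One compact K for the whole sequence is what lets integrals against merely locally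
  integrable functions pass to the limit.\<close>

lemma C1c_mollify:
  fixes \<psi> :: "real^'n \<Rightarrow> real"
  assumes S: "open S" and \<psi>: "C1c S \<psi> \<psi>'"
  obtains K \<phi> where "compact K" "K \<subseteq> S" "\<And>k::nat. test_function S (\<phi> k)"
    "\<And>x. x \<notin> K \<Longrightarrow> \<psi> x = 0 \<and> \<psi>' x = 0" "\<And>k x. x \<notin> K \<Longrightarrow> \<phi> k x = 0 \<and> grad (\<phi> k) x = 0"
    "\<And>k x. \<bar>\<phi> k x - \<psi> x\<bar> \<le> 1 / Suc k" "\<And>k x i. \<bar>grad (\<phi> k) x $ i - \<psi>' x $ i\<bar> \<le> 1 / Suc k"
proof -
  obtain K0 where K0: "compact K0" "K0 \<subseteq> S" "\<And>x. x \<notin> K0 \<Longrightarrow> \<psi> x = 0 \<and> \<psi>' x = 0"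
    using \<psi> unfolding C1c_def by blast
  have c': "continuous_on UNIV \<psi>'" using \<psi> by (auto simp: C1c_def)
  have c: "continuous_on UNIV \<psi>" by (rule C1c_continuous[OF \<psi>])
  obtain a b where ab: "K0 \<subseteq> cbox a b" using compact_imp_bounded[OF K0(1)] bounded_subset_cbox_symmetric by metis
  have out: "\<And>x. x \<notin> cbox a b \<Longrightarrow> \<psi> x = 0 \<and> \<psi>' x = 0" using ab K0 by blast
  obtain e0 where e0: "e0 > 0" "(\<Union>x\<in>K0. cball x e0) \<subseteq> S"
    using compact_subset_open_imp_cball_epsilon_subset[OF K0(1) S K0(2)] by blast
  define K where "K = (\<Union>x\<in>K0. cball x e0)"
  have K: "compact K" "K \<subseteq> S" "K0 \<subseteq> K"
    using e0 K0(1) compact_minkowski_sum_cball by (auto simp: K_def)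
  have "\<exists>\<phi>. test_function S \<phi> \<and> (\<forall>x. x \<notin> K \<longrightarrow> \<phi> x = 0 \<and> grad \<phi> x = 0) \<and>
     (\<forall>x. \<bar>\<phi> x - \<psi> x\<bar> \<le> 1 / Suc k) \<and> (\<forall>x i. \<bar>grad \<phi> x $ i - \<psi>' x $ i\<bar> \<le> 1 / Suc k)" for k
  proof -
    have pos: "1 / real (Suc k) > 0" by simp
    obtain e1 where e1: "e1 > 0" "\<And>x y. norm (y - x) \<le> e1 \<Longrightarrow> norm (\<psi> y - \<psi> x) \<le> 1 / Suc k"
      using compact_support_uniform[OF c K0(1) _ pos] K0(3) by blast
    obtain e2 where e2: "e2 > 0" "\<And>x y. norm (y - x) \<le> e2 \<Longrightarrow> norm (\<psi>' y - \<psi>' x) \<le> 1 / Suc k"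
      using compact_support_uniform[OF c' K0(1) _ pos] K0(3) by blast
    \<comment> \<open>\<open>e0\<close> keeps the supports inside K, while \<open>e1\<close> and
      \<open>e2\<close> bound the oscillation of \<psi> and of its gradient.\<close>
    define e where "e = min e0 (min e1 e2)"
    have "e > 0" using e0 e1 e2 by (auto simp: e_def)
    then obtain \<rho> :: "real^'n \<Rightarrow> real" where \<rho>: "smooth \<rho>" "\<And>x. \<rho> x \<ge> 0" "\<And>x. norm x > e \<Longrightarrow> \<rho> x = 0"
      "\<And>x. \<rho> (- x) = \<rho> x" "integral\<^sup>L lborel \<rho> = 1" "integrable lborel \<rho>"
      by (rule mollifier_exists) auto
    let ?\<phi> = "conv a b \<rho> \<psi>"
    have sub: "(\<Union>x\<in>K0. cball x e) \<subseteq> K" unfolding K_def e_def by (intro UN_mono subset_cball) auto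
    have gr: "grad ?\<phi> x $ i = conv a b \<rho> (\<lambda>x. \<psi>' x $ i) x" for x i
      using grad_eqI[OF GDERIV_conv[OF smooth_grad(1)[OF \<rho>(1)] smooth_grad_continuous[OF \<rho>(1)] c, of a b]]
        conv_grad_swap[OF \<rho>(1) C1c_mono[OF \<psi>] out] by simp
    have z: "?\<phi> x = 0 \<and> grad ?\<phi> x = 0" if "x \<notin> K" for x
    proof -
      have "x \<notin> (\<Union>x\<in>K0. cball x e)" using that sub by blast
      then have "?\<phi> x = 0" "conv a b \<rho> (\<lambda>x. \<psi>' x $ i) x = 0" for i
        using \<rho>(3) K0(3) by (auto intro!: conv_support[of e \<rho> K0])
      then show ?thesis by (simp add: vec_eq_iff gr)
    qed
    have "test_function S ?\<phi>"
      using z K by (intro test_function_smooth_compact[of _ K] smooth_conv \<rho> c) auto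
    moreover have "\<bar>?\<phi> x - \<psi> x\<bar> \<le> 1 / Suc k" for x
      using e1(2)[of _ x] out by (intro conv_approx[OF \<rho> c]) (auto simp: e_def)
    moreover have "\<bar>grad ?\<phi> x $ i - \<psi>' x $ i\<bar> \<le> 1 / Suc k" for x i
      unfolding gr
    proof (rule conv_approx[OF \<rho>])
      show "continuous_on UNIV (\<lambda>x. \<psi>' x $ i)" by (intro continuous_intros c')
      show "\<bar>\<psi>' y $ i - \<psi>' x $ i\<bar> \<le> 1 / Suc k" if "norm (y - x) \<le> e" for y
        using e2(2)[of y x] that component_le_norm_cart[of "\<psi>' y - \<psi>' x" i] by (auto simp: e_def)
    qed (use out in auto)
    ultimately show ?thesis using z by blast
  qed
  then obtain \<phi> where "\<And>k::nat. test_function S (\<phi> k) \<and> (\<forall>x. x \<notin> K \<longrightarrow> \<phi> k x = 0 \<and> grad (\<phi> k) x = 0) \<and>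
     (\<forall>x. \<bar>\<phi> k x - \<psi> x\<bar> \<le> 1 / Suc k) \<and> (\<forall>x i. \<bar>grad (\<phi> k) x $ i - \<psi>' x $ i\<bar> \<le> 1 / Suc k)"
    by metis
  with K K0(3) show thesis by (intro that[of K \<phi>]) auto
qed

text \<open>For p \<ge> 1 the modulus of f is at most 1 plus its p-th power, and constants are
  integrable on a compact set.\<close>

lemma in_Lp_integrable_compact:
  assumes S: "open S" and f: "in_Lp p S f" "p \<ge> 1" and K: "compact K" "K \<subseteq> S"
  shows "integrable (lebesgue_on S) (\<lambda>x. indicator K x * f x)"
proof -
  have m: "f \<in> borel_measurable (lebesgue_on S)" and i: "integrable (lebesgue_on S) (\<lambda>x. \<bar>f x\<bar> powr p)"
    using f by (auto simp: in_Lp_def)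
  have [measurable]: "S \<in> sets lebesgue" using S by simp
  have Kl: "K \<in> lmeasurable" using K by (simp add: lmeasurable_compact)
  then have Ks: "K \<in> sets (lebesgue_on S)"
    using K by (auto simp: sets_restrict_space_iff fmeasurableD)
  have "emeasure (lebesgue_on S) K < \<infinity>"
    using fmeasurableD2[OF Kl] K by (subst emeasure_restrict_space) (auto simp: less_top simp del: emeasure_completion)
  then have "integrable (lebesgue_on S) (\<lambda>x. indicator K x + \<bar>f x\<bar> powr p)"
    using i Ks by (intro Bochner_Integration.integrable_add integrable_real_indicator) auto
  then show ?thesis
  proof (rule Bochner_Integration.integrable_bound)
    show "(\<lambda>x. indicator K x * f x) \<in> borel_measurable (lebesgue_on S)"
      using m Ks by (intro borel_measurable_times borel_measurable_indicator) auto
    have "\<bar>f x\<bar> \<le> 1 + \<bar>f x\<bar> powr p" for x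
    proof (cases "\<bar>f x\<bar> \<le> 1")
      case False
      then have "\<bar>f x\<bar> powr 1 \<le> \<bar>f x\<bar> powr p" using f(2) by (intro powr_mono) auto
      then show ?thesis using False by simp
    qed (auto intro: order_trans)
    then show "AE x in lebesgue_on S. norm (indicator K x * f x) \<le> norm (indicator K x + \<bar>f x\<bar> powr p)"
      by (auto simp: indicator_def intro!: AE_I2)
  qed
qed

definition locally_integrable_on :: "(real^'n) set \<Rightarrow> (real^'n \<Rightarrow> real) \<Rightarrow> bool" where
  "locally_integrable_on S f \<longleftrightarrow>
     (\<forall>K. compact K \<and> K \<subseteq> S \<longrightarrow> integrable (lebesgue_on S) (\<lambda>x. indicator K x * f x))"

lemma in_Lp_locally_integrable: "open S \<Longrightarrow> in_Lp p S f \<Longrightarrow> p \<ge> 1 \<Longrightarrow> locally_integrable_on S f"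
  unfolding locally_integrable_on_def using in_Lp_integrable_compact by blast

lemma integrable_mult_compact_support:
  fixes f \<eta> :: "real^'n \<Rightarrow> real"
  assumes S: "open S" and f: "locally_integrable_on S f" and K: "compact K" "K \<subseteq> S"
    and \<eta>: "continuous_on UNIV \<eta>" "\<And>x. x \<notin> K \<Longrightarrow> \<eta> x = 0"
  shows "integrable (lebesgue_on S) (\<lambda>x. f x * \<eta> x)"
proof -
  obtain B where B: "\<And>x. x \<in> K \<Longrightarrow> norm (\<eta> x) \<le> B"
    using compact_imp_bounded[OF compact_continuous_image[OF continuous_on_subset[OF \<eta>(1)] K(1)]]
    by (auto simp: bounded_iff)
  have [measurable]: "\<eta> \<in> borel_measurable (lebesgue_on S)"
    using \<eta>(1) S by (intro continuous_imp_measurable_on_sets_lebesgue) (auto intro: continuous_on_subset)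
  have i: "integrable (lebesgue_on S) (\<lambda>x. indicator K x * f x)"
    using f K unfolding locally_integrable_on_def by blast
  have "integrable (lebesgue_on S) (\<lambda>x. (indicator K x * f x) * \<eta> x)"
  proof (rule Bochner_Integration.integrable_bound[OF integrable_mult_left[OF i, of B]])
    show "(\<lambda>x. indicator K x * f x * \<eta> x) \<in> borel_measurable (lebesgue_on S)"
      using i by measurable
    show "AE x in lebesgue_on S. norm (indicator K x * f x * \<eta> x) \<le> norm (indicator K x * f x * B)"
    proof (rule AE_I2)
      fix x
      show "norm (indicator K x * f x * \<eta> x) \<le> norm (indicator K x * f x * B)"
        using B[of x] by (cases "x \<in> K") (auto simp: abs_mult intro!: mult_left_mono)
    qed
  qed
  moreover have "(\<lambda>x. (indicator K x * f x) * \<eta> x) = (\<lambda>x. f x * \<eta> x)"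
    using \<eta>(2) by (auto simp: indicator_def fun_eq_iff)
  ultimately show ?thesis by simp
qed

lemma integral_uniform_limit:
  fixes f \<eta> :: "real^'n \<Rightarrow> real" and X :: "nat \<Rightarrow> real^'n \<Rightarrow> real"
  assumes S: "open S" and f: "locally_integrable_on S f" and K: "compact K" "K \<subseteq> S"
    and \<eta>: "continuous_on UNIV \<eta>" "\<And>x. x \<notin> K \<Longrightarrow> \<eta> x = 0"
    and X: "\<And>k. continuous_on UNIV (X k)" "\<And>k x. x \<notin> K \<Longrightarrow> X k x = 0"
    and lim: "\<And>k x. \<bar>X k x - \<eta> x\<bar> \<le> 1 / Suc k"
  shows "(\<lambda>k. integral\<^sup>L (lebesgue_on S) (\<lambda>x. f x * X k x)) \<longlonglongrightarrow> integral\<^sup>L (lebesgue_on S) (\<lambda>x. f x * \<eta> x)"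
proof -
  let ?I = "\<lambda>h. integral\<^sup>L (lebesgue_on S) h"
  have i: "integrable (lebesgue_on S) (\<lambda>x. indicator K x * f x)"
    using f K unfolding locally_integrable_on_def by blast
  have i1: "integrable (lebesgue_on S) (\<lambda>x. f x * X k x)" for k
    by (rule integrable_mult_compact_support[OF S f K X])
  have i2: "integrable (lebesgue_on S) (\<lambda>x. f x * \<eta> x)"
    by (rule integrable_mult_compact_support[OF S f K \<eta>])
  have bd: "\<bar>?I (\<lambda>x. f x * X k x) - ?I (\<lambda>x. f x * \<eta> x)\<bar> \<le> 1 / Suc k * ?I (\<lambda>x. \<bar>indicator K x * f x\<bar>)" for k
  proof -
    have "?I (\<lambda>x. f x * X k x) - ?I (\<lambda>x. f x * \<eta> x) = ?I (\<lambda>x. f x * X k x - f x * \<eta> x)"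
      using i1 i2 by simp
    also have "\<bar>\<dots>\<bar> \<le> ?I (\<lambda>x. 1 / Suc k * \<bar>indicator K x * f x\<bar>)"
    proof (rule integral_abs_bound_integral)
      fix x
      show "\<bar>f x * X k x - f x * \<eta> x\<bar> \<le> 1 / Suc k * \<bar>indicator K x * f x\<bar>"
      proof (cases "x \<in> K")
        case True
        have "\<bar>f x * X k x - f x * \<eta> x\<bar> = \<bar>f x\<bar> * \<bar>X k x - \<eta> x\<bar>"
          by (simp add: abs_mult[symmetric] right_diff_distrib)
        also have "\<dots> \<le> \<bar>f x\<bar> * (1 / Suc k)" by (intro mult_left_mono lim) auto
        finally show ?thesis using True by (simp add: mult.commute)
      qed (use \<eta> X in auto)
    qed (use i i1 i2 in auto)
    finally show ?thesis by simp
  qed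
  have "(\<lambda>k. 1 / Suc k * ?I (\<lambda>x. \<bar>indicator K x * f x\<bar>)) \<longlonglongrightarrow> 0"
    by (rule tendsto_mult_left_zero[OF LIMSEQ_Suc[OF lim_1_over_n]])
  then have "(\<lambda>k. ?I (\<lambda>x. f x * X k x) - ?I (\<lambda>x. f x * \<eta> x)) \<longlonglongrightarrow> 0"
    by (rule Lim_null_comparison[OF always_eventually, rotated]) (unfold real_norm_def, rule allI, rule bd)
  then show ?thesis by (simp add: LIM_zero_iff)
qed

lemma weak_gradD:
  assumes "weak_grad p S f V"
  shows "in_Lp p S f" "in_Lp p S (\<lambda>x. V x $ i)"
    "test_function S \<phi> \<Longrightarrow> integral\<^sup>L (lebesgue_on S) (\<lambda>x. f x * grad \<phi> x $ i) =
      - integral\<^sup>L (lebesgue_on S) (\<lambda>x. V x $ i * \<phi> x)"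
proof -
  note * = assms[unfolded weak_grad_def]
  show "in_Lp p S f" by (rule *[THEN conjunct1])
  show "in_Lp p S (\<lambda>x. V x $ i)" by (rule *[THEN conjunct2, THEN conjunct1, rule_format])
  show "test_function S \<phi> \<Longrightarrow> integral\<^sup>L (lebesgue_on S) (\<lambda>x. f x * grad \<phi> x $ i) =
      - integral\<^sup>L (lebesgue_on S) (\<lambda>x. V x $ i * \<phi> x)"
    by (rule *[THEN conjunct2, THEN conjunct2, rule_format])
qed

text \<open>Both integrals are continuous under the uniform convergence supplied by
  \<open>C1c_mollify\<close>, so the identity extends from smooth to C^1 test functions.\<close>

lemma weak_grad_C1c:
  assumes S: "open S" and w: "weak_grad p S f V" "p \<ge> 1" and \<psi>: "C1c S \<psi> \<psi>'"
  shows "integral\<^sup>L (lebesgue_on S) (\<lambda>x. f x * \<psi>' x $ i) = - integral\<^sup>L (lebesgue_on S) (\<lambda>x. V x $ i * \<psi> x)"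
proof -
  have f: "locally_integrable_on S f" and V: "locally_integrable_on S (\<lambda>x. V x $ i)"
    by (rule in_Lp_locally_integrable[OF S _ w(2)], rule weak_gradD[OF w(1)])+
  obtain K \<phi> where K: "compact K" "K \<subseteq> S" "\<And>k::nat. test_function S (\<phi> k)"
    "\<And>x. x \<notin> K \<Longrightarrow> \<psi> x = 0 \<and> \<psi>' x = 0" "\<And>k x. x \<notin> K \<Longrightarrow> \<phi> k x = 0 \<and> grad (\<phi> k) x = 0"
    "\<And>k x. \<bar>\<phi> k x - \<psi> x\<bar> \<le> 1 / Suc k" "\<And>k x i. \<bar>grad (\<phi> k) x $ i - \<psi>' x $ i\<bar> \<le> 1 / Suc k"
    using C1c_mollify[OF S \<psi>] by blast
  have c: "continuous_on UNIV \<psi>" "continuous_on UNIV \<psi>'"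
    using C1c_continuous[OF \<psi>] \<psi> by (auto simp: C1c_def)
  have c\<phi>: "continuous_on UNIV (\<phi> k)" "continuous_on UNIV (grad (\<phi> k))" for k
    using C1c_continuous[OF test_function_C1c[OF K(3)]] test_function_grad(2)[OF K(3)] by auto
  have "(\<lambda>k. integral\<^sup>L (lebesgue_on S) (\<lambda>x. f x * grad (\<phi> k) x $ i)) \<longlonglongrightarrow> integral\<^sup>L (lebesgue_on S) (\<lambda>x. f x * \<psi>' x $ i)"
    by (rule integral_uniform_limit[OF S f K(1,2)]) (use K c c\<phi> in \<open>auto intro!: continuous_intros\<close>)
  moreover have "(\<lambda>k. - integral\<^sup>L (lebesgue_on S) (\<lambda>x. V x $ i * \<phi> k x)) \<longlonglongrightarrow> - integral\<^sup>L (lebesgue_on S) (\<lambda>x. V x $ i * \<psi> x)"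
    by (rule tendsto_minus, rule integral_uniform_limit[OF S V K(1,2)]) (use K c c\<phi> in \<open>auto intro!: continuous_intros\<close>)
  moreover have "integral\<^sup>L (lebesgue_on S) (\<lambda>x. f x * grad (\<phi> k) x $ i) = - integral\<^sup>L (lebesgue_on S) (\<lambda>x. V x $ i * \<phi> k x)" for k
    by (rule weak_gradD(3)[OF w(1) K(3)])
  ultimately show ?thesis by (simp add: LIMSEQ_unique)
qed

text \<open>Open boxes are stable under intersection and generate the Borel sets, and the vanishing
  total integral handles complements. Hence every set integral of f vanishes.\<close>

lemma AE_zero_if_box_integrals_zero:
  fixes f :: "'a::euclidean_space \<Rightarrow> real"
  assumes f: "integrable lborel f" and total: "integral\<^sup>L lborel f = 0"
    and box: "\<And>l u. integral\<^sup>L lborel (\<lambda>x. indicator (box l u) x * f x) = 0"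
  shows "AE x in lborel. f x = 0"
proof (rule sigma_finite_measure.density_zero[OF sigma_finite_lborel f])
  let ?E = "range (\<lambda>(a, b). box a b::'a set)"
  fix A :: "'a set" assume "A \<in> sets lborel"
  then have "A \<in> sigma_sets UNIV ?E" by (simp add: borel_eq_box)
  have [measurable]: "f \<in> borel_measurable borel" using borel_measurable_integrable[OF f] by simp
  have meas: "A \<in> sets borel" if "A \<in> sigma_sets UNIV ?E" for A
    using that by (simp add: borel_eq_box)
  have si: "set_integrable lborel A f" if "A \<in> sets borel" for A
    using f that unfolding set_integrable_def by (intro integrable_mult_indicator) auto
  have "Int_stable ?E" by (auto simp: Int_stable_def box_Int_box)
  moreover have "?E \<subseteq> Pow UNIV" by simp
  ultimately show "set_lebesgue_integral lborel A f = 0"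
    using \<open>A \<in> sigma_sets UNIV ?E\<close>
  proof (induction rule: sigma_sets_induct_disjoint)
    case (compl A)
    then have [measurable]: "A \<in> sets borel" using meas by simp
    have "set_lebesgue_integral lborel (A \<union> (UNIV - A)) f =
        set_lebesgue_integral lborel A f + set_lebesgue_integral lborel (UNIV - A) f"
      by (rule set_integral_Un) (auto intro!: si)
    with compl total show ?case by (simp add: set_lebesgue_integral_def)
  next
    case (union A)
    then have [measurable]: "\<And>i. A i \<in> sets borel" using meas by (auto simp: image_subset_iff)
    have "set_lebesgue_integral lborel (\<Union>i. A i) f = (\<Sum>i. set_lebesgue_integral lborel (A i) f)"
      using union(1) by (intro lebesgue_integral_countable_add si) (auto simp: disjoint_family_on_def)
    with union show ?case by simp
  qed (use box in \<open>auto simp: set_lebesgue_integral_def\<close>)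
qed

text \<open>The functions \<open>1 - (1 - \<beta>)^k\<close>, with \<open>\<beta>\<close> the bump of a box, are test functions increasing to
  the indicator function of the box.\<close>

lemma fundamental_lemma:
  fixes h :: "real^'n \<Rightarrow> real"
  assumes S: "open S" and h: "locally_integrable_on S h"
    and zero: "\<And>\<phi>. test_function S \<phi> \<Longrightarrow> integral\<^sup>L (lebesgue_on S) (\<lambda>x. h x * \<phi> x) = 0"
  shows "AE x in lebesgue_on S. h x = 0"
proof -
  have [measurable]: "S \<in> sets lebesgue" using S by simp
  have boxz: "integral\<^sup>L (lebesgue_on S) (\<lambda>x. indicator (box a b) x * h x) = 0" if "cbox a b \<subseteq> S" for a b
  proof -
    let ?\<beta> = "box_bump a b"
    let ?\<phi> = "\<lambda>k x. 1 + - 1 * (1 + - 1 * ?\<beta> x) ^ Suc k"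
    have i: "integrable (lebesgue_on S) (\<lambda>x. indicator (cbox a b) x * h x)"
      using h that by (auto simp: locally_integrable_on_def)
    have out: "?\<phi> k x = 0" if "x \<notin> box a b" for k x using box_bump_eq_0[OF that] by simp
    have sm: "smooth (?\<phi> k)" for k
      by (intro allI Ck_closure_add Ck_closure_mult Ck_closure_const Ck_closure_power)
        (simp add: smooth_box_bump)
    have tf: "test_function S (?\<phi> k)" for k
      by (rule test_function_smooth_compact[OF sm compact_cbox that]) (use out box_subset_cbox in blast)
    have "(\<lambda>k. integral\<^sup>L (lebesgue_on S) (\<lambda>x. h x * ?\<phi> k x)) \<longlonglongrightarrow> integral\<^sup>L (lebesgue_on S) (\<lambda>x. indicator (box a b) x * h x)"
    proof (rule integral_dominated_convergence)
      show "integrable (lebesgue_on S) (\<lambda>x. \<bar>indicator (cbox a b) x * h x\<bar>)" using i by simp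
      have "box a b \<in> sets (lebesgue_on S)"
        using that box_subset_cbox[of a b] by (auto simp: sets_restrict_space_iff)
      then have "(\<lambda>x. indicator (box a b) x * (indicator (cbox a b) x * h x)) \<in> borel_measurable (lebesgue_on S)"
        using i by measurable
      moreover have "(\<lambda>x. indicator (box a b) x * (indicator (cbox a b) x * h x)) = (\<lambda>x. indicator (box a b) x * h x)"
        using box_subset_cbox[of a b] by (auto simp: indicator_def fun_eq_iff)
      ultimately show "(\<lambda>x. indicator (box a b) x * h x) \<in> borel_measurable (lebesgue_on S)" by simp
      show "(\<lambda>x. h x * ?\<phi> k x) \<in> borel_measurable (lebesgue_on S)" for k
      proof (rule borel_measurable_integrable[OF integrable_mult_compact_support[OF S h compact_cbox that]])
        show "continuous_on UNIV (?\<phi> k)" using sm[of k] Ck_closure_continuous[of 0 UNIV "?\<phi> k"] by simp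
        show "\<And>x. x \<notin> cbox a b \<Longrightarrow> ?\<phi> k x = 0" using out box_subset_cbox by blast
      qed
      show "AE x in lebesgue_on S. (\<lambda>k. h x * ?\<phi> k x) \<longlonglongrightarrow> indicator (box a b) x * h x"
      proof (rule AE_I2)
        fix x
        show "(\<lambda>k. h x * ?\<phi> k x) \<longlonglongrightarrow> indicator (box a b) x * h x"
        proof (cases "x \<in> box a b")
          case True
          then have "\<bar>1 + - 1 * ?\<beta> x\<bar> < 1" using box_bump_pos_iff[of a b x] box_bump_le_1[of a b x] by auto
          then have "(\<lambda>k. (1 + - 1 * ?\<beta> x) ^ Suc k) \<longlonglongrightarrow> 0"
            by (intro LIMSEQ_Suc[OF LIMSEQ_abs_realpow_zero2])
          then have "(\<lambda>k. h x * ?\<phi> k x) \<longlonglongrightarrow> h x * (1 + - 1 * 0)" by (intro tendsto_intros)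
          then show ?thesis using True by simp
        qed (use out in auto)
      qed
      show "AE x in lebesgue_on S. norm (h x * ?\<phi> k x) \<le> \<bar>indicator (cbox a b) x * h x\<bar>" for k
      proof (rule AE_I2)
        fix x
        show "norm (h x * ?\<phi> k x) \<le> \<bar>indicator (cbox a b) x * h x\<bar>"
        proof (cases "x \<in> cbox a b")
          case True
          have "0 \<le> 1 + - 1 * ?\<beta> x" "1 + - 1 * ?\<beta> x \<le> 1"
            using box_bump_nonneg[of a b x] box_bump_le_1[of a b x] by simp_all
          from zero_le_power[OF this(1), of "Suc k"] power_le_one[OF this, of "Suc k"]
          have "\<bar>?\<phi> k x\<bar> \<le> 1" by linarith
          then have "\<bar>h x\<bar> * \<bar>?\<phi> k x\<bar> \<le> \<bar>h x\<bar> * 1" by (intro mult_left_mono) auto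
          then show ?thesis using True by (simp add: abs_mult)
        next
          case False
          then have "x \<notin> box a b" using box_subset_cbox by blast
          from out[OF this] show ?thesis by simp
        qed
      qed
    qed
    then show ?thesis using zero[OF tf] by (simp add: LIMSEQ_const_iff)
  qed
  have AEbox: "AE x in lebesgue. x \<in> box a b \<longrightarrow> h x = 0" if ab: "cbox a b \<subseteq> S" for a b
  proof -
    let ?k = "\<lambda>x. indicator (box a b) x * h x"
    have boxS: "box a b \<subseteq> S" using ab box_subset_cbox by blast
    have "integrable (lebesgue_on S) (\<lambda>x. indicator (cbox a b) x * h x)"
      using h ab by (auto simp: locally_integrable_on_def)
    then have "integrable lebesgue (\<lambda>x. indicator S x *\<^sub>R (indicator (cbox a b) x * h x))"
      by (subst (asm) integrable_restrict_space) auto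
    then have "integrable lebesgue (\<lambda>x. indicator (box a b) x *\<^sub>R (indicator S x *\<^sub>R (indicator (cbox a b) x * h x)))"
      by (rule integrable_mult_indicator[rotated]) simp
    moreover have "(\<lambda>x. indicator (box a b) x *\<^sub>R (indicator S x *\<^sub>R (indicator (cbox a b) x * h x))) = ?k"
      using ab boxS box_subset_cbox[of a b] by (auto simp: indicator_def fun_eq_iff)
    ultimately have ik: "integrable lebesgue ?k" by simp
    \<comment> \<open>The box argument works with Borel sets and \<open>lborel\<close>, while h is
      only Lebesgue measurable; k' is a Borel version of h on the box.\<close>
    then obtain k' where k'[measurable]: "k' \<in> borel_measurable lborel" and eq: "AE x in lborel. ?k x = k' x"
      using completion_ex_borel_measurable_real[OF borel_measurable_integrable[OF ik]] by auto
    have eq': "AE x in lebesgue. ?k x = k' x" using eq by (rule AE_completion)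
    have mk: "k' \<in> borel_measurable lebesgue" by (rule measurable_completion[OF k'])
    have ik': "integrable lebesgue k'"
      using integrable_cong_AE[OF borel_measurable_integrable[OF ik] mk eq'] ik by simp
    then have ikb: "integrable lborel k'" using integrable_completion[OF k'] by simp
    have bx: "integral\<^sup>L lborel (\<lambda>x. indicator (box l u) x * k' x) = 0" for l u
    proof -
      obtain l' u' where lu: "box l u \<inter> box a b = box l' u'" "cbox l' u' \<subseteq> S"
      proof (cases "box l u \<inter> box a b = {}")
        case True
        \<comment> \<open>The corners produced for an empty intersection may still bound a nonempty
          closed box leaving S, so corners with an empty closed box are used instead.\<close>
        have "box One (0::real^'n) = {}" "cbox One (0::real^'n) = {}"
          by (auto simp: box_eq_empty intro: SOME_Basis)
        with True that[of One 0] show thesis by auto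
      next
        case False
        obtain l' u' where 1: "box l u \<inter> box a b = box l' u'" using box_Int_box by blast
        have "box l' u' \<noteq> {}" "box l' u' \<subseteq> box a b" using 1 False by auto
        then have "cbox l' u' \<subseteq> cbox a b" by (metis closure_box closure_mono box_ne_empty(2) bot.extremum_uniqueI)
        with 1 ab that show thesis by blast
      qed
      have "integral\<^sup>L lborel (\<lambda>x. indicator (box l u) x * k' x) = integral\<^sup>L lebesgue (\<lambda>x. indicator (box l u) x * k' x)"
        by (rule integral_completion[symmetric]) measurable
      also have "\<dots> = integral\<^sup>L lebesgue (\<lambda>x. indicator (box l u) x * ?k x)"
      proof (rule integral_cong_AE)
        show "(\<lambda>x. indicator (box l u) x * k' x) \<in> borel_measurable lebesgue"
          using mk by (intro borel_measurable_times borel_measurable_indicator) auto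
        show "(\<lambda>x. indicator (box l u) x * ?k x) \<in> borel_measurable lebesgue"
          using borel_measurable_integrable[OF ik] by (rule borel_measurable_times[rotated]) (rule borel_measurable_indicator, simp)
      qed (use eq' in auto)
      also have "(\<lambda>x. indicator (box l u) x * ?k x) = (\<lambda>x. indicator S x *\<^sub>R (indicator (box l' u') x * h x))"
      proof
        fix x
        show "indicator (box l u) x * ?k x = indicator S x *\<^sub>R (indicator (box l' u') x * h x)"
          using boxS lu(1) by (auto simp: indicator_def)
      qed
      also have "integral\<^sup>L lebesgue \<dots> = integral\<^sup>L (lebesgue_on S) (\<lambda>x. indicator (box l' u') x * h x)"
        by (subst integral_restrict_space) auto
      also have "\<dots> = 0" by (rule boxz[OF lu(2)])
      finally show ?thesis .
    qed
    have "integral\<^sup>L lborel k' = integral\<^sup>L lborel (\<lambda>x. indicator (box a b) x * k' x)"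
      by (rule integral_cong_AE) (use eq in \<open>auto simp: indicator_def\<close>)
    then have "AE x in lborel. k' x = 0"
      using bx ikb by (intro AE_zero_if_box_integrals_zero) auto
    then have "AE x in lebesgue. k' x = 0" by (rule AE_completion)
    with eq' show ?thesis by (rule AE_mp[OF AE_conjI]) (auto intro!: AE_I2 simp: indicator_def split: if_splits)
  qed
  obtain \<D> where \<D>: "countable \<D>" "\<D> \<subseteq> Pow S" "\<And>X. X \<in> \<D> \<Longrightarrow> \<exists>a b. X = cbox a b" "\<Union>\<D> = S"
    using open_countable_Union_open_cbox[OF S] by metis
  have "AE x in lebesgue. \<forall>X\<in>\<D>. x \<in> X \<longrightarrow> h x = 0"
  proof (subst AE_ball_countable[OF \<D>(1)], rule ballI)
    fix X assume X: "X \<in> \<D>"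
    then obtain a b where ab: "X = cbox a b" using \<D>(3) by blast
    \<comment> \<open>S is covered by closed boxes but h is controlled on open ones; the faces are
      null sets.\<close>
    have "AE x in lebesgue. x \<notin> cbox a b - box a b"
      by (rule AE_not_in) (metis negligible_iff_null_sets negligible_frontier_interval)
    moreover have "cbox a b \<subseteq> S" using X ab \<D>(2) by blast
    note AEbox[OF this]
    ultimately show "AE x in lebesgue. x \<in> X \<longrightarrow> h x = 0"
      unfolding ab by eventually_elim blast
  qed
  then have "AE x in lebesgue. x \<in> S \<longrightarrow> h x = 0"
    by (rule AE_mp) (use \<D>(4) in \<open>auto intro!: AE_I2\<close>)
  then show ?thesis by (subst AE_restrict_space_iff) auto
qed

lemma continuous_locally_integrable:
  assumes "open S" "continuous_on S v" shows "locally_integrable_on S v"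
  unfolding locally_integrable_on_def
proof (intro allI impI)
  fix L assume L: "compact L \<and> L \<subseteq> S"
  then have "integrable lborel (\<lambda>x. indicator L x *\<^sub>R v x)"
    using assms by (intro borel_integrable_compact) (auto intro: continuous_on_subset)
  then have "integrable lebesgue (\<lambda>x. indicator L x *\<^sub>R v x)"
    using integrable_completion[OF borel_measurable_integrable] by blast
  moreover have "(\<lambda>x. indicator L x *\<^sub>R v x) = (\<lambda>x. indicator S x *\<^sub>R (indicator L x * v x))"
    using L by (auto simp: indicator_def fun_eq_iff)
  ultimately show "integrable (lebesgue_on S) (\<lambda>x. indicator L x * v x)"
    using assms by (subst integrable_restrict_space) auto
qed

text \<open>The product of u and \<psi>, extended by zero, is a compactly supported C^1 function, so
  its gradient has integral zero.\<close>

lemma classical_weak_identity: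
  assumes S: "open S" and u: "\<And>x. x \<in> S \<Longrightarrow> GDERIV u x :> G x" "continuous_on S G" and \<psi>: "C1c S \<psi> \<psi>'"
  shows "integral\<^sup>L (lebesgue_on S) (\<lambda>x. u x * \<psi>' x $ i) = - integral\<^sup>L (lebesgue_on S) (\<lambda>x. G x $ i * \<psi> x)"
proof -
  obtain K where K: "compact K" "K \<subseteq> S" "\<And>x. x \<notin> K \<Longrightarrow> \<psi> x = 0 \<and> \<psi>' x = 0"
    using \<psi> unfolding C1c_def by blast
  have c: "continuous_on UNIV \<psi>" "continuous_on UNIV \<psi>'" and d: "\<And>x. GDERIV \<psi> x :> \<psi>' x"
    using C1c_continuous[OF \<psi>] \<psi> by (auto simp: C1c_def)
  have cu: "continuous_on S u" using u(1) by (rule GDERIV_continuous_on)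
  let ?F' = "\<lambda>x. u x *\<^sub>R \<psi>' x + \<psi> x *\<^sub>R G x"
  have F: "C1c S (\<lambda>x. if x \<in> S then u x * \<psi> x else 0) (\<lambda>x. if x \<in> S then ?F' x else 0)"
    by (rule C1c_extend[OF S K(1,2)])
      (use K u cu d in \<open>auto intro!: GDERIV_mult continuous_intros continuous_on_subset[OF c(1)] continuous_on_subset[OF c(2)]\<close>)
  note li = continuous_locally_integrable[OF S]
  have i1: "integrable (lebesgue_on S) (\<lambda>x. u x * \<psi>' x $ i)"
    by (rule integrable_mult_compact_support[OF S li[OF cu] K(1,2)]) (use K c in \<open>auto intro!: continuous_intros\<close>)
  have i2: "integrable (lebesgue_on S) (\<lambda>x. G x $ i * \<psi> x)"
    by (rule integrable_mult_compact_support[OF S li K(1,2)]) (use K c u in \<open>auto intro!: continuous_intros\<close>)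
  let ?H = "\<lambda>x. if x \<in> S then ?F' x else 0"
  have cH: "(\<lambda>x. ?H x $ i) \<in> borel_measurable borel"
    using F by (intro borel_measurable_continuous_onI continuous_intros) (auto simp: C1c_def)
  have "0 = integral\<^sup>L lborel (\<lambda>x. ?H x $ i)"
    using integral_C1c_gradient[OF C1c_mono[OF F subset_UNIV]] by simp
  also have "\<dots> = integral\<^sup>L lebesgue (\<lambda>x. ?H x $ i)"
    using cH by (intro integral_completion[symmetric]) simp
  also have "(\<lambda>x. ?H x $ i) = (\<lambda>x. indicator S x *\<^sub>R (u x * \<psi>' x $ i + G x $ i * \<psi> x))"
    by (auto simp: fun_eq_iff)
  also have "integral\<^sup>L lebesgue \<dots> = integral\<^sup>L (lebesgue_on S) (\<lambda>x. u x * \<psi>' x $ i + G x $ i * \<psi> x)"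
    using S by (subst integral_restrict_space) auto
  also have "\<dots> = integral\<^sup>L (lebesgue_on S) (\<lambda>x. u x * \<psi>' x $ i) + integral\<^sup>L (lebesgue_on S) (\<lambda>x. G x $ i * \<psi> x)"
    using i1 i2 by (rule Bochner_Integration.integral_add)
  finally show ?thesis by simp
qed

text \<open>Both fields satisfy the same integration by parts against every test function, so the
  fundamental lemma identifies them. This replaces the unspecified weak gradient of a strong
  solution by its continuous classical gradient.\<close>

lemma weak_grad_AE_classical:
  assumes S: "open S" and u: "\<And>x. x \<in> S \<Longrightarrow> GDERIV u x :> G x" "continuous_on S G"
    and w: "weak_grad p S u V" "p \<ge> 1"
  shows "AE x in lebesgue_on S. V x = G x"
proof -
  have "AE x in lebesgue_on S. V x $ i - G x $ i = 0" for i
  proof (rule fundamental_lemma[OF S])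
    have V: "locally_integrable_on S (\<lambda>x. V x $ i)"
      by (rule in_Lp_locally_integrable[OF S _ w(2)], rule weak_gradD[OF w(1)])+
    have G: "locally_integrable_on S (\<lambda>x. G x $ i)"
      using u(2) S by (intro continuous_locally_integrable continuous_intros)
    show "locally_integrable_on S (\<lambda>x. V x $ i - G x $ i)"
      using V G unfolding locally_integrable_on_def by (auto simp: right_diff_distrib)
    fix \<phi> assume \<phi>: "test_function S \<phi>"
    obtain K where K: "compact K" "K \<subseteq> S" "\<And>x. x \<notin> K \<Longrightarrow> \<phi> x = 0"
      using test_function_C1c[OF \<phi>] unfolding C1c_def by blast
    note c = C1c_continuous[OF test_function_C1c[OF \<phi>]]
    have "integral\<^sup>L (lebesgue_on S) (\<lambda>x. (V x $ i - G x $ i) * \<phi> x) =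
       integral\<^sup>L (lebesgue_on S) (\<lambda>x. V x $ i * \<phi> x) - integral\<^sup>L (lebesgue_on S) (\<lambda>x. G x $ i * \<phi> x)"
      using integrable_mult_compact_support[OF S V K(1,2) c K(3)] integrable_mult_compact_support[OF S G K(1,2) c K(3)]
      by (simp add: left_diff_distrib)
    also have "\<dots> = 0"
      using classical_weak_identity[OF S u test_function_C1c[OF \<phi>], of i] weak_gradD(3)[OF w(1) \<phi>, of i] by simp
    finally show "integral\<^sup>L (lebesgue_on S) (\<lambda>x. (V x $ i - G x $ i) * \<phi> x) = 0" .
  qed
  then have "AE x in lebesgue_on S. \<forall>i. V x $ i - G x $ i = 0" by (simp add: AE_all_countable)
  then show ?thesis by (rule AE_mp) (auto intro!: AE_I2 simp: vec_eq_iff)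
qed

section \<open>Ordinary differential equations\<close>

text \<open>Picard iteration without a contraction argument: the factorial in the bound for
  successive differences gives uniform convergence on every \<open>{0..T}\<close>, so the solution
  is global at once.\<close>

lemma picard_forward:
  fixes X :: "'a::euclidean_space \<Rightarrow> 'a"
  assumes lip: "L-lipschitz_on UNIV X"
  obtains z where "z 0 = x0" "\<And>t. t \<ge> 0 \<Longrightarrow> (z has_vector_derivative X (z t)) (at t within {0..})"
proof -
  have L: "L \<ge> 0" by (rule lipschitz_on_nonneg[OF lip])
  have lipX: "norm (X x - X y) \<le> L * norm (x - y)" for x y
    using lipschitz_onD[OF lip, of x y] by (simp add: dist_norm)
  have cX: "continuous_on UNIV X" by (rule lipschitz_on_continuous_on[OF lip])
  define zs :: "nat \<Rightarrow> real \<Rightarrow> 'a" where "zs n = ((\<lambda>u t. x0 + integral {0..t} (\<lambda>s. X (u s))) ^^ n) (\<lambda>t. x0)" for n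
  have zs0: "zs 0 = (\<lambda>t. x0)" and zsS: "zs (Suc n) = (\<lambda>t. x0 + integral {0..t} (\<lambda>s. X (zs n s)))" for n
    by (auto simp: zs_def)
  have cont: "continuous_on {0..T} (zs n)" for n T
  proof (induction n)
    case (Suc n)
    have "(\<lambda>s. X (zs n s)) integrable_on {0..T}"
      by (intro integrable_continuous_real continuous_on_compose2[OF cX Suc]) auto
    then show ?case unfolding zsS by (intro continuous_intros indefinite_integral_continuous_1)
  qed (simp add: zs0)
  have contX: "continuous_on {0..T} (\<lambda>s. X (zs n s))" for n T
    by (intro continuous_on_compose2[OF cX cont]) auto
  define B where "B = norm (X x0)"
  have step: "norm (zs (Suc n) t - zs n t) \<le> B * L ^ n * t ^ Suc n / fact (Suc n)" if "t \<ge> 0" for n t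
    using that
  proof (induction n arbitrary: t)
    case 0
    then show ?case by (simp add: zsS zs0 B_def)
  next
    case (Suc n)
    let ?g = "\<lambda>s. L * (B * L ^ n * s ^ Suc n / fact (Suc n))"
    have gi: "(?g has_integral B * L ^ Suc n * t ^ Suc (Suc n) / fact (Suc (Suc n))) {0..t}"
    proof -
      let ?c = "B * L ^ Suc n / fact (Suc (Suc n))"
      let ?G = "\<lambda>s. ?c * s ^ Suc (Suc n)"
      have alg: "B * L ^ Suc n / (N * F) * (N * s) = L * (B * L ^ n * s / F)" if "N \<noteq> 0" "F \<noteq> 0" for N F s :: real
        using that by (simp add: field_simps)
      have "(?G has_real_derivative ?g s) (at s within {0..t})" for s
      proof -
        have "?c * (real (Suc (Suc n)) * s ^ Suc n) = ?g s"
          unfolding fact_Suc[of "Suc n"] by (rule alg) auto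
        moreover have "Suc (Suc n) - Suc 0 = Suc n" by simp
        note DERIV_cmult[OF DERIV_pow[of "Suc (Suc n)" s "{0..t}"], of ?c, unfolded this]
        ultimately show ?thesis by (simp only:)
      qed
      then have "(?g has_integral (?G t - ?G 0)) {0..t}"
        using Suc.prems by (intro fundamental_theorem_of_calculus) (auto simp: has_real_derivative_iff_has_vector_derivative)
      then show ?thesis by simp
    qed
    have "zs (Suc (Suc n)) t - zs (Suc n) t = integral {0..t} (\<lambda>s. X (zs (Suc n) s) - X (zs n s))"
      unfolding zsS[of "Suc n"] zsS[of n] using contX[of t "Suc n"] contX[of t n]
      by (subst integral_diff) (auto intro: integrable_continuous_real simp: zsS)
    also have "norm \<dots> \<le> integral {0..t} ?g"
    proof (rule integral_norm_bound_integral)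
      show "(\<lambda>s. X (zs (Suc n) s) - X (zs n s)) integrable_on {0..t}"
        by (intro integrable_continuous_real continuous_intros contX)
      show "?g integrable_on {0..t}" using gi by blast
      show "norm (X (zs (Suc n) s) - X (zs n s)) \<le> ?g s" if "s \<in> {0..t}" for s
        using lipX[of "zs (Suc n) s" "zs n s"] mult_left_mono[OF Suc.IH[of s] L] that by simp
    qed
    also have "\<dots> = B * L ^ Suc n * t ^ Suc (Suc n) / fact (Suc (Suc n))" using gi by (rule integral_unique)
    finally show ?case .
  qed
  define z where "z t = x0 + (\<Sum>i. zs (Suc i) t - zs i t)" for t
  have ul: "uniform_limit {0..T} zs z sequentially" if "T \<ge> 0" for T
  proof -
    have "uniform_limit {0..T} (\<lambda>n t. \<Sum>i<n. zs (Suc i) t - zs i t) (\<lambda>t. \<Sum>i. zs (Suc i) t - zs i t) sequentially"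
    proof (rule Weierstrass_m_test)
      show "summable (\<lambda>n. B * T * (inverse (fact n) * (L * T) ^ n))" by (intro summable_mult summable_exp)
      fix n t assume t: "t \<in> {0..T}"
      have "norm (zs (Suc n) t - zs n t) \<le> B * L ^ n * t ^ Suc n / fact (Suc n)" using t step by auto
      also have "\<dots> \<le> B * L ^ n * T ^ Suc n / fact n"
        using t L that by (intro frac_le mult_left_mono power_mono fact_mono mult_nonneg_nonneg) (auto simp: B_def)
      finally show "norm (zs (Suc n) t - zs n t) \<le> B * T * (inverse (fact n) * (L * T) ^ n)"
        by (simp add: field_simps power_mult_distrib)
    qed
    then have "uniform_limit {0..T} (\<lambda>n t. x0 + (\<Sum>i<n. zs (Suc i) t - zs i t)) z sequentially"
      unfolding z_def by (intro uniform_limit_intros)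
    moreover have "x0 + (\<Sum>i<n. zs (Suc i) t - zs i t) = zs n t" for n t
      using sum_lessThan_telescope[of "\<lambda>i. zs i t" n] by (simp add: zs0)
    ultimately show ?thesis by simp
  qed
  have cz: "continuous_on {0..T} z" if "T \<ge> 0" for T
    by (rule uniform_limit_theorem[OF _ ul[OF that]]) (auto simp: cont)
  have cXz: "continuous_on {0..T} (\<lambda>s. X (z s))" if "T \<ge> 0" for T
    by (intro continuous_on_compose2[OF cX cz[OF that]]) auto
  have eq: "z t = x0 + integral {0..t} (\<lambda>s. X (z s))" if t: "t \<ge> 0" for t
  proof -
    have "(\<lambda>n. zs (Suc n) t) \<longlonglongrightarrow> z t"
      using tendsto_uniform_limitI[OF ul[OF t], of t] t by (intro LIMSEQ_Suc) auto
    moreover have "(\<lambda>n. integral {0..t} (\<lambda>s. X (zs n s))) \<longlonglongrightarrow> integral {0..t} (\<lambda>s. X (z s))"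
    proof (rule LIM_zero_cancel, rule tendstoI)
      fix e :: real assume e: "e > 0"
      \<comment> \<open>The two integrals differ by at most t (L + 1) d. Adding 1 to L and to t
        keeps the denominator positive, and the bound becomes e / 2.\<close>
      define d where "d = e / (2 * (L + 1) * (t + 1))"
      have d: "d > 0" using e L t by (simp add: d_def)
      have "\<forall>\<^sub>F n in sequentially. \<forall>s\<in>{0..t}. dist (zs n s) (z s) < d"
        using ul[OF t] d by (rule uniform_limitD)
      then show "\<forall>\<^sub>F n in sequentially. dist (integral {0..t} (\<lambda>s. X (zs n s)) - integral {0..t} (\<lambda>s. X (z s))) 0 < e"
      proof (rule eventually_mono)
        fix n assume n: "\<forall>s\<in>{0..t}. dist (zs n s) (z s) < d"
        have "integral {0..t} (\<lambda>s. X (zs n s)) - integral {0..t} (\<lambda>s. X (z s)) = integral {0..t} (\<lambda>s. X (zs n s) - X (z s))"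
          using contX[of t n] cXz[OF t] by (subst integral_diff) (auto intro: integrable_continuous_real)
        also have "norm \<dots> \<le> integral {0..t} (\<lambda>s. (L + 1) * d)"
        proof (rule integral_norm_bound_integral)
          show "(\<lambda>s. X (zs n s) - X (z s)) integrable_on {0..t}"
            by (intro integrable_continuous_real continuous_intros contX cXz t)
          fix s assume "s \<in> {0..t}"
          then have "norm (zs n s - z s) \<le> d" using n by (auto simp: dist_norm less_imp_le)
          then have "L * norm (zs n s - z s) \<le> (L + 1) * d" using L d by (intro mult_mono) auto
          then show "norm (X (zs n s) - X (z s)) \<le> (L + 1) * d" using lipX order_trans by blast
        qed (rule integrable_const_ivl)
        also have "\<dots> = t * ((L + 1) * d)" using t by simp
        also have "\<dots> \<le> (t + 1) * ((L + 1) * d)" using L d by (intro mult_right_mono) auto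
        also have "\<dots> = e / 2"
        proof -
          have "b * (a * (e / (2 * a * b))) = e / 2" if "a \<noteq> 0" "b \<noteq> 0" for a b :: real
            using that by (simp add: field_simps)
          from this[of "L + 1" "t + 1"] show ?thesis using L t by (simp add: d_def del: distrib_left_numeral distrib_right_numeral)
        qed
        also have "\<dots> < e" using e by simp
        finally show "dist (integral {0..t} (\<lambda>s. X (zs n s)) - integral {0..t} (\<lambda>s. X (z s))) 0 < e"
          by (simp add: dist_norm)
      qed
    qed
    then have "(\<lambda>n. zs (Suc n) t) \<longlonglongrightarrow> x0 + integral {0..t} (\<lambda>s. X (z s))"
      unfolding zsS by (intro tendsto_intros)
    ultimately show ?thesis by (rule LIMSEQ_unique)
  qed
  have der: "(z has_vector_derivative X (z t)) (at t within {0..})" if t: "t \<ge> 0" for t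
  proof -
    have "((\<lambda>u. integral {0..u} (\<lambda>s. X (z s))) has_vector_derivative X (z t)) (at t within {0..t+1})"
      using t by (intro integral_has_vector_derivative cXz) auto
    then have "((\<lambda>u. x0 + integral {0..u} (\<lambda>s. X (z s))) has_vector_derivative X (z t)) (at t within {0..t+1})"
      by (auto intro!: derivative_eq_intros)
    then have "(z has_vector_derivative X (z t)) (at t within {0..t+1})"
      by (rule has_vector_derivative_transform[rotated 2]) (use t eq in auto)
    moreover have "at t within {0..t+1} = at t within {0..}"
      by (rule at_within_nhd[of t "{..<t+1}"]) (use t in auto)
    ultimately show ?thesis by simp
  qed
  show thesis using eq[of 0] der by (intro that[of z]) auto
qed

text \<open>Backward time is forward time for - X; the two halves meet at time 0 with the same value
  and the same derivative.\<close>

lemma ode_solution: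
  fixes X :: "'a::euclidean_space \<Rightarrow> 'a"
  assumes lip: "L-lipschitz_on UNIV X"
  obtains z where "z 0 = x0" "\<And>t. (z has_vector_derivative X (z t)) (at t)"
proof -
  obtain u where u: "u 0 = x0" "\<And>t. t \<ge> 0 \<Longrightarrow> (u has_vector_derivative X (u t)) (at t within {0..})"
    using picard_forward[OF lip] by blast
  have "L-lipschitz_on UNIV (\<lambda>x. - X x)" using lip by (simp add: lipschitz_on_def dist_minus)
  then obtain v where v: "v 0 = x0" "\<And>t. t \<ge> 0 \<Longrightarrow> (v has_vector_derivative - X (v t)) (at t within {0..})"
    using picard_forward by blast
  define z where "z t = (if t \<in> {0..} then u t else v (- t))" for t
  have "(z has_vector_derivative X (z t)) (at t)" for t
  proof -
    have cl: "{..0} \<union> (closure {0..} \<inter> closure {..0}) = {..0::real}" by auto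
    have "((\<lambda>t. if t \<in> {0..} then u t else v (- t)) has_vector_derivative
        (if t \<in> {0..} then X (u t) else X (v (- t)))) (at t within UNIV)"
    proof (rule has_vector_derivative_If_within_closures[of t "{0..}" "{..0}"])
      show "((\<lambda>t. v (- t)) has_vector_derivative X (v (- t))) (at t within {..0} \<union> (closure {0..} \<inter> closure {..0}))"
        if "t \<in> {..0} \<union> (closure {0..} \<inter> closure {..0})"
      proof -
        have "(v has_vector_derivative - X (v (- t))) (at (- t) within uminus ` {..0})"
          using v(2)[of "- t"] that by (simp add: image_uminus_atMost)
        then have "(v \<circ> uminus has_vector_derivative (- 1) *\<^sub>R (- X (v (- t)))) (at t within {..0})"
          by (intro vector_diff_chain_within) (auto intro!: derivative_eq_intros)
        then show ?thesis unfolding cl by (simp add: o_def)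
      qed
    qed (use u v in auto)
    then show ?thesis by (simp add: z_def[abs_def] if_distrib)
  qed
  then show thesis using u by (intro that[of z]) (auto simp: z_def)
qed

text \<open>Gronwall's argument: the weighted squared distance \<open>\<phi>\<close> is
  nonincreasing by the Lipschitz bound, nonnegative, and zero at a.\<close>

lemma ode_unique_forward:
  fixes X :: "'a::euclidean_space \<Rightarrow> 'a"
  assumes lip: "L-lipschitz_on UNIV X" and "a \<le> t" "u a = v a"
    and u: "\<And>t. (u has_vector_derivative X (u t)) (at t)" and v: "\<And>t. (v has_vector_derivative X (v t)) (at t)"
  shows "u t = v t"
proof -
  let ?d = "\<lambda>t. u t - v t"
  define \<phi> where "\<phi> t = exp (- 2 * L * t) * (?d t \<bullet> ?d t)" for t
  define \<phi>' where "\<phi>' t = exp (- 2 * L * t) * (2 * (?d t \<bullet> (X (u t) - X (v t))) - 2 * L * (?d t \<bullet> ?d t))" for t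
  have "\<phi> t \<le> \<phi> a"
  proof (rule DERIV_nonpos_imp_nonincreasing[OF assms(2)])
    fix s
    have "((\<lambda>t. ?d t) has_vector_derivative (X (u s) - X (v s))) (at s)"
      by (intro has_vector_derivative_diff u v)
    then have "((\<lambda>t. ?d t \<bullet> ?d t) has_real_derivative 2 * (?d s \<bullet> (X (u s) - X (v s)))) (at s)"
      unfolding has_vector_derivative_def has_field_derivative_def
      by (intro has_derivative_eq_rhs[OF has_derivative_inner]) (auto simp: inner_commute fun_eq_iff)
    note inner = this
    have "((\<lambda>t. exp (- 2 * L * t)) has_real_derivative - 2 * L * exp (- 2 * L * s)) (at s)"
      by (auto intro!: derivative_eq_intros)
    from DERIV_mult[OF this inner] have "(\<phi> has_real_derivative \<phi>' s) (at s)"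
      unfolding \<phi>_def by (rule DERIV_cong) (simp add: \<phi>'_def algebra_simps)
    moreover have "\<phi>' s \<le> 0"
    proof -
      have "?d s \<bullet> (X (u s) - X (v s)) \<le> norm (?d s) * norm (X (u s) - X (v s))" by (rule norm_cauchy_schwarz)
      also have "\<dots> \<le> norm (?d s) * (L * norm (?d s))"
        using lipschitz_onD[OF lip, of "u s" "v s"] by (intro mult_left_mono) (auto simp: dist_norm)
      also have "\<dots> = L * (?d s \<bullet> ?d s)" by (simp add: power2_norm_eq_inner[symmetric] power2_eq_square)
      finally show ?thesis unfolding \<phi>'_def by (simp add: mult_le_0_iff)
    qed
    ultimately show "\<exists>y. (\<phi> has_real_derivative y) (at s) \<and> y \<le> 0" by blast
  qed
  then have "exp (- 2 * L * t) * (?d t \<bullet> ?d t) \<le> 0" using assms(3) by (simp add: \<phi>_def)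
  then have "?d t \<bullet> ?d t \<le> 0" by (simp add: mult_le_0_iff not_le[symmetric])
  then have "?d t \<bullet> ?d t = 0" by (intro antisym) auto
  then show ?thesis by simp
qed

lemma ode_unique:
  fixes X :: "'a::euclidean_space \<Rightarrow> 'a"
  assumes lip: "L-lipschitz_on UNIV X" and eq: "u a = v a"
    and u: "\<And>t. (u has_vector_derivative X (u t)) (at t)" and v: "\<And>t. (v has_vector_derivative X (v t)) (at t)"
  shows "u t = v t"
proof (cases "a \<le> t")
  case True
  then show ?thesis using ode_unique_forward[OF lip _ eq u v] by blast
next
  case False
  have lip': "L-lipschitz_on UNIV (\<lambda>x. - X x)" using lip by (simp add: lipschitz_on_def dist_minus)
  have rev: "((\<lambda>t. w (- t)) has_vector_derivative - X (w (- t))) (at t)"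
    if w: "\<And>t. (w has_vector_derivative X (w t)) (at t)" for w t
  proof -
    have "(w \<circ> uminus has_vector_derivative (- 1) *\<^sub>R X (w (- t))) (at t)"
      by (intro vector_diff_chain_at w) (auto intro!: derivative_eq_intros)
    then show ?thesis by (simp add: o_def)
  qed
  have "u (- (- t)) = v (- (- t))"
    by (rule ode_unique_forward[OF lip' _ _ rev[OF u] rev[OF v], of "- a"]) (use False eq in auto)
  then show ?thesis by simp
qed

section \<open>The sublevel domain\<close>

lemma inner_2: "(x::real^2) \<bullet> y = x $ 1 * y $ 1 + x $ 2 * y $ 2"
  by (simp add: inner_vec_def sum_2)

text \<open>Counterclockwise quarter turn. The Hamiltonian system of g reads z' = rot (G z), so its
  orbits are tangent to the level lines of g.\<close>

definition rot :: "real^2 \<Rightarrow> real^2" where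
  "rot v = vector [- (v $ 2), v $ 1]"

lemma rot_nth [simp]: "rot v $ 1 = - (v $ 2)" "rot v $ 2 = v $ 1"
  by (simp_all add: rot_def)

lemma inner_rot_rot [simp]: "rot v \<bullet> rot w = v \<bullet> w"
  by (simp add: inner_2)

lemma inner_rot_self [simp]: "v \<bullet> rot v = 0" "rot v \<bullet> v = 0"
  by (simp_all add: inner_2)

lemma norm_rot [simp]: "norm (rot v) = norm v"
  by (simp add: norm_eq_sqrt_inner)

lemma rot_diff: "rot v - rot w = rot (v - w)"
  by (simp add: vec_eq_iff forall_2)

lemma bounded_linear_rot: "bounded_linear rot"
proof -
  have "linear rot" by (rule linearI) (simp_all add: vec_eq_iff forall_2)
  then show ?thesis by (simp add: linear_conv_bounded_linear)
qed

lemmas continuous_on_rot [continuous_intros] = bounded_linear.continuous_on[OF bounded_linear_rot]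

lemma orthogonal_rot_imp_parallel:
  assumes "x \<bullet> rot v = 0" "v \<noteq> 0"
  shows "x = ((x \<bullet> v) / (v \<bullet> v)) *\<^sub>R v"
proof -
  have v: "v \<bullet> v \<noteq> 0" using assms(2) by simp
  have a: "x $ 2 * v $ 1 = x $ 1 * v $ 2" using assms(1) by (simp add: inner_2)
  have "(v \<bullet> v) * x $ 1 = (x \<bullet> v) * v $ 1"
  proof -
    have "(v \<bullet> v) * x $ 1 = x $ 1 * v $ 1 * v $ 1 + v $ 2 * (x $ 1 * v $ 2)" by (simp add: inner_2 algebra_simps)
    then show ?thesis unfolding a[symmetric] by (simp add: inner_2 algebra_simps)
  qed
  moreover have "(v \<bullet> v) * x $ 2 = (x \<bullet> v) * v $ 2"
  proof -
    have "(v \<bullet> v) * x $ 2 = x $ 2 * v $ 2 * v $ 2 + v $ 1 * (x $ 2 * v $ 1)" by (simp add: inner_2 algebra_simps)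
    then show ?thesis unfolding a by (simp add: inner_2 algebra_simps)
  qed
  ultimately show ?thesis using v by (simp add: vec_eq_iff forall_2 field_simps)
qed

lemma GDERIV_lipschitz:
  assumes "convex C" "\<And>x. x \<in> C \<Longrightarrow> GDERIV f x :> f' x" "\<And>x. x \<in> C \<Longrightarrow> norm (f' x) \<le> B"
    and "x \<in> C" "y \<in> C"
  shows "\<bar>f x - f y\<bar> \<le> B * norm (x - y)"
proof -
  have B: "B \<ge> 0" using assms(3)[OF assms(4)] norm_ge_zero order_trans by blast
  have "norm (f x - f y) \<le> B * norm (x - y)"
  proof (rule differentiable_bound[OF assms(1) _ _ assms(4,5)])
    fix z assume z: "z \<in> C"
    show "(f has_derivative (\<lambda>h. h \<bullet> f' z)) (at z within C)"
      using assms(2)[OF z] unfolding gderiv_def by (rule has_derivative_at_withinI)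
    show "onorm (\<lambda>h. h \<bullet> f' z) \<le> B"
    proof (rule onorm_bound[OF B])
      show "norm (h \<bullet> f' z) \<le> B * norm h" for h
        using Cauchy_Schwarz_ineq2[of h "f' z"] mult_left_mono[OF assms(3)[OF z], of "norm h"]
        by (simp add: mult.commute)
    qed
  qed
  then show ?thesis by simp
qed

lemma GDERIV_taylor:
  fixes f :: "'a::real_inner \<Rightarrow> real"
  assumes C: "convex C" "x \<in> C" "y \<in> C" and f: "\<And>x. x \<in> C \<Longrightarrow> GDERIV f x :> f' x"
    and lip: "\<And>x y. x \<in> C \<Longrightarrow> y \<in> C \<Longrightarrow> norm (f' x - f' y) \<le> B * norm (x - y)" and B: "B \<ge> 0"
  shows "\<bar>f x - f y - (x - y) \<bullet> f' y\<bar> \<le> B * (norm (x - y))\<^sup>2"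
proof -
  have seg: "closed_segment y x \<subseteq> C" using C by (simp add: closed_segment_subset)
  have "norm (f x - f y - (\<lambda>h. h \<bullet> f' y) (x - y)) \<le> norm (x - y) * (B * norm (x - y))"
  proof (rule differentiable_bound_linearization[where S = "closed_segment y x" and f' = "\<lambda>z h. h \<bullet> f' z"])
    show "y + t *\<^sub>R (x - y) \<in> closed_segment y x" if "t \<in> {0..1}" for t
      using that by (auto simp: in_segment algebra_simps)
    show "y \<in> closed_segment y x" by simp
    fix z assume z: "z \<in> closed_segment y x"
    show "(f has_derivative (\<lambda>h. h \<bullet> f' z)) (at z within closed_segment y x)"
      using f[of z] z seg unfolding gderiv_def by (auto intro: has_derivative_at_withinI)
    have nz: "norm (z - y) \<le> norm (x - y)" using z segment_bound(1) by (metis norm_minus_commute)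
    have "onorm (\<lambda>h. h \<bullet> (f' z - f' y)) \<le> B * norm (x - y)"
    proof (rule onorm_bound)
      fix h :: 'a
      have "norm (f' z - f' y) \<le> B * norm (x - y)"
        using lip[of z y] z seg C mult_left_mono[OF nz B] by (auto intro: order_trans)
      then have "norm h * norm (f' z - f' y) \<le> norm h * (B * norm (x - y))" by (intro mult_left_mono) auto
      then show "norm (h \<bullet> (f' z - f' y)) \<le> B * norm (x - y) * norm h"
        using Cauchy_Schwarz_ineq2[of h "f' z - f' y"] by (simp add: mult.commute)
    qed (use B in simp)
    then show "onorm ((\<lambda>h. h \<bullet> f' z) - (\<lambda>h. h \<bullet> f' y)) \<le> B * norm (x - y)"
      by (simp add: inner_diff_right fun_diff_def)
  qed
  then show ?thesis by (simp add: power2_eq_square mult_ac)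
qed

text \<open>One admissible g, with G its gradient and \<open>H i\<close> the gradient of the i-th
  component of G. The bounds m and M are shared by the whole family, so an estimate that depends on
  g only through them is uniform.\<close>

locale level_domain =
  fixes D E :: "(real^2) set" and g :: "real^2 \<Rightarrow> real" and G :: "real^2 \<Rightarrow> real^2"
    and H :: "2 \<Rightarrow> real^2 \<Rightarrow> real^2" and m M :: real
  assumes openD: "open D" and boundedD: "bounded D"
    and E: "open E" "connected E" "E \<noteq> {}" "E \<subseteq> D"
    and g_cont: "continuous_on (closure D) g"
    and g_deriv: "\<And>x. x \<in> D \<Longrightarrow> GDERIV g x :> G x"
    and G_deriv: "\<And>i x. x \<in> D \<Longrightarrow> GDERIV (\<lambda>x. G x $ i) x :> H i x"
    and H_cont: "\<And>i. continuous_on D (H i)"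
    and G_le: "\<And>x. x \<in> D \<Longrightarrow> norm (G x) \<le> M"
    and H_le: "\<And>i x. x \<in> D \<Longrightarrow> norm (H i x) \<le> M"
    and g_E: "\<And>x. x \<in> E \<Longrightarrow> g x \<le> 0" and g_frontier: "\<And>x. x \<in> frontier D \<Longrightarrow> g x > 0"
    and m: "m > 0" and G_ge: "\<And>x. x \<in> D \<Longrightarrow> g x = 0 \<Longrightarrow> m \<le> norm (G x)"
begin

abbreviation \<Omega> :: "(real^2) set" where "\<Omega> \<equiv> Omega D E g"
abbreviation \<Gamma> :: "(real^2) set" where "\<Gamma> \<equiv> frontier \<Omega>"

text \<open>The definite description is meaningful because E is connected, nonempty and contained in
  the interior, hence in exactly one of its components.\<close>

lemma Omega_component: "\<Omega> \<in> components (interior {x \<in> D. g x \<le> 0})" and E_subset_Omega: "E \<subseteq> \<Omega>"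
proof -
  let ?U = "interior {x \<in> D. g x \<le> 0}"
  have EU: "E \<subseteq> ?U" using E g_E by (intro interior_maximal) auto
  then have "?U \<noteq> {}" using E by blast
  then obtain C where C: "C \<in> components ?U" "E \<subseteq> C"
    using exists_component_superset[OF EU _ E(2)] by blast
  have uniq: "C' = C" if "C' \<in> components ?U \<and> E \<subseteq> C'" for C'
  proof -
    have "C' \<inter> C \<noteq> {}" using that C(2) E(3) by auto
    then show ?thesis using components_eq[of C' ?U C] that C(1) by simp
  qed
  have "\<Omega> = C"
    unfolding Omega_def by (rule the_equality) (rule conjI[OF C], rule uniq)
  with C show "\<Omega> \<in> components ?U" "E \<subseteq> \<Omega>" by simp_all
qed

lemma open_Omega: "open \<Omega>"
  using Omega_component open_components open_interior by blast

lemma Omega_nonempty: "\<Omega> \<noteq> {}"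
  using E_subset_Omega E(3) by blast

lemma Omega_subset: "\<Omega> \<subseteq> {x \<in> D. g x \<le> 0}"
  using in_components_subset[OF Omega_component] interior_subset by blast

lemma G_continuous: "continuous_on D G"
proof -
  have "continuous_on D (\<lambda>x. G x $ i)" for i
    using G_deriv[of _ i] unfolding gderiv_def
    by (intro continuous_at_imp_continuous_on ballI has_derivative_continuous) blast
  then show ?thesis
    using continuous_on_vec_lambda[of D "\<lambda>i x. G x $ i"] by simp
qed

lemma g_continuous: "continuous_on D g"
  using g_cont closure_subset continuous_on_subset by blast

lemma open_neg: "open {x \<in> D. g x < 0}"
  using continuous_open_preimage[OF g_continuous openD open_lessThan[of 0]]
  by (simp add: vimage_def Int_def)

text \<open>A point of \<Omega> with g = 0 would be a local maximum of g and hence have zero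
  gradient, against the lower bound m.\<close>

lemma g_neg_on_Omega: "x \<in> \<Omega> \<Longrightarrow> g x < 0"
proof (rule ccontr)
  assume x: "x \<in> \<Omega>" "\<not> g x < 0"
  then have xD: "x \<in> D" "g x = 0" using Omega_subset by force+
  have "(\<lambda>h. h \<bullet> G x) = (\<lambda>h. 0)"
  proof (rule has_derivative_local_max[of g "\<lambda>h. h \<bullet> G x" x])
    show "(g has_derivative (\<lambda>h. h \<bullet> G x)) (at x)" using g_deriv[OF xD(1)] by (simp add: gderiv_def)
    show "\<forall>\<^sub>F y in at x. g y \<le> g x"
      using open_Omega x(1) Omega_subset xD(2) by (auto simp: eventually_at_topological intro!: exI[of _ \<Omega>])
  qed
  then have "G x \<bullet> G x = 0" by metis
  then show False using G_ge[OF xD] m by simp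
qed

lemma connected_neg_subset_Omega:
  assumes "connected C" "C \<subseteq> {x \<in> D. g x < 0}" "C \<inter> \<Omega> \<noteq> {}"
  shows "C \<subseteq> \<Omega>"
proof -
  have "{x \<in> D. g x < 0} \<subseteq> interior {x \<in> D. g x \<le> 0}"
    using open_neg by (intro interior_maximal) auto
  then show ?thesis
    using components_maximal[OF Omega_component assms(1)] assms(2,3) by blast
qed

text \<open>Positivity of g on the frontier of D keeps the closure of \<Omega> inside D. If g were
  negative at a boundary point, a ball around it would be connected to \<Omega> within {g < 0} and
  hence belong to \<Omega>.\<close>

lemma closure_Omega_subset: "closure \<Omega> \<subseteq> D" and g_zero_on_frontier: "x \<in> \<Gamma> \<Longrightarrow> g x = 0"
proof -
  have *: "x \<in> D \<and> g x \<le> 0" if x: "x \<in> closure \<Omega>" for x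
  proof -
    have xD: "x \<in> closure D" using x closure_mono[of \<Omega> D] Omega_subset by blast
    have "closed {y \<in> closure D. g y \<le> 0}"
      using continuous_closed_preimage[OF g_cont closed_closure closed_atMost[of 0]]
      by (simp add: vimage_def Int_def)
    moreover have "\<Omega> \<subseteq> {y \<in> closure D. g y \<le> 0}" using Omega_subset closure_subset by blast
    ultimately have "g x \<le> 0" using x closure_minimal by blast
    moreover have "x \<notin> frontier D" using g_frontier[of x] calculation by force
    ultimately show ?thesis using xD openD by (simp add: frontier_def interior_open)
  qed
  then show "closure \<Omega> \<subseteq> D" by blast
  assume x: "x \<in> \<Gamma>"
  then have xc: "x \<in> closure \<Omega>" "x \<notin> \<Omega>" using open_Omega by (auto simp: frontier_def interior_open)
  show "g x = 0"
  proof (rule ccontr)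
    assume "g x \<noteq> 0"
    then have "x \<in> {x \<in> D. g x < 0}" using *[OF xc(1)] by auto
    then obtain e where e: "e > 0" "ball x e \<subseteq> {x \<in> D. g x < 0}" using open_neg open_contains_ball by blast
    obtain y where "y \<in> \<Omega>" "dist y x < e" using xc(1) e(1) closure_approachable by blast
    then have "ball x e \<inter> \<Omega> \<noteq> {}" by (auto simp: dist_commute)
    then have "ball x e \<subseteq> \<Omega>" using e(2) connected_ball by (intro connected_neg_subset_Omega) auto
    then show False using xc(2) centre_in_ball e(1) by blast
  qed
qed

lemma Gamma_subset_D: "\<Gamma> \<subseteq> D"
  using closure_Omega_subset by (auto simp: frontier_def)

lemma bounded_Omega: "bounded \<Omega>"
  using boundedD Omega_subset bounded_subset by blast

lemma compact_closure_Omega: "compact (closure \<Omega>)"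
  using bounded_Omega by (simp add: compact_closure)

lemma compact_Gamma: "compact \<Gamma>"
  using bounded_Omega by (simp add: compact_frontier_bounded)

lemma Gamma_nonempty: "\<Gamma> \<noteq> {}"
  using Omega_nonempty bounded_Omega not_bounded_UNIV by (metis frontier_eq_empty)

lemma norm_G_Gamma: "q \<in> \<Gamma> \<Longrightarrow> m \<le> norm (G q) \<and> norm (G q) \<le> M"
  using G_ge G_le Gamma_subset_D g_zero_on_frontier by blast

lemma M_pos: "M > 0"
  using Gamma_nonempty norm_G_Gamma m by fastforce

text \<open>Neither D nor \<Omega> need be convex, so Taylor and Lipschitz bounds are used on balls
  of this common radius around boundary points.\<close>

definition R :: real where "R = (SOME R. R > 0 \<and> (\<forall>q\<in>\<Gamma>. cball q R \<subseteq> D))"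

lemma R: "R > 0" "q \<in> \<Gamma> \<Longrightarrow> cball q R \<subseteq> D"
proof -
  obtain e where "e > 0" "(\<Union>x\<in>\<Gamma>. cball x e) \<subseteq> D"
    using compact_subset_open_imp_cball_epsilon_subset[OF compact_Gamma openD Gamma_subset_D] by blast
  then have "\<exists>R. R > 0 \<and> (\<forall>q\<in>\<Gamma>. cball q R \<subseteq> D)" by blast
  then have "R > 0 \<and> (\<forall>q\<in>\<Gamma>. cball q R \<subseteq> D)" unfolding R_def by (rule someI_ex)
  then show "R > 0" "q \<in> \<Gamma> \<Longrightarrow> cball q R \<subseteq> D" by auto
qed

text \<open>Each component of G has Lipschitz constant M, and the norm is at most the sum of the two
  components; hence the factor 2.\<close>

lemma G_lipschitz:
  assumes "convex C" "C \<subseteq> D" "x \<in> C" "y \<in> C"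
  shows "norm (G x - G y) \<le> 2 * M * norm (x - y)"
proof -
  have "\<bar>G x $ i - G y $ i\<bar> \<le> M * norm (x - y)" for i
    using assms by (intro GDERIV_lipschitz[where f' = "H i"] G_deriv H_le) auto
  from add_mono[OF this[of 1] this[of 2]] show ?thesis
    using norm_le_l1_cart[of "G x - G y"] by (simp add: sum_2)
qed

lemma g_taylor:
  assumes "convex C" "C \<subseteq> D" "x \<in> C" "y \<in> C"
  shows "\<bar>g x - g y - (x - y) \<bullet> G y\<bar> \<le> 2 * M * (norm (x - y))\<^sup>2"
  using assms M_pos by (intro GDERIV_taylor[of C] g_deriv G_lipschitz[of C]) auto

text \<open>A pushing time along - G q: the first bound makes the quadratic Taylor term at most 1/8
  of t (norm (G q))^2, the second keeps the push within R / 4. The radius \<open>r\<close> is so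
  small against \<tau> m that after time \<tau> every point of the ball of radius \<open>r\<close>
  has reached g < 0.\<close>

definition \<tau> :: real where "\<tau> = min (1 / (16 * M)) (R / (4 * M))"
definition r :: real where "r = min (\<tau> * m / 8) (R / 4)"

lemma \<tau>: "\<tau> > 0" "2 * M * \<tau> \<le> 1 / 8" "\<tau> * M \<le> R / 4"
proof -
  show "\<tau> > 0" using M_pos R(1) by (simp add: \<tau>_def)
  have "\<tau> \<le> 1 / (16 * M)" "\<tau> \<le> R / (4 * M)" by (auto simp: \<tau>_def)
  then show "2 * M * \<tau> \<le> 1 / 8" "\<tau> * M \<le> R / 4" using M_pos by (simp_all add: field_simps)
qed

lemma r: "r > 0" "r \<le> \<tau> * m / 8" "r \<le> R / 4"
  using \<tau>(1) m R(1) by (auto simp: r_def)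

text \<open>On the ball G differs from G q by at most norm (G q) / 64, so the linear term gains a
  factor 63/64; the quadratic remainder costs 1/8 = 8/64, which leaves 55/64.\<close>

lemma g_descent:
  assumes q: "q \<in> \<Gamma>" and x: "x \<in> ball q r" and t: "0 \<le> t" "t \<le> \<tau>"
  shows "x - t *\<^sub>R G q \<in> D" "g (x - t *\<^sub>R G q) \<le> g x - 55 / 64 * t * (norm (G q))\<^sup>2"
proof -
  let ?a = "norm (G q)"
  have a: "m \<le> ?a" "?a \<le> M" "?a > 0" using norm_G_Gamma[OF q] m by auto
  have nx: "norm (x - q) \<le> r" using x by (simp add: dist_norm norm_minus_commute less_imp_le)
  have ta: "t * ?a \<le> R / 4"
    using mult_mono[OF t(2) a(2)] t \<tau> by (auto intro: order_trans)
  have "norm (x - t *\<^sub>R G q - q) \<le> norm (x - q) + norm (t *\<^sub>R G q)"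
    using norm_triangle_ineq4[of "x - q" "t *\<^sub>R G q"] by (simp add: algebra_simps)
  also have "\<dots> \<le> R" using nx r(3) ta R(1) t by simp
  finally have xt: "x - t *\<^sub>R G q \<in> cball q R" by (simp add: dist_norm norm_minus_commute)
  then show "x - t *\<^sub>R G q \<in> D" using R(2)[OF q] by blast
  have xq: "x \<in> cball q R" "q \<in> cball q R"
    using nx r(3) R(1) by (auto simp: dist_norm norm_minus_commute)
  have "2 * M * r \<le> (2 * M * \<tau>) * m / 8" using r(2) M_pos mult_left_mono[of r "\<tau> * m / 8" "2 * M"] by simp
  also have "\<dots> \<le> ?a / 64" using mult_right_mono[OF \<tau>(2) less_imp_le[OF m]] a(1) by linarith
  finally have Lr: "2 * M * r \<le> ?a / 64" .
  have "norm (G x - G q) \<le> 2 * M * norm (x - q)"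
    by (rule G_lipschitz[OF convex_cball R(2)[OF q] xq])
  also have "\<dots> \<le> 2 * M * r" using nx M_pos by (intro mult_left_mono) auto
  also note Lr
  finally have dG: "norm (G x - G q) \<le> ?a / 64" .
  have "\<bar>(G x - G q) \<bullet> G q\<bar> \<le> ?a / 64 * ?a"
    using Cauchy_Schwarz_ineq2[of "G x - G q" "G q"] mult_right_mono[OF dG, of ?a] by simp
  moreover have "(G x - G q) \<bullet> G q = G x \<bullet> G q - ?a\<^sup>2" by (simp add: inner_diff_left power2_norm_eq_inner)
  ultimately have Gx: "G x \<bullet> G q \<ge> 63 / 64 * ?a\<^sup>2" unfolding power2_eq_square by linarith
  have "\<bar>g (x - t *\<^sub>R G q) - g x - (x - t *\<^sub>R G q - x) \<bullet> G x\<bar> \<le> 2 * M * (norm (x - t *\<^sub>R G q - x))\<^sup>2"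
    by (rule g_taylor[OF convex_cball R(2)[OF q] xt xq(1)])
  then have "g (x - t *\<^sub>R G q) \<le> g x - t * (G x \<bullet> G q) + 2 * M * (t * ?a)\<^sup>2"
    using t by (simp add: inner_commute)
  moreover have "2 * M * (t * ?a)\<^sup>2 \<le> 1 / 8 * (t * ?a\<^sup>2)"
  proof -
    have "2 * M * (t * ?a)\<^sup>2 = (2 * M * t) * (t * ?a\<^sup>2)" by (simp add: power2_eq_square)
    also have "\<dots> \<le> 1 / 8 * (t * ?a\<^sup>2)"
    proof (rule mult_right_mono)
      have "2 * M * t \<le> 2 * M * \<tau>" using t(2) M_pos by (intro mult_left_mono) auto
      then show "2 * M * t \<le> 1 / 8" using \<tau>(2) by linarith
    qed (use t in simp)
    finally show ?thesis .
  qed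
  moreover have "t * (G x \<bullet> G q) \<ge> 63 / 64 * (t * ?a\<^sup>2)" using mult_left_mono[OF Gx t(1)] by (simp add: mult_ac)
  ultimately show "g (x - t *\<^sub>R G q) \<le> g x - 55 / 64 * t * ?a\<^sup>2" by simp
qed

text \<open>Pushing two points near \<open>q\<close> in the direction \<open>- G q\<close> brings both into a common ball on which
  \<open>g\<close> is negative, so they lie in the same component.\<close>

lemma near_Gamma_Omega:
  assumes q: "q \<in> \<Gamma>" and x: "x \<in> ball q r"
  shows "x \<in> \<Omega> \<longleftrightarrow> g x < 0"
proof
  assume gx: "g x < 0"
  let ?a = "norm (G q)" and ?N = "{x \<in> D. g x < 0}"
  have a: "m \<le> ?a" "?a \<le> M" "?a > 0" using norm_G_Gamma[OF q] m by auto
  obtain p where p: "p \<in> \<Omega>" "dist p q < r"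
    using q r(1) closure_approachable by (metis DiffD1 frontier_def)
  let ?seg = "\<lambda>y. closed_segment y (y - \<tau> *\<^sub>R G q)"
  let ?B = "(\<lambda>y. y - \<tau> *\<^sub>R G q) ` ball q r"
  have seg: "?seg y \<subseteq> ?N" if y: "y \<in> ball q r" "g y < 0" for y
  proof
    fix w assume "w \<in> ?seg y"
    then obtain u where u: "0 \<le> u" "u \<le> 1" "w = y - (u * \<tau>) *\<^sub>R G q"
      by (auto simp: in_segment algebra_simps)
    have ut: "0 \<le> u * \<tau>" "u * \<tau> \<le> \<tau>" using u \<tau>(1) by (auto simp: mult_left_le_one_le)
    have "0 \<le> 55 / 64 * (u * \<tau>) * ?a\<^sup>2" using ut by simp
    then show "w \<in> ?N" using g_descent[OF q y(1) ut] y(2) u(3) by auto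
  qed
  \<comment> \<open>On the ball g starts at no more than \<tau> (norm (G q))^2 / 4, while the
    descent over time \<tau> subtracts 55/64 of \<tau> (norm (G q))^2.\<close>
  have B: "?B \<subseteq> ?N"
  proof
    fix w assume "w \<in> ?B"
    then obtain y where y: "y \<in> ball q r" "w = y - \<tau> *\<^sub>R G q" by blast
    have ny: "norm (y - q) \<le> r" using y by (simp add: dist_norm norm_minus_commute less_imp_le)
    have yq: "y \<in> cball q R" "q \<in> cball q R"
      using ny r(3) R(1) by (auto simp: dist_norm norm_minus_commute)
    have rr: "r \<le> \<tau> * ?a / 8" using r(2) mult_left_mono[OF a(1) less_imp_le[OF \<tau>(1)]] by linarith
    have "\<bar>g y - g q - (y - q) \<bullet> G q\<bar> \<le> 2 * M * (norm (y - q))\<^sup>2"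
      by (rule g_taylor[OF convex_cball R(2)[OF q] yq])
    then have "g y \<le> \<bar>(y - q) \<bullet> G q\<bar> + 2 * M * (norm (y - q))\<^sup>2" using g_zero_on_frontier[OF q] by linarith
    also have "\<bar>(y - q) \<bullet> G q\<bar> \<le> r * ?a"
      using Cauchy_Schwarz_ineq2[of "y - q" "G q"] mult_right_mono[OF ny, of ?a] by simp
    also have "r * ?a \<le> \<tau> * ?a\<^sup>2 / 8" using mult_right_mono[OF rr, of ?a] by (simp add: power2_eq_square mult_ac)
    also have "2 * M * (norm (y - q))\<^sup>2 \<le> \<tau> * ?a\<^sup>2 / 8"
    proof -
      have "(norm (y - q))\<^sup>2 \<le> (\<tau> * ?a / 8)\<^sup>2" using ny rr by (intro power_mono) auto
      then have "2 * M * (norm (y - q))\<^sup>2 \<le> 2 * M * (\<tau> * ?a / 8)\<^sup>2" using M_pos by (intro mult_left_mono) auto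
      also have "\<dots> = (2 * M * \<tau>) * (\<tau> * ?a\<^sup>2) / 64" by (simp add: power2_eq_square)
      also have "\<dots> \<le> 1 / 8 * (\<tau> * ?a\<^sup>2) / 64" using \<tau> by (intro divide_right_mono mult_right_mono) auto
      also have "\<dots> \<le> \<tau> * ?a\<^sup>2 / 8" using \<tau>(1) by simp
      finally show ?thesis .
    qed
    finally have "g y \<le> \<tau> * ?a\<^sup>2 / 4" by simp
    moreover have "\<tau> * ?a\<^sup>2 > 0" using \<tau>(1) a(3) by simp
    ultimately have "g w < 0" using g_descent(2)[OF q y(1), of \<tau>] \<tau>(1) y(2) by simp
    moreover have "w \<in> D" using g_descent(1)[OF q y(1), of \<tau>] \<tau>(1) y(2) by simp
    ultimately show "w \<in> ?N" by simp
  qed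
  have pb: "p \<in> ball q r" using p by (simp add: dist_commute)
  have cB: "connected ?B" by (intro connected_continuous_image continuous_intros connected_ball)
  have "p - \<tau> *\<^sub>R G q \<in> ?seg p \<inter> ?B" using pb by auto
  then have c1: "connected (?seg p \<union> ?B)" by (intro connected_Un[OF connected_segment cB]) blast
  have "x - \<tau> *\<^sub>R G q \<in> (?seg p \<union> ?B) \<inter> ?seg x" using x by auto
  then have "connected (?seg p \<union> ?B \<union> ?seg x)" by (intro connected_Un[OF c1 connected_segment]) blast
  moreover have "?seg p \<union> ?B \<union> ?seg x \<subseteq> ?N"
    using seg[OF pb g_neg_on_Omega[OF p(1)]] seg[OF x gx] B by blast
  ultimately have "?seg p \<union> ?B \<union> ?seg x \<subseteq> \<Omega>"
    by (rule connected_neg_subset_Omega) (use p(1) in auto)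
  then show "x \<in> \<Omega>" by auto
qed (rule g_neg_on_Omega)

text \<open>A zero of g in the ball is pushed along - G q by an arbitrarily small amount into {g <
  0}, which near q is \<Omega>; so it lies in the closure. No other sheet of the zero set comes near
  \<Gamma>.\<close>

lemma near_Gamma_Gamma:
  assumes q: "q \<in> \<Gamma>" and x: "x \<in> ball q r"
  shows "x \<in> \<Gamma> \<longleftrightarrow> g x = 0"
proof
  assume gx: "g x = 0"
  let ?a = "norm (G q)"
  have a: "m \<le> ?a" "?a \<le> M" "?a > 0" using norm_G_Gamma[OF q] m by auto
  have "x \<in> closure \<Omega>"
    unfolding closure_approachable
  proof (intro allI impI)
    fix e :: real assume e: "e > 0"
    obtain e' where e': "e' > 0" "ball x e' \<subseteq> ball q r" using x open_ball open_contains_ball by blast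
    define t where "t = min \<tau> (min e e' / (2 * ?a))"
    have t: "0 < t" "t \<le> \<tau>" using \<tau>(1) e e' a by (auto simp: t_def)
    have "t * ?a \<le> min e e' / 2" using a(3) mult_right_mono[of t "min e e' / (2 * ?a)" ?a] by (simp add: t_def)
    then have ta: "t * ?a < e" "t * ?a < e'" using e e' by auto
    let ?y = "x - t *\<^sub>R G q"
    have "dist ?y x = t * ?a" using t by (simp add: dist_norm)
    moreover have "0 < 55 / 64 * t * ?a\<^sup>2" using t a by simp
    then have "g ?y < 0" using g_descent(2)[OF q x, of t] t gx by linarith
    moreover have "?y \<in> ball x e'" using ta(2) \<open>dist ?y x = _\<close> by (simp only: mem_ball dist_commute[of x])
    then have "?y \<in> ball q r" using e'(2) by blast
    ultimately show "\<exists>y\<in>\<Omega>. dist y x < e" using near_Gamma_Omega[OF q] ta by (intro bexI[of _ ?y]) auto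
  qed
  moreover have "x \<notin> \<Omega>" using g_neg_on_Omega gx by force
  ultimately show "x \<in> \<Gamma>" using open_Omega by (simp add: frontier_def interior_open)
qed (rule g_zero_on_frontier)

text \<open>The Neumann condition is stated for every \<open>outward_normal\<close>; this supplies
  the vector to which it gets applied. The first-order error is kept below half of what the cone
  condition guarantees, so the linear term decides the sign of g in both cones.\<close>

lemma outward_normal_Gamma:
  assumes q: "q \<in> \<Gamma>"
  shows "outward_normal \<Omega> q (G q /\<^sub>R norm (G q))"
  unfolding outward_normal_def
proof (intro conjI allI impI)
  let ?a = "norm (G q)"
  have a: "?a > 0" using norm_G_Gamma[OF q] m by auto
  then show "norm (G q /\<^sub>R ?a) = 1" by simp
  fix c :: real assume c: "c > 0"
  have "q \<in> D" using q Gamma_subset_D by blast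
  then have "(g has_derivative (\<lambda>h. h \<bullet> G q)) (at q)" using g_deriv by (simp add: gderiv_def)
  then obtain d where d: "d > 0"
    "\<And>y. norm (y - q) < d \<Longrightarrow> norm (g y - g q - (y - q) \<bullet> G q) \<le> c * ?a / 2 * norm (y - q)"
    using c a unfolding has_derivative_at_alt by (metis divide_pos_pos mult_pos_pos zero_less_numeral)
  show "\<exists>r'>0. \<forall>h. norm h < r' \<longrightarrow>
     ((G q /\<^sub>R ?a) \<bullet> h < - c * norm h \<longrightarrow> q + h \<in> \<Omega>) \<and> ((G q /\<^sub>R ?a) \<bullet> h > c * norm h \<longrightarrow> q + h \<notin> \<Omega>)"
  proof (intro exI[of _ "min d r"] conjI allI impI)
    show "0 < min d r" using d r by simp
    fix h :: "real^2" assume h: "norm h < min d r"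
    define K where "K = c * ?a * norm h"
    have K: "K \<ge> 0" using c a by (simp add: K_def)
    have *: "\<bar>g (q + h) - h \<bullet> G q\<bar> \<le> K / 2"
      using d(2)[of "q + h"] h g_zero_on_frontier[OF q] by (simp add: K_def)
    have b: "q + h \<in> ball q r" using h by (simp add: dist_norm)
    {
      assume "(G q /\<^sub>R ?a) \<bullet> h < - c * norm h"
      then have "h \<bullet> G q < - K" using a by (simp add: K_def field_simps inner_commute)
      with * K have "g (q + h) < 0" by linarith
      then show "q + h \<in> \<Omega>" using near_Gamma_Omega[OF q b] by simp
    }
    {
      assume "(G q /\<^sub>R ?a) \<bullet> h > c * norm h"
      then have "h \<bullet> G q > K" using a by (simp add: K_def field_simps inner_commute)
      with * K have "\<not> g (q + h) < 0" by linarith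
      then show "q + h \<notin> \<Omega>" using near_Gamma_Omega[OF q b] by simp
    }
  qed
qed

end

section \<open>Periodic orbits on the boundary\<close>

context level_domain
begin

text \<open>Global solvability needs a field that is Lipschitz on the whole plane, while G is
  controlled only in D. This factor is 1 on \<Gamma> and 0 from distance R / 2 on; multiplying by it
  keeps the field tangential to the level lines and unchanged on \<Gamma>.\<close>

definition cutoff :: "real^2 \<Rightarrow> real" where
  "cutoff x = max 0 (1 - infdist x \<Gamma> / (R / 2))"

definition X :: "real^2 \<Rightarrow> real^2" where
  "X x = cutoff x *\<^sub>R rot (G x)"

lemma cutoff_bounds: "0 \<le> cutoff x" "cutoff x \<le> 1"
  using infdist_nonneg[of x \<Gamma>] R(1) by (auto simp: cutoff_def)

lemma cutoff_Gamma: "x \<in> \<Gamma> \<Longrightarrow> cutoff x = 1"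
  by (simp add: cutoff_def infdist_zero)

lemma cutoff_lipschitz: "\<bar>cutoff x - cutoff y\<bar> \<le> 2 / R * dist x y"
proof -
  have "\<bar>infdist x \<Gamma> - infdist y \<Gamma>\<bar> \<le> dist x y" by (rule infdist_triangle_abs)
  then have *: "\<bar>infdist x \<Gamma> - infdist y \<Gamma>\<bar> / (R / 2) \<le> dist x y / (R / 2)"
    using R(1) by (intro divide_right_mono) auto
  have "\<bar>cutoff x - cutoff y\<bar> \<le> \<bar>infdist x \<Gamma> / (R / 2) - infdist y \<Gamma> / (R / 2)\<bar>"
  proof -
    have "\<bar>max 0 (1 - a) - max 0 (1 - b)\<bar> \<le> \<bar>a - b\<bar>" for a b :: real by (auto simp: max_def)
    then show ?thesis unfolding cutoff_def .
  qed
  also have "\<dots> = \<bar>infdist x \<Gamma> - infdist y \<Gamma>\<bar> / (R / 2)"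
    using R(1) by (simp only: diff_divide_distrib[symmetric] abs_divide)
  finally show ?thesis using * by (simp add: mult.commute)
qed

lemma cutoff_pos:
  assumes "cutoff x > 0" shows "\<exists>q\<in>\<Gamma>. dist x q < R / 2"
proof -
  have "infdist x \<Gamma> / (R / 2) < 1" using assms unfolding cutoff_def by (simp add: max_def split: if_splits)
  then have "infdist x \<Gamma> < R / 2" using R(1) by (simp add: field_simps)
  moreover obtain q where "q \<in> \<Gamma>" "infdist x \<Gamma> = dist x q"
    using infdist_attains_inf[OF compact_imp_closed[OF compact_Gamma] Gamma_nonempty] by metis
  ultimately show ?thesis by auto
qed

lemma X_bound: "norm (X x) \<le> M"
proof (cases "cutoff x > 0")
  case True
  then obtain q where q: "q \<in> \<Gamma>" "dist x q < R / 2" using cutoff_pos by blast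
  then have "x \<in> cball q R" using R(1) by (simp add: dist_commute)
  then have "norm (G x) \<le> M" using R(2)[OF q(1)] G_le by blast
  then show ?thesis
    using mult_mono[OF cutoff_bounds(2)[of x] \<open>norm (G x) \<le> M\<close>] cutoff_bounds[of x] M_pos by (simp add: X_def)
next
  case False
  then show ?thesis using cutoff_bounds[of x] M_pos by (simp add: X_def)
qed

text \<open>Points closer than R / 2 share a ball around one boundary point, where both factors are
  Lipschitz. For points further apart the bound M on both values suffices, which is the source of 4
  M / R.\<close>

lemma X_lipschitz_aux:
  assumes "cutoff x > 0" shows "norm (X x - X y) \<le> (4 * M / R + 2 * M) * dist x y"
proof (cases "dist x y < R / 2")
  case True
  obtain q where q: "q \<in> \<Gamma>" "dist x q < R / 2" using cutoff_pos[OF assms] by blast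
  have x: "x \<in> cball q R" using q R(1) by (simp add: dist_commute)
  have "dist q y \<le> dist q x + dist x y" by (rule dist_triangle)
  then have y: "y \<in> cball q R" using q True by (simp add: dist_commute)
  have Gx: "norm (G x) \<le> M" using R(2)[OF q(1)] G_le x by blast
  have "X x - X y = (cutoff x - cutoff y) *\<^sub>R rot (G x) + cutoff y *\<^sub>R rot (G x - G y)"
    by (simp add: X_def rot_diff[symmetric] algebra_simps)
  then have "norm (X x - X y) \<le> \<bar>cutoff x - cutoff y\<bar> * norm (G x) + cutoff y * norm (G x - G y)"
    using norm_triangle_ineq[of "(cutoff x - cutoff y) *\<^sub>R rot (G x)" "cutoff y *\<^sub>R rot (G x - G y)"] cutoff_bounds[of y] by simp
  also have "\<bar>cutoff x - cutoff y\<bar> * norm (G x) \<le> 2 / R * dist x y * M"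
    using cutoff_lipschitz[of x y] Gx R(1) by (intro mult_mono) auto
  also have "cutoff y * norm (G x - G y) \<le> 1 * (2 * M * norm (x - y))"
    using cutoff_bounds[of y] G_lipschitz[OF convex_cball R(2)[OF q(1)] x y] by (intro mult_mono) auto
  finally have "norm (X x - X y) \<le> (2 * M / R + 2 * M) * dist x y"
    by (simp add: dist_norm algebra_simps)
  also have "\<dots> \<le> (4 * M / R + 2 * M) * dist x y"
    using M_pos R(1) by (intro mult_right_mono add_mono divide_right_mono) auto
  finally show ?thesis .
next
  case False
  have "norm (X x - X y) \<le> 2 * M" using X_bound[of x] X_bound[of y] norm_triangle_ineq4[of "X x" "X y"] by linarith
  also have "\<dots> = 4 * M / R * (R / 2)" using R(1) by simp
  also have "\<dots> \<le> 4 * M / R * dist x y" using False M_pos R(1) by (intro mult_left_mono) auto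
  also have "\<dots> \<le> (4 * M / R + 2 * M) * dist x y" using M_pos by (intro mult_right_mono) auto
  finally show ?thesis .
qed

lemma X_lipschitz: "(4 * M / R + 2 * M)-lipschitz_on UNIV X"
proof (rule lipschitz_onI)
  show "0 \<le> 4 * M / R + 2 * M" using M_pos R(1) by simp
  fix x y :: "real^2"
  consider "cutoff x > 0" | "cutoff y > 0" | "cutoff x = 0" "cutoff y = 0" using cutoff_bounds[of x] cutoff_bounds[of y] by linarith
  then show "dist (X x) (X y) \<le> (4 * M / R + 2 * M) * dist x y"
  proof cases
    case 1 then show ?thesis using X_lipschitz_aux[of x y] by (simp add: dist_norm)
  next
    case 2 then show ?thesis using X_lipschitz_aux[of y x] by (simp add: dist_norm norm_minus_commute)
  next
    case 3 then show ?thesis using M_pos R(1) by (simp add: X_def)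
  qed
qed

section \<open>Hamiltonian orbits on \<Gamma>\<close>

definition orbit :: "(real \<Rightarrow> real^2) \<Rightarrow> bool" where
  "orbit z \<longleftrightarrow> (\<forall>t. z t \<in> \<Gamma> \<and> (z has_vector_derivative rot (G (z t))) (at t))"

text \<open>The set of times spent in \<Gamma> is closed; it is open because g is constant along the
  curve while it stays near \<Gamma>, where the zeros of g are exactly \<Gamma>. Only tangency is
  asked for, so the lemma covers both the truncated field and the orbits of
  \<open>hamiltonian_orbit\<close>.\<close>

lemma stays_in_Gamma:
  assumes der: "\<And>t. \<exists>v. (z has_vector_derivative v) (at t) \<and> (z t \<in> D \<longrightarrow> v \<bullet> G (z t) = 0)"
    and z0: "z 0 \<in> \<Gamma>"
  shows "z t \<in> \<Gamma>"
proof -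
  have cont: "continuous_on UNIV z"
    using der has_vector_derivative_continuous by (intro continuous_at_imp_continuous_on ballI) blast
  let ?A = "{t. z t \<in> \<Gamma>}"
  have "closed ?A"
    using closed_vimage[OF compact_imp_closed[OF compact_Gamma] cont] by (simp add: vimage_def)
  moreover have "open ?A"
    unfolding open_dist
  proof (intro ballI)
    fix t0 assume t0: "t0 \<in> ?A"
    then have q: "z t0 \<in> \<Gamma>" by simp
    obtain d where d: "d > 0" "\<And>t. dist t t0 < d \<Longrightarrow> dist (z t) (z t0) < r"
      using cont r(1) unfolding continuous_on_iff by (metis UNIV_I)
    have inball: "z t \<in> ball (z t0) r" if "t \<in> ball t0 d" for t
      using d(2)[of t] that by (simp add: dist_commute)
    have inD: "z t \<in> D" if "t \<in> ball t0 d" for t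
    proof -
      have "z t \<in> cball (z t0) R" using inball[OF that] r(3) R(1) by simp
      then show ?thesis using R(2)[OF q] by blast
    qed
    have "((\<lambda>t. g (z t)) has_real_derivative 0) (at t within ball t0 d)" if t: "t \<in> ball t0 d" for t
    proof -
      obtain v where v: "(z has_vector_derivative v) (at t)" "v \<bullet> G (z t) = 0" using der inD[OF t] by blast
      have "(g has_derivative (\<lambda>h. h \<bullet> G (z t))) (at (z t))" using g_deriv[OF inD[OF t]] by (simp add: gderiv_def)
      from has_derivative_compose[OF v(1)[unfolded has_vector_derivative_def] this]
      have "((\<lambda>t. g (z t)) has_derivative (\<lambda>h. 0)) (at t)" using v(2) by simp
      then have "((\<lambda>t. g (z t)) has_real_derivative 0) (at t)"
        unfolding has_field_derivative_def by (rule has_derivative_eq_rhs) auto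
      then show ?thesis by (rule has_field_derivative_at_within)
    qed
    then obtain c where c: "\<And>t. t \<in> ball t0 d \<Longrightarrow> g (z t) = c"
      using has_field_derivative_zero_constant[OF convex_ball, of t0 d "\<lambda>t. g (z t)"] by blast
    have "c = 0" using c[of t0] d(1) g_zero_on_frontier[OF q] by simp
    then have "z t \<in> \<Gamma>" if "t \<in> ball t0 d" for t
      using near_Gamma_Gamma[OF q inball[OF that]] c[OF that] by simp
    then show "\<exists>e>0. \<forall>t. dist t t0 < e \<longrightarrow> t \<in> ?A"
      using d(1) by (auto intro!: exI[of _ d] simp: dist_commute)
  qed
  ultimately have A: "?A = {} \<or> ?A = UNIV" by (intro clopen[THEN iffD1] conjI)
  have "0 \<in> ?A" using z0 by simp
  then have "t \<in> ?A" using A by (elim disjE) (simp_all only: empty_iff UNIV_I)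
  then show ?thesis by simp
qed

lemma orbit_X: "orbit z \<Longrightarrow> (z has_vector_derivative X (z t)) (at t)"
  by (simp add: orbit_def X_def cutoff_Gamma)

lemma orbit_exists:
  assumes "q \<in> \<Gamma>" obtains z where "z 0 = q" "orbit z"
proof -
  obtain z where z: "z 0 = q" "\<And>t. (z has_vector_derivative X (z t)) (at t)"
    using ode_solution[OF X_lipschitz] by blast
  have *: "z t \<in> \<Gamma>" for t
  proof (rule stays_in_Gamma)
    show "\<exists>v. (z has_vector_derivative v) (at t) \<and> (z t \<in> D \<longrightarrow> v \<bullet> G (z t) = 0)" for t
      using z(2)[of t] by (intro exI[of _ "X (z t)"]) (simp add: X_def)
  qed (use z assms in simp)
  have "orbit z" unfolding orbit_def using * z(2) cutoff_Gamma[OF *] by (simp add: X_def)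
  with z(1) that show thesis by blast
qed

lemma orbit_unique:
  assumes "orbit z" "orbit w" "z a = w a" shows "z t = w t"
  by (rule ode_unique[OF X_lipschitz assms(3) orbit_X[OF assms(1)] orbit_X[OF assms(2)]])

lemma orbit_shift: "orbit z \<Longrightarrow> orbit (\<lambda>t. z (t + c))"
  unfolding orbit_def
proof (intro allI conjI)
  fix t assume z: "\<forall>t. z t \<in> \<Gamma> \<and> (z has_vector_derivative rot (G (z t))) (at t)"
  then show "z (t + c) \<in> \<Gamma>" by blast
  have "((\<lambda>t. t + c) has_vector_derivative 1) (at t)" by (auto intro!: derivative_eq_intros)
  from vector_diff_chain_at[OF this, of z "rot (G (z (t + c)))"] z
  show "((\<lambda>t. z (t + c)) has_vector_derivative rot (G (z (t + c)))) (at t)" by (simp add: o_def)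
qed

lemma orbit_shift_eq:
  assumes "orbit z" "z a = z b" shows "z (t + (b - a)) = z t"
  using orbit_unique[OF orbit_shift[OF assms(1), of "b - a"] assms(1), of a t] assms(2) by simp

lemma orbit_continuous: "orbit z \<Longrightarrow> continuous_on S z"
  unfolding orbit_def using has_vector_derivative_continuous
  by (intro continuous_at_imp_continuous_on ballI) blast

lemma orbit_speed:
  assumes "orbit z" shows "norm (z s - z t) \<le> M * \<bar>s - t\<bar>"
proof -
  have "norm (z s - z t) \<le> M * norm (s - t)"
  proof (rule differentiable_bound[of UNIV z "\<lambda>t h. h *\<^sub>R rot (G (z t))"])
    fix t
    show "(z has_derivative (\<lambda>h. h *\<^sub>R rot (G (z t)))) (at t within UNIV)"
      using assms by (simp add: orbit_def has_vector_derivative_def)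
    have "norm (G (z t)) \<le> M" using assms norm_G_Gamma by (auto simp: orbit_def)
    then show "onorm (\<lambda>h. h *\<^sub>R rot (G (z t))) \<le> M"
      using M_pos by (intro onorm_bound) (auto simp: mult.commute[of M] intro: mult_left_mono)
  qed auto
  then show ?thesis by simp
qed

text \<open>Within time s0 an orbit stays within M s0 \<le> R of its start, and G changes by at most
  1/8 of its size there. The bound 1/4 keeps the time correction in \<open>orbit_periodic\<close>
  below the unit gap. The radius \<open>\<rho>0\<close> is small enough that every point of \<Gamma>
  closer than it is reached within time s0.\<close>

definition s0 :: real where "s0 = min (1 / 4) (min (R / M) (m / (16 * M * M)))"
definition \<rho>0 :: real where "\<rho>0 = min (s0 * m / 2) (min R (m / (16 * M)))"

lemma s0: "s0 > 0" "s0 \<le> 1 / 4" "M * s0 \<le> R" "2 * M * (M * s0) \<le> m / 8"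
proof -
  show "s0 > 0" using R(1) M_pos m by (auto simp: s0_def)
  show "s0 \<le> 1 / 4" unfolding s0_def by (rule min.cobounded1)
  have "s0 \<le> R / M" "s0 \<le> m / (16 * M * M)" by (auto simp: s0_def)
  then show "M * s0 \<le> R" "2 * M * (M * s0) \<le> m / 8" using M_pos by (simp_all add: field_simps)
qed

lemma \<rho>0: "\<rho>0 > 0" "\<rho>0 \<le> s0 * m / 2" "\<rho>0 \<le> R" "2 * M * \<rho>0 \<le> m / 8"
proof -
  show "\<rho>0 > 0" "\<rho>0 \<le> s0 * m / 2" "\<rho>0 \<le> R" using R(1) M_pos m s0(1) by (auto simp: \<rho>0_def)
  have "\<rho>0 \<le> m / (16 * M)" by (auto simp: \<rho>0_def)
  then show "2 * M * \<rho>0 \<le> m / 8" using M_pos by (simp add: field_simps)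
qed

lemma inner_G_near:
  assumes q: "q \<in> \<Gamma>" and x: "x \<in> cball q R" and d: "2 * M * norm (x - q) \<le> m / 8"
  shows "G x \<bullet> G q \<ge> 7 / 8 * (norm (G q))\<^sup>2"
proof -
  let ?a = "norm (G q)"
  have a: "m \<le> ?a" using norm_G_Gamma[OF q] by simp
  have "norm (G x - G q) \<le> 2 * M * norm (x - q)"
    using x R(1) by (intro G_lipschitz[OF convex_cball R(2)[OF q]]) auto
  then have "norm (G x - G q) \<le> ?a / 8" using d a by linarith
  then have "norm (G x - G q) * ?a \<le> ?a / 8 * ?a" by (intro mult_right_mono) auto
  moreover have "\<bar>(G x - G q) \<bullet> G q\<bar> \<le> norm (G x - G q) * ?a" by (rule Cauchy_Schwarz_ineq2)
  moreover have "(G x - G q) \<bullet> G q = G x \<bullet> G q - ?a * ?a"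
    by (simp add: inner_diff_left power2_norm_eq_inner[symmetric] power2_eq_square)
  ultimately show ?thesis unfolding power2_eq_square by linarith
qed

text \<open>The tangential velocity is the inner product of two rotated gradients, which equals
  \<open>G (z (t0 + s)) \<bullet> G (z t0)\<close>; by \<open>inner_G_near\<close> this stays above
  7/8 of its initial value.\<close>

lemma orbit_progress:
  fixes z :: "real \<Rightarrow> real^2" and t0 :: real
  assumes z: "orbit z" and s: "0 \<le> s" "s \<le> s0"
  defines "h \<equiv> \<lambda>s. (z (t0 + s) - z t0) \<bullet> rot (G (z t0))"
  shows "h s \<ge> 7 / 8 * (norm (G (z t0)))\<^sup>2 * s" "h (- s) \<le> - (7 / 8 * (norm (G (z t0)))\<^sup>2 * s)"
proof -
  let ?c = "7 / 8 * (norm (G (z t0)))\<^sup>2"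
  have q: "z t0 \<in> \<Gamma>" using z by (simp add: orbit_def)
  have der: "(h has_real_derivative G (z (t0 + s)) \<bullet> G (z t0)) (at s)" for s
  proof -
    have "((\<lambda>s. z (t0 + s)) has_vector_derivative rot (G (z (t0 + s)))) (at s)"
      using orbit_shift[OF z, of t0] by (simp add: orbit_def add.commute)
    then show ?thesis
      unfolding h_def has_vector_derivative_def has_field_derivative_def
      by (auto intro!: derivative_eq_intros simp: fun_eq_iff)
  qed
  have ge: "G (z (t0 + s)) \<bullet> G (z t0) \<ge> ?c" if "\<bar>s\<bar> \<le> s0" for s
  proof (rule inner_G_near[OF q])
    have *: "norm (z (t0 + s) - z t0) \<le> M * s0"
      using orbit_speed[OF z, of "t0 + s" t0] mult_left_mono[OF that less_imp_le[OF M_pos]] by simp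
    then show "z (t0 + s) \<in> cball (z t0) R" using s0(3) by (simp add: dist_norm norm_minus_commute)
    have "2 * M * norm (z (t0 + s) - z t0) \<le> 2 * M * (M * s0)" using * M_pos by (intro mult_left_mono) auto
    then show "2 * M * norm (z (t0 + s) - z t0) \<le> m / 8" using s0(4) by linarith
  qed
  have mono: "h a - ?c * a \<le> h b - ?c * b" if ab: "- s0 \<le> a" "a \<le> b" "b \<le> s0" for a b
  proof (rule DERIV_nonneg_imp_nondecreasing[OF ab(2)])
    fix x assume x: "a \<le> x" "x \<le> b"
    have "((\<lambda>s. h s - ?c * s) has_real_derivative G (z (t0 + x)) \<bullet> G (z t0) - ?c) (at x)"
      using der[of x] by (auto intro!: derivative_eq_intros)
    moreover have "G (z (t0 + x)) \<bullet> G (z t0) - ?c \<ge> 0" using ge[of x] x ab by auto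
    ultimately show "\<exists>y. ((\<lambda>s. h s - ?c * s) has_real_derivative y) (at x) \<and> 0 \<le> y" by blast
  qed
  have h0: "h 0 = 0" by (simp add: h_def)
  show "h s \<ge> ?c * s" using mono[of 0 s] s h0 s0(1) by simp
  show "h (- s) \<le> - (?c * s)" using mono[of "- s" 0] s h0 s0(1) by simp
qed

lemma orbit_no_short_return:
  assumes "orbit z" "0 < s" "s \<le> s0" shows "z (t + s) \<noteq> z t"
proof
  assume "z (t + s) = z t"
  then have "7 / 8 * (norm (G (z t)))\<^sup>2 * s \<le> 0" using orbit_progress(1)[OF assms(1), of s t] assms by simp
  moreover have "z t \<in> \<Gamma>" using assms(1) by (simp add: orbit_def)
  then have "norm (G (z t)) > 0" using norm_G_Gamma[of "z t"] m by auto
  ultimately show False using assms(2) by (simp add: mult_le_0_iff)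
qed

text \<open>Near q the boundary is a graph over the tangent line. Two of its points on a common
  normal differ by \<open>l *\<^sub>R G q\<close>; in units of \<bar>l\<bar> (norm (G q))^2 the
  linear change of g is at least 7/8 and the Taylor remainder at most 1/4, yet g vanishes at both
  points.\<close>

lemma Gamma_graph:
  assumes q: "q \<in> \<Gamma>" and x: "x \<in> \<Gamma>" and y: "y \<in> \<Gamma>" and xy: "(x - y) \<bullet> rot (G q) = 0"
    and nx: "norm (x - q) \<le> M * s0" and ny: "norm (y - q) \<le> \<rho>0"
  shows "x = y"
proof (rule ccontr)
  assume ne: "x \<noteq> y"
  let ?a = "norm (G q)"
  have a: "m \<le> ?a" "?a > 0" using norm_G_Gamma[OF q] m by auto
  then have "G q \<noteq> 0" by auto
  from orthogonal_rot_imp_parallel[OF xy this] obtain l where l: "x - y = l *\<^sub>R G q" by blast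
  with ne have l0: "l \<noteq> 0" by auto
  have xb: "x \<in> cball q R" and yb: "y \<in> cball q R"
    using nx ny s0 \<rho>0 by (auto simp: dist_norm norm_minus_commute)
  have "\<bar>g x - g y - (x - y) \<bullet> G y\<bar> \<le> 2 * M * (norm (x - y))\<^sup>2"
    by (rule g_taylor[OF convex_cball R(2)[OF q] xb yb])
  then have t: "\<bar>l\<bar> * \<bar>G y \<bullet> G q\<bar> \<le> 2 * M * (norm (x - y))\<^sup>2"
    using g_zero_on_frontier[OF x] g_zero_on_frontier[OF y] l by (simp add: abs_mult inner_commute)
  have "2 * M * norm (y - q) \<le> 2 * M * \<rho>0" using ny M_pos by (intro mult_left_mono) auto
  then have "G y \<bullet> G q \<ge> 7 / 8 * ?a\<^sup>2" using \<rho>0(4) by (intro inner_G_near[OF q yb]) linarith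
  then have "\<bar>l\<bar> * (7 / 8 * ?a\<^sup>2) \<le> \<bar>l\<bar> * \<bar>G y \<bullet> G q\<bar>" by (intro mult_left_mono) auto
  moreover have "2 * M * (norm (x - y))\<^sup>2 \<le> (m / 4) * (\<bar>l\<bar> * ?a)"
  proof -
    have "norm (x - y) \<le> norm (x - q) + norm (y - q)"
      using norm_triangle_ineq4[of "x - q" "y - q"] by simp
    then have "norm (x - y) \<le> M * s0 + \<rho>0" using nx ny by linarith
    then have "2 * M * norm (x - y) \<le> 2 * M * (M * s0 + \<rho>0)" using M_pos by (intro mult_left_mono) auto
    also have "\<dots> \<le> m / 4" using s0(4) \<rho>0(4) by (simp add: algebra_simps)
    finally have "2 * M * norm (x - y) * norm (x - y) \<le> m / 4 * norm (x - y)" by (intro mult_right_mono) auto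
    then show ?thesis using l by (simp add: power2_eq_square mult.assoc)
  qed
  moreover have "(m / 4) * (\<bar>l\<bar> * ?a) \<le> \<bar>l\<bar> * (1 / 4 * ?a\<^sup>2)"
    using mult_right_mono[OF a(1), of "\<bar>l\<bar> * ?a / 4"] by (simp add: power2_eq_square mult_ac)
  ultimately have "\<bar>l\<bar> * (7 / 8 * ?a\<^sup>2) \<le> \<bar>l\<bar> * (1 / 4 * ?a\<^sup>2)" using t by linarith
  then show False using l0 a(2) by (simp add: mult_le_cancel_left)
qed

text \<open>The intermediate value theorem matches the tangential coordinate of p along the orbit,
  and \<open>Gamma_graph\<close> turns this into equality of the points.\<close>

lemma orbit_hits_near:
  assumes z: "orbit z" and p: "p \<in> \<Gamma>" "dist (z t0) p < \<rho>0"
  obtains s where "\<bar>s\<bar> \<le> s0" "z (t0 + s) = p"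
proof -
  let ?h = "\<lambda>s. (z (t0 + s) - z t0) \<bullet> rot (G (z t0))" and ?y = "(p - z t0) \<bullet> rot (G (z t0))"
  let ?a = "norm (G (z t0))"
  have q: "z t0 \<in> \<Gamma>" using z by (simp add: orbit_def)
  have a: "m \<le> ?a" "?a > 0" using norm_G_Gamma[OF q] m by auto
  have "norm (p - z t0) \<le> \<rho>0" using p(2) by (simp add: dist_norm norm_minus_commute)
  then have "norm (p - z t0) * ?a \<le> \<rho>0 * ?a" by (intro mult_right_mono) auto
  then have "\<bar>?y\<bar> \<le> \<rho>0 * ?a" using Cauchy_Schwarz_ineq2[of "p - z t0" "rot (G (z t0))"] by simp
  also have "\<dots> \<le> (s0 * m / 2) * ?a" using \<rho>0(2) by (intro mult_right_mono) auto
  also have "\<dots> \<le> (s0 * ?a / 2) * ?a" using a s0(1) by (intro mult_right_mono divide_right_mono mult_left_mono) auto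
  also have "\<dots> \<le> 7 / 8 * ?a\<^sup>2 * s0" using s0(1) by (simp add: power2_eq_square)
  finally have y: "\<bar>?y\<bar> \<le> 7 / 8 * ?a\<^sup>2 * s0" .
  have "\<exists>s\<ge>- s0. s \<le> s0 \<and> ?h s = ?y"
  proof (rule IVT')
    show "?h (- s0) \<le> ?y" using orbit_progress(2)[OF z, of s0 t0] y s0(1) by simp
    show "?y \<le> ?h s0" using orbit_progress(1)[OF z, of s0 t0] y s0(1) by simp
    show "continuous_on {- s0..s0} ?h"
      by (intro continuous_intros continuous_on_compose2[OF orbit_continuous[OF z, of UNIV]]) auto
  qed (use s0 in simp)
  then obtain s where s: "- s0 \<le> s" "s \<le> s0" "?h s = ?y" by blast
  have "z (t0 + s) = p"
  proof (rule Gamma_graph[OF q _ p(1)])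
    show "z (t0 + s) \<in> \<Gamma>" using z by (simp add: orbit_def)
    show "(z (t0 + s) - p) \<bullet> rot (G (z t0)) = 0" using s(3) by (simp add: inner_diff_left)
    have "\<bar>s\<bar> \<le> s0" using s by auto
    then show "norm (z (t0 + s) - z t0) \<le> M * s0"
      using orbit_speed[OF z, of "t0 + s" t0] mult_left_mono[OF \<open>\<bar>s\<bar> \<le> s0\<close> less_imp_le[OF M_pos]] by simp
    show "norm (p - z t0) \<le> \<rho>0" by fact
  qed
  with s that[of s] show thesis by simp
qed

text \<open>The points at integer times accumulate in the compact \<Gamma>, so some later one comes
  within \<open>\<rho>0\<close> of an earlier one and hits it after a time correction of at most s0
  \<le> 1/4. The two times are at least 1 apart, so the resulting period is positive.\<close>

lemma orbit_periodic:
  assumes z: "orbit z" obtains P where "P > 0" "\<And>t. z (t + P) = z t"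
proof -
  have *: "\<forall>n. z (real n) \<in> \<Gamma>" using z by (simp add: orbit_def)
  obtain l k where k: "strict_mono k" "((\<lambda>n. z (real n)) \<circ> k) \<longlonglongrightarrow> l"
    using compact_Gamma[unfolded compact_def, THEN spec, of "\<lambda>n. z (real n)", THEN mp, OF *] by blast
  then have "Cauchy ((\<lambda>n. z (real n)) \<circ> k)" using LIMSEQ_imp_Cauchy by blast
  then obtain N where N: "dist (z (real (k (Suc N)))) (z (real (k N))) < \<rho>0"
    using \<rho>0(1) unfolding Cauchy_def o_def by (metis le_Suc_eq order_refl)
  have kN: "real (k (Suc N)) \<ge> real (k N) + 1" using strict_monoD[OF k(1), of N "Suc N"] by simp
  have "z (real (k N)) \<in> \<Gamma>" using z by (simp add: orbit_def)
  then obtain s where s: "\<bar>s\<bar> \<le> s0" "z (real (k (Suc N)) + s) = z (real (k N))"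
    using orbit_hits_near[OF z _ N] by blast
  have "z (t + (real (k (Suc N)) + s - real (k N))) = z t" for t
    by (rule orbit_shift_eq[OF z s(2)[symmetric]])
  moreover have "real (k (Suc N)) + s - real (k N) > 0" using kN s(1) s0(2) by linarith
  ultimately show thesis using that by blast
qed

definition least_period :: "(real \<Rightarrow> real^2) \<Rightarrow> real \<Rightarrow> bool" where
  "least_period z T \<longleftrightarrow> T > 0 \<and> (\<forall>t. z (t + T) = z t) \<and> (\<forall>s. 0 < s \<and> s < T \<longrightarrow> (\<exists>t. z (t + s) \<noteq> z t))"

text \<open>All periods exceed s0 and positive differences of periods are periods, so distinct
  periods are more than s0 apart. Hence a period within s0 of the infimum is the least one.\<close>

lemma least_period_exists:
  assumes z: "orbit z" obtains T where "least_period z T"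
proof -
  let ?P = "{P. P > 0 \<and> (\<forall>t. z (t + P) = z t)}"
  obtain P0 where P0: "P0 \<in> ?P" using orbit_periodic[OF z] by blast
  have diff: "P - P' \<in> ?P" if "P \<in> ?P" "P' \<in> ?P" "P' < P" for P P'
  proof -
    have "z (t + (P - P')) = z t" for t
    proof -
      have "\<forall>t. z t = z (t + P')" using that(2) by simp
      then have "z (t + (P - P')) = z (t + (P - P') + P')" by (rule spec)
      also have "t + (P - P') + P' = t + P" by simp
      also have "z \<dots> = z t" using that(1) by blast
      finally show ?thesis .
    qed
    then show ?thesis using that(3) by simp
  qed
  have low: "P > s0" if "P \<in> ?P" for P
  proof -
    have "P > 0" "z (0 + P) = z 0" using that by blast+
    then show ?thesis using orbit_no_short_return[OF z, of P 0] by (cases "P \<le> s0") auto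
  qed
  have bdd: "bdd_below ?P" using low by (intro bdd_belowI[of _ s0]) (meson less_imp_le)
  have "Inf ?P < Inf ?P + s0" using s0(1) by simp
  then obtain T where T: "T \<in> ?P" "T < Inf ?P + s0" using cInf_lessD[of ?P] P0 by blast
  have "\<exists>t. z (t + s) \<noteq> z t" if s: "0 < s" "s < T" for s
  proof (rule ccontr)
    assume "\<not> ?thesis"
    then have sP: "s \<in> ?P" using s by simp
    then have "Inf ?P \<le> s" using bdd by (rule cInf_lower)
    moreover have "T - s > s0" by (rule low[OF diff[OF T(1) sP s(2)]])
    ultimately show False using T(2) by linarith
  qed
  then have "least_period z T" unfolding least_period_def using T(1) by blast
  then show thesis by (rule that)
qed

lemma least_period_inj:
  assumes z: "orbit z" and T: "least_period z T" shows "inj_on z {0..<T}"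
proof (rule linorder_inj_onI')
  fix a b assume ab: "a \<in> {0..<T}" "b \<in> {0..<T}" "a < b"
  show "z a \<noteq> z b"
  proof
    assume "z a = z b"
    then have "\<forall>t. z (t + (b - a)) = z t" using orbit_shift_eq[OF z] by blast
    moreover have "0 < b - a" "b - a < T" using ab by auto
    ultimately show False using T unfolding least_period_def by blast
  qed
qed

lemma least_period_range:
  assumes T: "least_period z T" shows "z ` {0..<T} = range z"
proof -
  have T0: "T > 0" and per: "\<And>t. z (t + T) = z t" using T by (auto simp: least_period_def)
  have nat: "z (t + real n * T) = z t" for t n
  proof (induction n)
    case (Suc n)
    have "z (t + real (Suc n) * T) = z (t + real n * T + T)" by (simp add: algebra_simps)
    then show ?case using per Suc by simp
  qed simp
  have int: "z (t + of_int k * T) = z t" for t k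
  proof (cases "k \<ge> 0")
    case True
    then show ?thesis using nat[of t "nat k"] by simp
  next
    case False
    then show ?thesis using nat[of "t + of_int k * T" "nat (- k)"] by simp
  qed
  have "z t \<in> z ` {0..<T}" for t
  proof -
    let ?k = "\<lfloor>t / T\<rfloor>"
    have "of_int ?k \<le> t / T" "t / T < of_int ?k + 1" by linarith+
    then have "of_int ?k * T \<le> t" "t < (of_int ?k + 1) * T"
      by (simp_all only: pos_le_divide_eq[OF T0] pos_divide_less_eq[OF T0])
    then have "t + of_int (- ?k) * T \<in> {0..<T}" by (simp add: algebra_simps)
    then show ?thesis using int[of t "- ?k"] by (metis imageI)
  qed
  then show ?thesis by blast
qed

text \<open>The range is compact, hence closed in K, and open in K because every boundary point
  within \<open>\<rho>0\<close> of the orbit lies on it. As K is connected, the orbit exhausts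
  it.\<close>

lemma orbit_range_component:
  assumes z: "orbit z" and K: "K \<in> components \<Gamma>" and t0: "z t0 \<in> K"
  shows "range z = K"
proof
  have sub: "range z \<subseteq> \<Gamma>" using z by (auto simp: orbit_def)
  have "connected (range z)" by (intro connected_continuous_image orbit_continuous[OF z] connected_UNIV)
  then show sK: "range z \<subseteq> K" using components_maximal[OF K] sub t0 by blast
  obtain T where T: "least_period z T" using least_period_exists[OF z] by blast
  have "range z = z ` {0..T}" using least_period_range[OF T] by (auto; force)
  then have "compact (range z)" using orbit_continuous[OF z] by (simp add: compact_continuous_image)
  then have "closedin (top_of_set K) (range z)" using sK by (simp add: closed_subset compact_imp_closed)
  moreover have "openin (top_of_set K) (range z)"
    unfolding openin_contains_ball
  proof (intro conjI ballI sK)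
    fix x assume "x \<in> range z"
    then obtain t where t: "x = z t" by blast
    have "ball x \<rho>0 \<inter> K \<subseteq> range z"
    proof
      fix p assume p: "p \<in> ball x \<rho>0 \<inter> K"
      then have "p \<in> \<Gamma>" using in_components_subset[OF K] by blast
      then obtain s where "z (t + s) = p" using orbit_hits_near[OF z, of p t] p t by auto
      then show "p \<in> range z" by blast
    qed
    then show "\<exists>e>0. ball x e \<inter> K \<subseteq> range z" using \<rho>0(1) by blast
  qed
  ultimately have "range z = {} \<or> range z = K"
    using in_components_connected[OF K] unfolding connected_clopen by blast
  then show "K \<subseteq> range z" by blast
qed

text \<open>Finitely many balls of radius \<rho>0 / 2 cover the compact \<Gamma>, and each meets at
  most one component, since two boundary points within \<open>\<rho>0\<close> lie on one
  orbit.\<close>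

lemma finite_components_Gamma: "finite (components \<Gamma>)"
proof -
  obtain k where k: "finite k" "k \<subseteq> \<Gamma>" "\<Gamma> \<subseteq> (\<Union>x\<in>k. ball x (\<rho>0 / 2))"
    using seq_compact_imp_totally_bounded[OF compact_imp_seq_compact[OF compact_Gamma]] \<rho>0(1) by (meson half_gt_zero)
  define c where "c x = (SOME K. K \<in> components \<Gamma> \<and> K \<inter> ball x (\<rho>0 / 2) \<noteq> {})" for x
  have uniq: "K = K'" if K: "K \<in> components \<Gamma>" "K \<inter> ball x (\<rho>0 / 2) \<noteq> {}"
    and K': "K' \<in> components \<Gamma>" "K' \<inter> ball x (\<rho>0 / 2) \<noteq> {}" for K K' x
  proof -
    obtain p p' where p: "p \<in> K" "dist x p < \<rho>0 / 2" "p' \<in> K'" "dist x p' < \<rho>0 / 2" using K K' by auto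
    have G: "p \<in> \<Gamma>" "p' \<in> \<Gamma>" using p K K' in_components_subset by blast+
    obtain z where z: "z 0 = p" "orbit z" using orbit_exists[OF G(1)] by blast
    have "dist p p' < \<rho>0" using p(2,4) dist_triangle_half_r[of x p \<rho>0 p'] by simp
    then have "dist (z 0) p' < \<rho>0" using z by simp
    then obtain s where "z (0 + s) = p'" using orbit_hits_near[OF z(2) G(2)] by blast
    then have "p' \<in> range z" by blast
    moreover have "range z = K" using orbit_range_component[OF z(2) K(1), of 0] z(1) p(1) by simp
    ultimately have "K \<inter> K' \<noteq> {}" using p(3) by blast
    then show ?thesis using components_eq[OF K(1) K'(1)] by simp
  qed
  have "components \<Gamma> \<subseteq> c ` k"
  proof
    fix K assume K: "K \<in> components \<Gamma>"
    then obtain p where p: "p \<in> K" using in_components_nonempty by blast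
    then have "p \<in> \<Gamma>" using K in_components_subset by blast
    then obtain x where x: "x \<in> k" "p \<in> ball x (\<rho>0 / 2)" using k(3) by blast
    then have *: "K \<in> components \<Gamma> \<and> K \<inter> ball x (\<rho>0 / 2) \<noteq> {}" using K p by blast
    then have "c x \<in> components \<Gamma> \<and> c x \<inter> ball x (\<rho>0 / 2) \<noteq> {}" unfolding c_def by (rule someI)
    with * have "c x = K" using uniq by blast
    then show "K \<in> c ` k" using x(1) by blast
  qed
  then show ?thesis using k(1) finite_surj by blast
qed

text \<open>\<open>hamiltonian_orbit\<close> only asks the curve to stay in D; tangency confines it
  to \<Gamma> once it starts there.\<close>

lemma hamiltonian_orbit_iff:
  assumes "z 0 \<in> \<Gamma>"
  shows "hamiltonian_orbit D g z T \<longleftrightarrow> orbit z \<and> least_period z T"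
proof -
  have gr: "vector [- (grad g x $ 2), grad g x $ 1] = rot (G x)" if "x \<in> D" for x
    using grad_eqI[OF g_deriv[OF that]] by (simp add: rot_def)
  have "(\<forall>t. z t \<in> D \<and> (z has_vector_derivative vector [- (grad g (z t) $ 2), grad g (z t) $ 1]) (at t)) \<longleftrightarrow> orbit z"
  proof
    assume *: "\<forall>t. z t \<in> D \<and> (z has_vector_derivative vector [- (grad g (z t) $ 2), grad g (z t) $ 1]) (at t)"
    then have d: "(z has_vector_derivative rot (G (z t))) (at t)" for t using gr by metis
    have "z t \<in> \<Gamma>" for t
      by (rule stays_in_Gamma[of z, OF _ assms]) (use d in \<open>auto intro!: exI[of _ "rot (G (z _))"]\<close>)
    with d show "orbit z" by (simp add: orbit_def)
  next
    assume "orbit z"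
    then show "\<forall>t. z t \<in> D \<and> (z has_vector_derivative vector [- (grad g (z t) $ 2), grad g (z t) $ 1]) (at t)"
      using Gamma_subset_D gr unfolding orbit_def by (metis subsetD)
  qed
  then show ?thesis unfolding hamiltonian_orbit_def least_period_def by blast
qed

text \<open>The same choice term as in \<open>boundary_integral\<close>, so that its summands can be
  folded into \<open>zK\<close> and \<open>TK\<close>.\<close>

definition the_orbit :: "(real^2) set \<Rightarrow> (real \<Rightarrow> real^2) \<times> real" where
  "the_orbit K = (SOME (z, T). z 0 \<in> K \<and> hamiltonian_orbit D g z T)"

abbreviation zK :: "(real^2) set \<Rightarrow> real \<Rightarrow> real^2" where "zK K \<equiv> fst (the_orbit K)"
abbreviation TK :: "(real^2) set \<Rightarrow> real" where "TK K \<equiv> snd (the_orbit K)"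

lemma the_orbit:
  assumes K: "K \<in> components \<Gamma>"
  shows "orbit (zK K)" "least_period (zK K) (TK K)" "TK K > 0" "inj_on (zK K) {0..<TK K}" "zK K ` {0..<TK K} = K"
proof -
  obtain q where q: "q \<in> K" using in_components_nonempty[OF K] by blast
  have KG: "K \<subseteq> \<Gamma>" using in_components_subset[OF K] .
  obtain z where z: "z 0 = q" "orbit z" using orbit_exists q KG by blast
  obtain T where T: "least_period z T" using least_period_exists[OF z(2)] by blast
  have "z 0 \<in> K \<and> hamiltonian_orbit D g z T" using hamiltonian_orbit_iff[of z T] z T q KG by auto
  then have "case (z, T) of (z, T) \<Rightarrow> z 0 \<in> K \<and> hamiltonian_orbit D g z T" by simp
  then have "case the_orbit K of (z, T) \<Rightarrow> z 0 \<in> K \<and> hamiltonian_orbit D g z T"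
    unfolding the_orbit_def by (rule someI)
  then have *: "zK K 0 \<in> K" "hamiltonian_orbit D g (zK K) (TK K)" by (auto simp: split_beta)
  then show o: "orbit (zK K)" and l: "least_period (zK K) (TK K)" using hamiltonian_orbit_iff[of "zK K" "TK K"] KG by auto
  then show "TK K > 0" by (simp add: least_period_def)
  show "inj_on (zK K) {0..<TK K}" by (rule least_period_inj[OF o l])
  show "zK K ` {0..<TK K} = K" using least_period_range[OF l] orbit_range_component[OF o K *(1)] by simp
qed

lemma boundary_integral_eq:
  "boundary_integral D E g \<phi> = (\<Sum>K\<in>components \<Gamma>.
     ext_integral (lebesgue_on {0..TK K}) (\<lambda>t. \<phi> (zK K t) * norm (G (zK K t))))"
  unfolding boundary_integral_def
proof (rule sum.cong[OF refl])
  fix K assume K: "K \<in> components \<Gamma>"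
  have "vector_derivative (zK K) (at t) = rot (G (zK K t))" for t
    using the_orbit(1)[OF K] by (simp add: orbit_def vector_derivative_at)
  then show "(let (z, T) = SOME (z, T). z 0 \<in> K \<and> hamiltonian_orbit D g z T
      in ext_integral (lebesgue_on {0..T}) (\<lambda>t. \<phi> (z t) * norm (vector_derivative z (at t)))) =
    ext_integral (lebesgue_on {0..TK K}) (\<lambda>t. \<phi> (zK K t) * norm (G (zK K t)))"
    unfolding the_orbit_def[symmetric] by (simp add: Let_def split_beta)
qed

end

section \<open>Tubular neighbourhood of the boundary\<close>

text \<open>Fubini on real \<times> real, carried over by the coordinate bijection, which maps boxes
  to boxes of equal measure.\<close>

lemma integral_cbox_real2:
  fixes f :: "real^2 \<Rightarrow> real"
  assumes f: "continuous_on (cbox (vector [a, c]) (vector [b, d])) f"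
  shows "integral (cbox (vector [a, c]) (vector [b, d])) f =
    integral {a..b} (\<lambda>s. integral {c..d} (\<lambda>t. f (vector [s, t])))"
proof -
  define \<gamma> :: "real \<times> real \<Rightarrow> real^2" where "\<gamma> p = vector [fst p, snd p]" for p
  define \<eta> :: "real^2 \<Rightarrow> real \<times> real" where "\<eta> x = (x $ 1, x $ 2)" for x
  have inv: "\<eta> (\<gamma> p) = p" "\<gamma> (\<eta> x) = x" for p x
    by (auto simp: \<gamma>_def \<eta>_def vec_eq_iff forall_2)
  have \<gamma>_cont: "continuous_on S \<gamma>" for S
  proof -
    have c: "continuous_on S (\<lambda>p::real \<times> real. if i = 1 then fst p else snd p)" for i :: 2
      by (cases "i = 1") (auto intro!: continuous_intros)
    have eq: "\<gamma> = (\<lambda>p. \<chi> i. if i = 1 then fst p else snd p)"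
      by (auto simp: \<gamma>_def fun_eq_iff vec_eq_iff forall_2)
    show ?thesis unfolding eq by (rule continuous_on_vec_lambda, rule c)
  qed
  have im: "y \<in> \<eta> ` A \<longleftrightarrow> \<gamma> y \<in> A" "x \<in> \<gamma> ` B \<longleftrightarrow> \<eta> x \<in> B" for x y A B
  proof -
    have "\<gamma> y \<in> A" if "y \<in> \<eta> ` A" using that inv by force
    moreover have "y \<in> \<eta> ` A" if "\<gamma> y \<in> A" using imageI[OF that, of \<eta>] by (simp add: inv)
    moreover have "\<eta> x \<in> B" if "x \<in> \<gamma> ` B" using that inv by force
    moreover have "x \<in> \<gamma> ` B" if "\<eta> x \<in> B" using imageI[OF that, of \<gamma>] by (simp add: inv)
    ultimately show "y \<in> \<eta> ` A \<longleftrightarrow> \<gamma> y \<in> A" "x \<in> \<gamma> ` B \<longleftrightarrow> \<eta> x \<in> B" by iprover+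
  qed
  have \<eta>_im: "\<eta> ` cbox u v = cbox (\<eta> u) (\<eta> v)" for u v
    by (rule set_eqI, unfold im) (auto simp: \<eta>_def \<gamma>_def mem_box_cart forall_2)
  have \<gamma>_im: "\<gamma> ` cbox u v = cbox (\<gamma> u) (\<gamma> v)" for u v
    by (rule set_eqI, unfold im, cases u, cases v) (auto simp: \<eta>_def \<gamma>_def mem_box_cart forall_2)
  have cont: "measure lborel (\<gamma> ` cbox u v) = 1 * measure lborel (cbox u v)" for u v
  proof -
    have ex2: "(\<exists>i::2. P i) \<longleftrightarrow> P 1 \<or> P 2" for P by (metis exhaust_2)
    have "measure lborel (cbox (\<gamma> u) (\<gamma> v)) = measure lborel (cbox (fst u) (fst v)) * measure lborel (cbox (snd u) (snd v))"
      by (auto simp: content_cbox_if_cart \<gamma>_def UNIV_2 interval_eq_empty_cart ex2 content_real_if)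
    then show ?thesis unfolding \<gamma>_im by (cases u; cases v) (simp add: content_Pair)
  qed
  have fi: "(f has_integral integral (cbox (vector [a, c]) (vector [b, d])) f) (cbox (vector [a, c]) (vector [b, d]))"
    using f by (intro integrable_integral integrable_continuous)
  have "((\<lambda>x. f (\<gamma> x)) has_integral (1 / 1) *\<^sub>R integral (cbox (vector [a, c]) (vector [b, d])) f)
      (\<eta> ` cbox (vector [a, c]) (vector [b, d]))"
  proof (rule has_integral_twiddle[OF _ inv _ _ _ _ fi])
    show "isCont \<gamma> x" for x using \<gamma>_cont[of UNIV] by (cases x) (simp add: continuous_on_eq_continuous_at)
    show "\<exists>w z. \<gamma> ` cbox u v = cbox w z" for u v using \<gamma>_im by blast
    show "\<exists>w z. \<eta> ` cbox u v = cbox w z" for u v using \<eta>_im by blast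
    show "measure lborel (\<gamma> ` cbox u v) = 1 * measure lborel (cbox u v)" for u v by (rule cont)
  qed simp
  then have "integral (cbox (a, c) (b, d)) (\<lambda>x. f (\<gamma> x)) = integral (cbox (vector [a, c]) (vector [b, d])) f"
    unfolding \<eta>_im by (simp add: \<eta>_def integral_unique)
  moreover have "continuous_on (cbox (a, c) (b, d)) (\<lambda>x. f (\<gamma> x))"
  proof (rule continuous_on_compose2[OF f \<gamma>_cont])
    show "\<gamma> ` cbox (a, c) (b, d) \<subseteq> cbox (vector [a, c]) (vector [b, d])"
      unfolding \<gamma>_im by (simp add: \<gamma>_def)
  qed
  ultimately show ?thesis
    using integral_prod_continuous[of a c b d "\<lambda>x. f (\<gamma> x)"] by (simp add: \<gamma>_def)
qed

text \<open>Derivative of the cubic step 3 s^2 - 2 s^3 shifted to [1, 2]. The transition starts at 1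
  and not at 0, so that \<open>ramp (- g / \<delta>)\<close> vanishes on the whole layer - g \<le>
  \<delta> next to \<Gamma> and cut-off functions have compact support.\<close>

definition ramp' :: "real \<Rightarrow> real" where "ramp' s = max 0 (6 * (s - 1) * (2 - s))"

definition ramp :: "real \<Rightarrow> real" where
  "ramp s = (if s \<le> 1 then 0 else if 2 \<le> s then 1 else 3 * (s - 1)\<^sup>2 - 2 * (s - 1) ^ 3)"

lemma DERIV_pos_part_square: "((\<lambda>x. (max 0 x)\<^sup>2) has_real_derivative 2 * max 0 x) (at (x::real))"
proof -
  consider "x < 0" | "x > 0" | "x = 0" by linarith
  then show ?thesis
  proof cases
    case 1
    have "((\<lambda>x. 0) has_real_derivative 2 * max 0 x) (at x)" using 1 by simp
    then show ?thesis
      by (rule has_field_derivative_transform_within_open[where S = "{..<0}"]) (use 1 in auto)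
  next
    case 2
    have "((\<lambda>x. x\<^sup>2) has_real_derivative 2 * max 0 x) (at x)" using 2 by (auto intro!: derivative_eq_intros)
    then show ?thesis
      by (rule has_field_derivative_transform_within_open[where S = "{0<..}"]) (use 2 in auto)
  next
    case 3
    have "((\<lambda>h. (max 0 h)\<^sup>2 / h) \<longlongrightarrow> (0::real)) (at 0)"
    proof (rule Lim_null_comparison)
      have "norm ((max 0 h)\<^sup>2 / h) \<le> \<bar>h\<bar>" for h :: real by (auto simp: max_def power2_eq_square)
      then show "\<forall>\<^sub>F h in at (0::real). norm ((max 0 h)\<^sup>2 / h) \<le> \<bar>h\<bar>" by (intro always_eventually allI)
      show "((\<lambda>h::real. \<bar>h\<bar>) \<longlongrightarrow> 0) (at 0)" by (intro tendsto_rabs_zero tendsto_ident_at)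
    qed
    with 3 show ?thesis by (simp add: DERIV_def)
  qed
qed

text \<open>Written with linear factors times squared positive parts, the function needs no gluing
  at the knots 1 and 2, because the squared positive part is differentiable everywhere.\<close>

lemma ramp_DERIV: "(ramp has_real_derivative ramp' s) (at s)"
proof -
  let ?u = "\<lambda>s::real. s - 1" and ?v = "\<lambda>s::real. s - 2"
  have eq: "ramp = (\<lambda>s. (3 - 2 * ?u s) * (max 0 (?u s))\<^sup>2 + (3 + 2 * ?v s) * (max 0 (?v s))\<^sup>2)"
    by (rule ext) (auto simp: ramp_def max_def power2_eq_square power3_eq_cube algebra_simps)
  have d: "((\<lambda>s. (max 0 (s - c))\<^sup>2) has_real_derivative 2 * max 0 (s - c)) (at s)" for c :: real
  proof -
    have "((\<lambda>s. s - c) has_real_derivative 1) (at s)" by (auto intro!: derivative_eq_intros)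
    from DERIV_chain2[where f = "\<lambda>x. (max 0 x)\<^sup>2", OF DERIV_pos_part_square this] show ?thesis by simp
  qed
  have l: "((\<lambda>s. a + b * (s - c)) has_real_derivative b) (at s)" for a b c :: real
    by (auto intro!: derivative_eq_intros)
  have "(ramp has_real_derivative (- 2) * (max 0 (?u s))\<^sup>2 + (2 * max 0 (?u s)) * (3 - 2 * ?u s) +
      (2 * (max 0 (?v s))\<^sup>2 + (2 * max 0 (?v s)) * (3 + 2 * ?v s))) (at s)"
    unfolding eq using DERIV_add[OF DERIV_mult[OF l[of 3 "- 2" 1] d[of 1]] DERIV_mult[OF l[of 3 2 2] d[of 2]]] by simp
  moreover have "(- 2) * (max 0 (?u s))\<^sup>2 + (2 * max 0 (?u s)) * (3 - 2 * ?u s) +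
      (2 * (max 0 (?v s))\<^sup>2 + (2 * max 0 (?v s)) * (3 + 2 * ?v s)) = ramp' s"
  proof -
    consider "s \<le> 1" | "1 < s" "s < 2" | "2 \<le> s" by linarith
    then show ?thesis
    proof cases
      case 1
      then have "6 * (s - 1) * (2 - s) \<le> 0" by (simp add: mult_le_0_iff)
      with 1 show ?thesis by (simp add: ramp'_def)
    next
      case 2
      then have "6 * (s - 1) * (2 - s) \<ge> 0" by simp
      with 2 show ?thesis by (simp add: ramp'_def power2_eq_square algebra_simps)
    next
      case 3
      then have "6 * (s - 1) * (2 - s) \<le> 0" by (simp add: mult_le_0_iff)
      with 3 show ?thesis by (simp add: ramp'_def power2_eq_square algebra_simps)
    qed
  qed
  ultimately show ?thesis by simp
qed

lemma ramp'_nonneg: "0 \<le> ramp' s"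
  by (simp add: ramp'_def)

lemma ramp'_le: "ramp' s \<le> 2"
proof -
  have "6 * (s - 1) * (2 - s) = 3 / 2 - 6 * (s - 3 / 2)\<^sup>2" by (simp add: power2_eq_square algebra_simps)
  moreover have "0 \<le> (s - 3 / 2)\<^sup>2" by simp
  ultimately have "6 * (s - 1) * (2 - s) \<le> 2" by linarith
  then show ?thesis unfolding ramp'_def by (intro max.boundedI) auto
qed

lemma ramp'_eq_0: "s \<le> 1 \<or> 2 \<le> s \<Longrightarrow> ramp' s = 0"
  by (auto simp: ramp'_def max_def mult_le_0_iff zero_le_mult_iff)

lemma ramp'_continuous: "continuous_on S ramp'"
  unfolding ramp'_def by (intro continuous_intros)

lemma ramp_mono: "s \<le> t \<Longrightarrow> ramp s \<le> ramp t"
  by (rule DERIV_nonneg_imp_nondecreasing) (use ramp_DERIV ramp'_nonneg in blast)+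

lemma ramp_bounds: "0 \<le> ramp s" "ramp s \<le> 1"
  using ramp_mono[of "min s 1" s] ramp_mono[of s "max s 2"] by (auto simp: ramp_def)

lemma ramp_eq_0: "s \<le> 1 \<Longrightarrow> ramp s = 0" and ramp_eq_1: "2 \<le> s \<Longrightarrow> ramp s = 1"
  by (auto simp: ramp_def)

context level_domain
begin

text \<open>The interval \<open>[\<alpha>, \<beta>]\<close> is chosen so that \<open>- g / \<delta>\<close>, which along \<open>q - (\<delta> * \<sigma>) *\<^sub>R G q\<close> is close to
  \<open>\<sigma> * (norm (G q))\<^sup>2\<close>, covers \<open>[1, 2]\<close>.\<close>

definition \<alpha> :: real where "\<alpha> = 1 / (2 * M\<^sup>2)"
definition \<beta> :: real where "\<beta> = 3 / m\<^sup>2"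

lemma m_le_M: "m \<le> M"
  using Gamma_nonempty norm_G_Gamma by fastforce

lemma \<alpha>_pos: "\<alpha> > 0" and \<beta>_pos: "\<beta> > 0" and \<alpha>_le_\<beta>: "\<alpha> \<le> \<beta>"
proof -
  show "\<alpha> > 0" "\<beta> > 0" using M_pos m by (auto simp: \<alpha>_def \<beta>_def)
  have "m\<^sup>2 \<le> M\<^sup>2" using m m_le_M by (intro power_mono) auto
  then have "m\<^sup>2 \<le> 6 * M\<^sup>2" using zero_le_power2[of M] by linarith
  then show "\<alpha> \<le> \<beta>" using m M_pos by (simp add: \<alpha>_def \<beta>_def divide_simps)
qed

text \<open>Displacements s \<le> e0 along - G q stay within r / 2, where the sign of g decides
  membership in \<Omega>. The second bound provides the factor 1/2 for the absorption in
  \<open>tube_injective\<close>.\<close>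

definition e0 :: real where "e0 = min (r / (2 * M)) (m / (16 * M\<^sup>2))"

lemma e0: "e0 > 0" "e0 * M \<le> r / 2" "e0 \<le> \<tau>" "4 * M * M * e0 \<le> m / 4"
proof -
  show "e0 > 0" using r(1) M_pos m by (simp add: e0_def)
  have "e0 \<le> r / (2 * M)" "e0 \<le> m / (16 * M\<^sup>2)" by (auto simp: e0_def)
  then show 1: "e0 * M \<le> r / 2" and "4 * M * M * e0 \<le> m / 4"
    using M_pos by (simp_all add: field_simps power2_eq_square)
  have "\<tau> * m \<le> \<tau> * M" using \<tau>(1) m_le_M by (intro mult_left_mono) auto
  moreover have "\<tau> * M > 0" using \<tau>(1) M_pos by simp
  ultimately have "e0 * M \<le> \<tau> * M" using 1 r(2) by linarith
  then show "e0 \<le> \<tau>" using M_pos by simp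
qed

lemma tube_in_Omega:
  assumes q: "q \<in> \<Gamma>" and s: "0 < s" "s \<le> e0"
  shows "q - s *\<^sub>R G q \<in> \<Omega>" "q - s *\<^sub>R G q \<in> cball q R"
proof -
  have a: "0 < norm (G q)" "norm (G q) \<le> M" using norm_G_Gamma[OF q] m by auto
  have "s * norm (G q) \<le> e0 * M" using a s e0(1) by (intro mult_mono) auto
  then have n: "s * norm (G q) \<le> r / 2" using e0(2) by linarith
  then have b: "q - s *\<^sub>R G q \<in> ball q r" using s r(1) by (simp add: dist_norm)
  have "g (q - s *\<^sub>R G q) \<le> g q - 55 / 64 * s * (norm (G q))\<^sup>2"
    using r(1) s e0(3) by (intro g_descent(2)[OF q]) auto
  moreover have "0 < 55 / 64 * s * (norm (G q))\<^sup>2" using s a by simp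
  ultimately have "g (q - s *\<^sub>R G q) < 0" using g_zero_on_frontier[OF q] by linarith
  then show "q - s *\<^sub>R G q \<in> \<Omega>" using near_Gamma_Omega[OF q b] by simp
  show "q - s *\<^sub>R G q \<in> cball q R" using n s r R(1) by (simp add: dist_norm)
qed

text \<open>Two base points with a common foot differ by \<open>d\<close>, which is nearly tangential since \<open>g\<close>
  vanishes at both, and nearly normal since the foot is common; hence \<open>d = 0\<close>.\<close>

lemma tube_injective:
  assumes q: "q \<in> \<Gamma>" "q' \<in> \<Gamma>" and s: "0 < s" "s \<le> e0" "0 < s'" "s' \<le> e0"
    and eq: "q - s *\<^sub>R G q = q' - s' *\<^sub>R G q'"
  shows "q = q' \<and> s = s'"
proof -
  let ?a = "norm (G q)"
  define d where "d = q - q'"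
  have a: "m \<le> ?a" "?a \<le> M" "0 < ?a" "norm (G q') \<le> M" using norm_G_Gamma[OF q(1)] norm_G_Gamma[OF q(2)] m by auto
  have deq: "d = s *\<^sub>R G q - s' *\<^sub>R G q'" using eq by (simp add: d_def algebra_simps)
  have "norm d \<le> s * ?a + s' * norm (G q')"
    unfolding deq using norm_triangle_ineq4[of "s *\<^sub>R G q" "s' *\<^sub>R G q'"] s by simp
  also have "\<dots> \<le> e0 * M + e0 * M" using s a by (intro add_mono mult_mono) auto
  finally have nd: "norm d \<le> 2 * e0 * M" by (simp add: mult_ac)
  then have q'b: "q' \<in> cball q R" using e0(2) r(3) R(1) by (simp add: d_def dist_norm)
  have qb: "q \<in> cball q R" using R(1) by simp
  have lip: "norm (G q - G q') \<le> 2 * M * norm d"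
    unfolding d_def by (rule G_lipschitz[OF convex_cball R(2)[OF q(1)] qb q'b])
  have "\<bar>g q' - g q - (q' - q) \<bullet> G q\<bar> \<le> 2 * M * (norm (q' - q))\<^sup>2"
    by (rule g_taylor[OF convex_cball R(2)[OF q(1)] q'b qb])
  then have tan: "\<bar>d \<bullet> G q\<bar> \<le> 2 * M * (norm d)\<^sup>2"
    using g_zero_on_frontier[OF q(1)] g_zero_on_frontier[OF q(2)]
    by (simp add: d_def inner_diff_left norm_minus_commute abs_minus_commute)
  have deq': "d = (s - s') *\<^sub>R G q + s' *\<^sub>R (G q - G q')" using deq by (simp add: algebra_simps)
  have "d \<bullet> G q = (s - s') * ?a\<^sup>2 + s' * ((G q - G q') \<bullet> G q)"
    by (subst deq') (simp add: inner_add_left power2_norm_eq_inner)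
  then have "\<bar>s - s'\<bar> * ?a\<^sup>2 = \<bar>d \<bullet> G q - s' * ((G q - G q') \<bullet> G q)\<bar>"
    by (simp add: abs_mult)
  also have "\<dots> \<le> \<bar>d \<bullet> G q\<bar> + s' * \<bar>(G q - G q') \<bullet> G q\<bar>" using s abs_triangle_ineq4[of "d \<bullet> G q" "s' * ((G q - G q') \<bullet> G q)"]
    by (simp add: abs_mult)
  also have "\<bar>(G q - G q') \<bullet> G q\<bar> \<le> (2 * M * norm d) * ?a"
    using Cauchy_Schwarz_ineq2[of "G q - G q'" "G q"] mult_right_mono[OF lip norm_ge_zero[of "G q"]] by linarith
  finally have "\<bar>s - s'\<bar> * ?a\<^sup>2 \<le> 2 * M * (norm d)\<^sup>2 + s' * (2 * M * norm d * ?a)"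
    using tan s by (simp add: mult_left_mono)
  then have "(\<bar>s - s'\<bar> * ?a) * ?a \<le> (2 * M * norm d * norm d / ?a + s' * (2 * M * norm d)) * ?a"
    using a(3) by (simp add: power2_eq_square algebra_simps)
  then have 1: "\<bar>s - s'\<bar> * ?a \<le> 2 * M * norm d * norm d / ?a + s' * (2 * M * norm d)"
    using a(3) by simp
  have "norm d \<le> \<bar>s - s'\<bar> * ?a + s' * norm (G q - G q')"
    using norm_triangle_ineq[of "(s - s') *\<^sub>R G q" "s' *\<^sub>R (G q - G q')"] s by (subst deq') simp
  also have "\<dots> \<le> (2 * M * norm d * norm d / ?a + s' * (2 * M * norm d)) + s' * (2 * M * norm d)"
    using 1 lip s by (intro add_mono mult_left_mono) auto
  also have "\<dots> = norm d * (2 * M * norm d / ?a + 4 * M * s')" by (simp add: algebra_simps)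
  \<comment> \<open>Both terms in the bracket are at most 1/4, so norm d is at most half of itself
    and must vanish.\<close>
  also have "\<dots> \<le> norm d * (1 / 2)"
  proof (rule mult_left_mono)
    have "2 * M * norm d \<le> 2 * M * (2 * e0 * M)" using nd M_pos by (intro mult_left_mono) auto
    also have "\<dots> \<le> m / 4" using e0(4) by (simp add: mult_ac)
    also have "\<dots> \<le> 1 / 4 * ?a" using a by simp
    finally have "2 * M * norm d / ?a \<le> 1 / 4" using a(3) by (simp add: pos_divide_le_eq)
    moreover have "4 * M * s' \<le> 1 / 4"
    proof -
      have "4 * M * s' * M \<le> 4 * M * e0 * M" using s M_pos by (intro mult_right_mono mult_left_mono) auto
      also have "\<dots> \<le> 1 / 4 * M" using e0(4) m_le_M by (simp add: mult_ac)
      finally show ?thesis using M_pos by (simp add: mult_ac)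
    qed
    ultimately show "2 * M * norm d / ?a + 4 * M * s' \<le> 1 / 2" by simp
  qed simp
  finally have "norm d = 0" using norm_ge_zero[of d] by linarith
  then have "q = q'" by (simp add: d_def)
  moreover from this eq a(3) have "s = s'" by auto
  ultimately show ?thesis by simp
qed

text \<open>On the compact part of the closure at distance at least \<rho> from \<Gamma>, if
  nonempty, g attains a negative maximum. The threshold is a quarter of its modulus, so that 2
  \<delta> stays strictly below it.\<close>

lemma near_boundary_uniform:
  assumes "\<rho> > 0" obtains \<delta> where "\<delta> > 0" "\<And>x. x \<in> \<Omega> \<Longrightarrow> - g x \<le> 2 * \<delta> \<Longrightarrow> infdist x \<Gamma> < \<rho>"
proof -
  let ?C = "{x \<in> closure \<Omega>. \<rho> \<le> infdist x \<Gamma>}"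
  have "closed ?C"
    using continuous_closed_preimage[of "closure \<Omega>" "\<lambda>x. infdist x \<Gamma>" "{\<rho>..}"]
      continuous_on_infdist[OF continuous_on_id, of "closure \<Omega>" \<Gamma>]
    by (simp add: vimage_def Int_def)
  then have C: "compact ?C" using compact_closure_Omega
    by (metis (no_types, lifting) bounded_subset compact_eq_bounded_closed mem_Collect_eq subsetI)
  show thesis
  proof (cases "?C = {}")
    case True
    then have "\<And>x. x \<in> \<Omega> \<Longrightarrow> infdist x \<Gamma> < \<rho>" using closure_subset[of \<Omega>] by (force simp: not_le)
    then show thesis using that[of 1] by simp
  next
    case False
    have "continuous_on ?C g" using g_continuous closure_Omega_subset by (rule_tac continuous_on_subset) auto
    then obtain x0 where x0: "x0 \<in> ?C" "\<And>x. x \<in> ?C \<Longrightarrow> g x \<le> g x0"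
      using continuous_attains_sup[OF C False] by blast
    have "x0 \<notin> \<Gamma>" using x0(1) assms by (auto simp: infdist_zero)
    then have "x0 \<in> \<Omega>" using x0(1) open_Omega by (auto simp: frontier_def interior_open)
    then have neg: "g x0 < 0" by (rule g_neg_on_Omega)
    show thesis
    proof (rule that[of "- g x0 / 4"])
      fix x assume x: "x \<in> \<Omega>" "- g x \<le> 2 * (- g x0 / 4)"
      show "infdist x \<Gamma> < \<rho>"
      proof (rule ccontr)
        assume "\<not> ?thesis"
        then have "x \<in> ?C" using x(1) closure_subset by auto
        then have "g x \<le> g x0" by (rule x0(2))
        then show False using x(2) neg by linarith
      qed
    qed (use neg in simp)
  qed
qed

text \<open>The base point is a nearest boundary point. Minimality of the distance along the orbit
  through it makes the offset orthogonal to the tangent, hence a multiple of G q, whose size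
  Taylor's formula reads off from g x.\<close>

lemma tube_covers:
  obtains \<delta>1 where "\<delta>1 > 0" "\<And>\<delta> x. 0 < \<delta> \<Longrightarrow> \<delta> \<le> \<delta>1 \<Longrightarrow> x \<in> \<Omega> \<Longrightarrow> \<delta> \<le> - g x \<Longrightarrow> - g x \<le> 2 * \<delta> \<Longrightarrow>
    \<exists>q\<in>\<Gamma>. \<exists>\<sigma>. \<alpha> \<le> \<sigma> \<and> \<sigma> \<le> \<beta> \<and> x = q - (\<delta> * \<sigma>) *\<^sub>R G q"
proof -
  define \<rho> where "\<rho> = min R (m / (8 * M))"
  have \<rho>: "\<rho> > 0" "\<rho> \<le> R" "\<rho> \<le> m / (8 * M)" using R(1) m M_pos by (auto simp: \<rho>_def)
  obtain \<delta>1 where \<delta>1: "\<delta>1 > 0" "\<And>x. x \<in> \<Omega> \<Longrightarrow> - g x \<le> 2 * \<delta>1 \<Longrightarrow> infdist x \<Gamma> < \<rho>"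
    using near_boundary_uniform[OF \<rho>(1)] by blast
  show thesis
  proof (rule that[OF \<delta>1(1)])
    fix \<delta> x assume \<delta>: "0 < \<delta>" "\<delta> \<le> \<delta>1" and x: "x \<in> \<Omega>" "\<delta> \<le> - g x" "- g x \<le> 2 * \<delta>"
    have inf: "infdist x \<Gamma> < \<rho>" using x \<delta> by (intro \<delta>1(2)) auto
    obtain q where q: "q \<in> \<Gamma>" "infdist x \<Gamma> = dist x q"
      using infdist_attains_inf[OF compact_imp_closed[OF compact_Gamma] Gamma_nonempty] by metis
    let ?a = "norm (G q)"
    have a: "m \<le> ?a" "?a \<le> M" "0 < ?a" using norm_G_Gamma[OF q(1)] m by auto
    obtain z where z: "z 0 = q" "orbit z" using orbit_exists[OF q(1)] by blast
    let ?\<phi> = "\<lambda>t. (x - z t) \<bullet> (x - z t)"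
    have der: "(?\<phi> has_real_derivative - 2 * ((x - q) \<bullet> rot (G q))) (at 0)"
    proof -
      have "(z has_vector_derivative rot (G q)) (at 0)" using z by (auto simp: orbit_def)
      then show ?thesis
        unfolding has_vector_derivative_def has_field_derivative_def
        by (auto intro!: derivative_eq_intros simp: fun_eq_iff z(1) inner_commute)
    qed
    have "?\<phi> 0 \<le> ?\<phi> t" for t
    proof -
      have "z t \<in> \<Gamma>" using z by (simp add: orbit_def)
      then have "dist x q \<le> dist x (z t)" using q(2) infdist_le by metis
      then show ?thesis using z(1) by (simp add: dist_norm norm_eq_sqrt_inner)
    qed
    then have "- 2 * ((x - q) \<bullet> rot (G q)) = 0"
      by (intro DERIV_local_min[OF der, of 1]) auto
    then have "(x - q) \<bullet> rot (G q) = 0" by simp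
    then obtain l where l: "x - q = l *\<^sub>R G q" using orthogonal_rot_imp_parallel[of "x - q" "G q"] a(3) by auto
    have ln: "\<bar>l\<bar> * ?a = dist x q" using l by (simp add: dist_norm)
    have "\<bar>l\<bar> * m \<le> \<bar>l\<bar> * ?a" using a by (intro mult_left_mono) auto
    also have "\<dots> \<le> m / (8 * M)" using ln inf q(2) \<rho>(3) by linarith
    finally have lM: "2 * M * \<bar>l\<bar> \<le> 1 / 4" using m M_pos by (simp add: field_simps)
    have xb: "x \<in> cball q R" using inf q(2) \<rho>(2) by (simp add: dist_commute)
    have "\<bar>g x - g q - (x - q) \<bullet> G q\<bar> \<le> 2 * M * (norm (x - q))\<^sup>2"
      using xb R(1) by (intro g_taylor[OF convex_cball R(2)[OF q(1)]]) auto
    then have "\<bar>g x - l * ?a\<^sup>2\<bar> \<le> 2 * M * (\<bar>l\<bar> * ?a)\<^sup>2"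
      using g_zero_on_frontier[OF q(1)] l by (simp add: power2_norm_eq_inner)
    also have "\<dots> = (2 * M * \<bar>l\<bar>) * (\<bar>l\<bar> * ?a\<^sup>2)" by (simp add: power2_eq_square)
    also have "\<dots> \<le> 1 / 4 * (\<bar>l\<bar> * ?a\<^sup>2)" using lM by (intro mult_right_mono) auto
    finally have gl: "\<bar>g x - l * ?a\<^sup>2\<bar> \<le> 1 / 4 * (\<bar>l\<bar> * ?a\<^sup>2)" .
    have l_neg: "l < 0"
    proof (rule ccontr)
      assume "\<not> l < 0"
      then have "\<bar>l\<bar> * ?a\<^sup>2 = l * ?a\<^sup>2" "0 \<le> l * ?a\<^sup>2" by auto
      then have "g x \<ge> 0" using gl by linarith
      then show False using g_neg_on_Omega[OF x(1)] by simp
    qed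
    define s where "s = - l"
    have s: "s > 0" "\<bar>l\<bar> * ?a\<^sup>2 = s * ?a\<^sup>2" "l * ?a\<^sup>2 = - (s * ?a\<^sup>2)" using l_neg by (auto simp: s_def)
    \<comment> \<open>The value \<open>- g x\<close> lies between 3/4 and 5/4 of s (norm (G q))^2.
      With \<delta> \<le> - g x \<le> 2 \<delta> this gives 4/5 and 8/3, within the margins 1/2 and
      3 in \<open>\<alpha>\<close> and \<open>\<beta>\<close>.\<close>
    have lo: "4 / 5 * \<delta> \<le> s * ?a\<^sup>2" and hi: "s * ?a\<^sup>2 \<le> 8 / 3 * \<delta>" using gl s x by linarith+
    have "?a\<^sup>2 \<le> M\<^sup>2" "m\<^sup>2 \<le> ?a\<^sup>2" using a m by (auto intro!: power_mono)
    then have "s * ?a\<^sup>2 \<le> s * M\<^sup>2" "s * m\<^sup>2 \<le> s * ?a\<^sup>2" using s(1) by (auto intro!: mult_left_mono)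
    then have "4 / 5 * \<delta> \<le> s * M\<^sup>2" "s * m\<^sup>2 \<le> 8 / 3 * \<delta>" using lo hi by auto
    then have "\<alpha> \<le> s / \<delta>" "s / \<delta> \<le> \<beta>"
      using \<delta> m M_pos by (auto simp: \<alpha>_def \<beta>_def field_simps)
    moreover have "x = q - (\<delta> * (s / \<delta>)) *\<^sub>R G q" using l \<delta> by (simp add: s_def algebra_simps)
    ultimately show "\<exists>q\<in>\<Gamma>. \<exists>\<sigma>. \<alpha> \<le> \<sigma> \<and> \<sigma> \<le> \<beta> \<and> x = q - (\<delta> * \<sigma>) *\<^sub>R G q"
      using q(1) by blast
  qed
qed

end

section \<open>Boundary integrals as limits over thin strips\<close>

text \<open>The scalar integrand is wrapped as a vector in real^1 to apply the theorem for
  vector-valued functions, and recovered as its only component.\<close>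

lemma change_of_variables_real2:
  fixes f :: "real^2 \<Rightarrow> real" and \<Psi> :: "real^2 \<Rightarrow> real^2"
  assumes S: "S \<in> sets lebesgue" and der: "\<And>x. x \<in> S \<Longrightarrow> (\<Psi> has_derivative \<Psi>' x) (at x within S)"
    and inj: "inj_on \<Psi> S" and int: "(\<lambda>x. \<bar>det (matrix (\<Psi>' x))\<bar> * f (\<Psi> x)) absolutely_integrable_on S"
  shows "(f has_integral integral S (\<lambda>x. \<bar>det (matrix (\<Psi>' x))\<bar> * f (\<Psi> x))) (\<Psi> ` S)"
proof -
  let ?v = "\<lambda>x. vec (f x) :: real^1"
  let ?D = "\<lambda>x. \<bar>det (matrix (\<Psi>' x))\<bar> *\<^sub>R ?v (\<Psi> x)"
  have "bounded_linear (vec :: real \<Rightarrow> real^1)"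
    by (intro linear_conv_bounded_linear[THEN iffD1] linearI) (auto simp: vec_eq_iff)
  then have "(\<lambda>x. vec (\<bar>det (matrix (\<Psi>' x))\<bar> * f (\<Psi> x)) :: real^1) absolutely_integrable_on S"
    using absolutely_integrable_linear[OF int] by (simp add: o_def)
  moreover have Deq: "(\<lambda>x. vec (\<bar>det (matrix (\<Psi>' x))\<bar> * f (\<Psi> x)) :: real^1) = ?D"
    by (auto simp: vec_eq_iff fun_eq_iff)
  ultimately have D: "?D absolutely_integrable_on S" by simp
  have I: "?v absolutely_integrable_on (\<Psi> ` S) \<and> integral (\<Psi> ` S) ?v = integral S ?D"
    using has_absolute_integral_change_of_variables[OF S der inj, of ?v "integral S ?D"] D by blast
  then have iv: "?v integrable_on (\<Psi> ` S)" and iD: "?D integrable_on S"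
    using D by (auto simp: absolutely_integrable_on_def)
  have "(?v has_integral integral S ?D) (\<Psi> ` S)" using iv I by (metis integrable_integral)
  from has_integral_linear[OF this bounded_linear_vec_nth[of 1]]
  have "(f has_integral integral S ?D $ 1) (\<Psi> ` S)" by (simp add: o_def)
  moreover have "integral S ?D $ 1 = integral S (\<lambda>x. \<bar>det (matrix (\<Psi>' x))\<bar> * f (\<Psi> x))"
    using integral_component_eq_cart[OF iD, of 1] by simp
  ultimately show ?thesis by simp
qed

context level_domain
begin

text \<open>The time derivative of G along the orbit, by the chain rule in each component.\<close>

definition W :: "(real \<Rightarrow> real^2) \<Rightarrow> real \<Rightarrow> real^2" where
  "W z t = (\<chi> i. rot (G (z t)) \<bullet> H i (z t))"

lemma W_deriv:
  assumes "orbit z" shows "((\<lambda>t. G (z t)) has_derivative (\<lambda>h. h *\<^sub>R W z t)) (at t)"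
proof -
  have zt: "z t \<in> D" and dz: "(z has_derivative (\<lambda>h. h *\<^sub>R rot (G (z t)))) (at t)"
    using assms Gamma_subset_D by (auto simp: orbit_def has_vector_derivative_def)
  have "((\<lambda>t. G (z t) $ i) has_derivative (\<lambda>h. (h *\<^sub>R W z t) $ i)) (at t)" for i
    using has_derivative_compose[OF dz G_deriv[OF zt, of i, unfolded gderiv_def]] by (simp add: W_def)
  then show ?thesis
    by (subst has_derivative_componentwise_within) (auto simp: Basis_vec_def inner_axis)
qed

lemma W_bound:
  assumes "orbit z" shows "\<bar>W z t \<bullet> rot (G (z t))\<bar> \<le> 2 * M * M * M"
proof -
  have zt: "z t \<in> D" using assms Gamma_subset_D by (auto simp: orbit_def)
  have "\<bar>W z t $ i\<bar> \<le> M * M" for i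
    unfolding W_def using Cauchy_Schwarz_ineq2[of "rot (G (z t))" "H i (z t)"]
      mult_mono[OF G_le[OF zt] H_le[OF zt, of i]] M_pos by simp
  from add_mono[OF this[of 1] this[of 2]] have "norm (W z t) \<le> 2 * M * M"
    using norm_le_l1_cart[of "W z t"] by (simp add: sum_2)
  then have "norm (W z t) * norm (rot (G (z t))) \<le> 2 * M * M * M"
    using G_le[OF zt] M_pos by (intro mult_mono) auto
  then show ?thesis using Cauchy_Schwarz_ineq2[of "W z t" "rot (G (z t))"] by linarith
qed

lemma W_continuous: assumes "orbit z" shows "continuous_on S (W z)"
proof -
  have D: "z ` S \<subseteq> D" using assms Gamma_subset_D by (auto simp: orbit_def)
  note c = orbit_continuous[OF assms, of S]
  show ?thesis
    unfolding W_def
    by (intro continuous_on_vec_lambda continuous_intros continuous_on_compose2[OF G_continuous c D]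
        continuous_on_compose2[OF H_cont c D])
qed

definition tube :: "(real \<Rightarrow> real^2) \<Rightarrow> real \<Rightarrow> real^2 \<Rightarrow> real^2" where
  "tube z \<delta> p = z (p $ 1) - (\<delta> * p $ 2) *\<^sub>R G (z (p $ 1))"

definition tube' :: "(real \<Rightarrow> real^2) \<Rightarrow> real \<Rightarrow> real^2 \<Rightarrow> real^2 \<Rightarrow> real^2" where
  "tube' z \<delta> p h = h $ 1 *\<^sub>R rot (G (z (p $ 1))) -
     ((\<delta> * p $ 2) *\<^sub>R (h $ 1 *\<^sub>R W z (p $ 1)) + (\<delta> * h $ 2) *\<^sub>R G (z (p $ 1)))"

text \<open>The Jacobian determinant of \<open>tube\<close> without its factor \<delta>, which
  cancels against the 1 / \<delta> in \<open>\<kappa>\<close>. As \<delta> tends to 0 it tends to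
  (norm G)^2.\<close>

definition jac :: "(real \<Rightarrow> real^2) \<Rightarrow> real \<Rightarrow> real^2 \<Rightarrow> real" where
  "jac z \<delta> p = (norm (G (z (p $ 1))))\<^sup>2 - \<delta> * p $ 2 * (W z (p $ 1) \<bullet> rot (G (z (p $ 1))))"

lemma tube_deriv:
  assumes z: "orbit z" shows "(tube z \<delta> has_derivative tube' z \<delta> p) (at p within S)"
proof -
  have n: "((\<lambda>p. p $ i) has_derivative (\<lambda>h. h $ i)) (at p within S)" for i and p :: "real^2"
    by (rule bounded_linear.has_derivative[OF bounded_linear_vec_nth has_derivative_ident])
  have 1: "((\<lambda>p. z (p $ 1)) has_derivative (\<lambda>h. h $ 1 *\<^sub>R rot (G (z (p $ 1))))) (at p within S)"
    using z by (intro has_derivative_compose[OF n]) (simp add: orbit_def has_vector_derivative_def)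
  have 2: "((\<lambda>p. G (z (p $ 1))) has_derivative (\<lambda>h. h $ 1 *\<^sub>R W z (p $ 1))) (at p within S)"
    by (rule has_derivative_compose[OF n W_deriv[OF z]])
  have 3: "((\<lambda>p. \<delta> * p $ 2) has_derivative (\<lambda>h. \<delta> * h $ 2)) (at p within S)"
    by (intro has_derivative_mult_right n)
  from has_derivative_diff[OF 1 has_derivative_scaleR[OF 3 2]]
  show ?thesis unfolding tube_def[abs_def] tube'_def[abs_def] .
qed

lemma det_tube': "det (matrix (tube' z \<delta> p)) = \<delta> * jac z \<delta> p"
  by (simp add: det_2 matrix_def tube'_def axis_def jac_def power2_norm_eq_inner inner_2 algebra_simps)

definition strip :: "(real^2) set \<Rightarrow> (real^2) set" where
  "strip K = cbox (vector [0, \<alpha>]) (vector [TK K, \<beta>])"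

text \<open>The end time is removed because the orbit is injective only on the half-open period; the
  removed segment is a null set.\<close>

definition strip0 :: "(real^2) set \<Rightarrow> (real^2) set" where
  "strip0 K = {p \<in> strip K. p $ 1 < TK K}"

lemma mem_strip: "p \<in> strip K \<longleftrightarrow> 0 \<le> p $ 1 \<and> p $ 1 \<le> TK K \<and> \<alpha> \<le> p $ 2 \<and> p $ 2 \<le> \<beta>"
  by (auto simp: strip_def mem_box_cart forall_2)

lemma strip0_lebesgue: "strip0 K \<in> sets lebesgue"
proof -
  have eq: "strip0 K = strip K \<inter> {p. p $ 1 < TK K}" by (auto simp: strip0_def)
   have "strip K \<in> sets lebesgue" by (simp add: strip_def)
  moreover have "{p::real^2. p $ 1 < TK K} \<in> sets lebesgue"
    using open_halfspace_component_lt_cart[of 1 "TK K"] by simp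
  ultimately show ?thesis unfolding eq by (rule sets.Int)
qed

lemma negligible_strip_diff: "negligible (strip K - strip0 K)"
proof (rule negligible_subset)
  have "axis 1 1 \<in> (Basis :: (real^2) set)" by (auto simp: Basis_vec_def)
  from negligible_standard_hyperplane[OF this, of "TK K"]
  show "negligible {p::real^2. p $ 1 = TK K}" by (simp add: inner_axis)
  show "strip K - strip0 K \<subseteq> {p. p $ 1 = TK K}" by (auto simp: strip0_def mem_strip)
qed

text \<open>The cut-off \<open>ramp (- g / \<delta>)\<close> has gradient
  \<open>- \<kappa> \<delta> x *\<^sub>R G x\<close>; as \<delta> tends to 0 this weight
  concentrates on \<Gamma>.\<close>

definition \<kappa> :: "real \<Rightarrow> real^2 \<Rightarrow> real" where "\<kappa> \<delta> x = ramp' (- g x / \<delta>) / \<delta>"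

lemma g_continuous_Omega: "continuous_on \<Omega> g"
  using g_continuous closure_subset closure_Omega_subset by (rule_tac continuous_on_subset) auto

lemma \<kappa>_continuous: "continuous_on \<Omega> (\<kappa> \<delta>)"
  unfolding \<kappa>_def divide_inverse
  by (intro continuous_intros continuous_on_compose2[OF ramp'_continuous[of UNIV]] g_continuous_Omega) auto

text \<open>Two requirements on \<delta>: the products \<delta> \<sigma> stay within
  \<open>e0\<close>, where the strip map is injective with values in \<Omega>, and the layer
  \<delta> \<le> - g \<le> 2 \<delta> is covered.\<close>

definition \<delta>0 :: real where
  "\<delta>0 = (SOME d. 0 < d \<and> d * \<beta> \<le> e0 \<and> (\<forall>\<delta> x. 0 < \<delta> \<and> \<delta> \<le> d \<and> x \<in> \<Omega> \<and> \<delta> \<le> - g x \<and> - g x \<le> 2 * \<delta> \<longrightarrow>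
    (\<exists>q\<in>\<Gamma>. \<exists>\<sigma>. \<alpha> \<le> \<sigma> \<and> \<sigma> \<le> \<beta> \<and> x = q - (\<delta> * \<sigma>) *\<^sub>R G q)))"

lemma \<delta>0: "\<delta>0 > 0" "\<delta>0 * \<beta> \<le> e0"
  and tube_covers_\<delta>0: "0 < \<delta> \<Longrightarrow> \<delta> \<le> \<delta>0 \<Longrightarrow> x \<in> \<Omega> \<Longrightarrow> \<delta> \<le> - g x \<Longrightarrow> - g x \<le> 2 * \<delta> \<Longrightarrow>
    \<exists>q\<in>\<Gamma>. \<exists>\<sigma>. \<alpha> \<le> \<sigma> \<and> \<sigma> \<le> \<beta> \<and> x = q - (\<delta> * \<sigma>) *\<^sub>R G q"
proof -
  let ?P = "\<lambda>d. 0 < d \<and> d * \<beta> \<le> e0 \<and> (\<forall>\<delta> x. 0 < \<delta> \<and> \<delta> \<le> d \<and> x \<in> \<Omega> \<and> \<delta> \<le> - g x \<and> - g x \<le> 2 * \<delta> \<longrightarrow>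
    (\<exists>q\<in>\<Gamma>. \<exists>\<sigma>. \<alpha> \<le> \<sigma> \<and> \<sigma> \<le> \<beta> \<and> x = q - (\<delta> * \<sigma>) *\<^sub>R G q))"
  obtain d1 where d1: "d1 > 0" "\<And>\<delta> x. 0 < \<delta> \<Longrightarrow> \<delta> \<le> d1 \<Longrightarrow> x \<in> \<Omega> \<Longrightarrow> \<delta> \<le> - g x \<Longrightarrow> - g x \<le> 2 * \<delta> \<Longrightarrow>
    \<exists>q\<in>\<Gamma>. \<exists>\<sigma>. \<alpha> \<le> \<sigma> \<and> \<sigma> \<le> \<beta> \<and> x = q - (\<delta> * \<sigma>) *\<^sub>R G q"
    using tube_covers by blast
  have "min d1 (e0 / \<beta>) * \<beta> \<le> e0 / \<beta> * \<beta>" using \<beta>_pos by (intro mult_right_mono) auto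
  then have b: "min d1 (e0 / \<beta>) * \<beta> \<le> e0" using \<beta>_pos by simp
  have "?P (min d1 (e0 / \<beta>))"
  proof (intro conjI allI impI b)
    show "0 < min d1 (e0 / \<beta>)" using d1(1) e0(1) \<beta>_pos by simp
    fix \<delta> x assume *: "0 < \<delta> \<and> \<delta> \<le> min d1 (e0 / \<beta>) \<and> x \<in> \<Omega> \<and> \<delta> \<le> - g x \<and> - g x \<le> 2 * \<delta>"
    show "\<exists>q\<in>\<Gamma>. \<exists>\<sigma>. \<alpha> \<le> \<sigma> \<and> \<sigma> \<le> \<beta> \<and> x = q - (\<delta> * \<sigma>) *\<^sub>R G q"
      by (rule d1(2)) (use * in auto)
  qed
  then have P: "?P \<delta>0" unfolding \<delta>0_def by (rule someI[of ?P])
  show "\<delta>0 > 0" by (rule P[THEN conjunct1])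
  show "\<delta>0 * \<beta> \<le> e0" by (rule P[THEN conjunct2, THEN conjunct1])
  show "0 < \<delta> \<Longrightarrow> \<delta> \<le> \<delta>0 \<Longrightarrow> x \<in> \<Omega> \<Longrightarrow> \<delta> \<le> - g x \<Longrightarrow> - g x \<le> 2 * \<delta> \<Longrightarrow>
    \<exists>q\<in>\<Gamma>. \<exists>\<sigma>. \<alpha> \<le> \<sigma> \<and> \<sigma> \<le> \<beta> \<and> x = q - (\<delta> * \<sigma>) *\<^sub>R G q"
    by (rule P[THEN conjunct2, THEN conjunct2, rule_format]) simp
qed

lemma tube_param:
  assumes "0 < \<delta>" "\<delta> \<le> \<delta>0" "p \<in> strip K" shows "0 < \<delta> * p $ 2" "\<delta> * p $ 2 \<le> e0"
proof -
  show "0 < \<delta> * p $ 2" using assms \<alpha>_pos by (auto simp: mem_strip)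
  have "\<delta> * p $ 2 \<le> \<delta>0 * \<beta>" using assms \<alpha>_pos \<delta>0(1) by (intro mult_mono) (auto simp: mem_strip)
  then show "\<delta> * p $ 2 \<le> e0" using \<delta>0(2) by linarith
qed

lemma zK_Gamma: "K \<in> components \<Gamma> \<Longrightarrow> zK K t \<in> \<Gamma>"
  using the_orbit(1) by (simp add: orbit_def)

lemma tube_Omega:
  assumes "K \<in> components \<Gamma>" "0 < \<delta>" "\<delta> \<le> \<delta>0" "p \<in> strip K"
  shows "tube (zK K) \<delta> p \<in> \<Omega>"
  unfolding tube_def using tube_in_Omega(1)[OF zK_Gamma[OF assms(1)] tube_param[OF assms(2-4)]] .

definition integrand :: "(real^2) set \<Rightarrow> (real^2 \<Rightarrow> real) \<Rightarrow> real \<Rightarrow> real^2 \<Rightarrow> real" where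
  "integrand K h \<delta> p = \<bar>jac (zK K) \<delta> p\<bar> * (ramp' (- g (tube (zK K) \<delta> p) / \<delta>) * h (tube (zK K) \<delta> p))"

lemma integrand_continuous:
  assumes K: "K \<in> components \<Gamma>" and \<delta>: "0 < \<delta>" "\<delta> \<le> \<delta>0" and h: "continuous_on (closure \<Omega>) h"
  shows "continuous_on (strip K) (integrand K h \<delta>)"
proof -
  note z = the_orbit(1)[OF K]
  have c1: "continuous_on (strip K) (\<lambda>p. p $ 1)" by (intro continuous_intros)
  have cz: "continuous_on (strip K) (\<lambda>p. zK K (p $ 1))"
    by (rule continuous_on_compose2[OF orbit_continuous[OF z, of UNIV] c1]) simp
  have cG: "continuous_on (strip K) (\<lambda>p. G (zK K (p $ 1)))"
    by (rule continuous_on_compose2[OF G_continuous cz]) (use zK_Gamma[OF K] Gamma_subset_D in auto)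
  have cW: "continuous_on (strip K) (\<lambda>p. W (zK K) (p $ 1))"
    by (rule continuous_on_compose2[OF W_continuous[OF z, of UNIV] c1]) simp
  have ct: "continuous_on (strip K) (tube (zK K) \<delta>)"
    unfolding tube_def by (intro continuous_intros cz cG)
  have cg: "continuous_on (strip K) (\<lambda>p. g (tube (zK K) \<delta> p))"
    by (rule continuous_on_compose2[OF g_continuous_Omega ct]) (use tube_Omega[OF K \<delta>] in auto)
  have ch: "continuous_on (strip K) (\<lambda>p. h (tube (zK K) \<delta> p))"
    by (rule continuous_on_compose2[OF h ct]) (use tube_Omega[OF K \<delta>] closure_subset in blast)
  have cr: "continuous_on (strip K) (\<lambda>p. ramp' (- g (tube (zK K) \<delta> p) / \<delta>))"
    using \<delta> by (intro continuous_on_compose2[OF ramp'_continuous[of UNIV]] continuous_intros cg) auto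
  have cj: "continuous_on (strip K) (jac (zK K) \<delta>)"
    unfolding jac_def by (intro continuous_intros cG cW)
  show ?thesis unfolding integrand_def by (intro continuous_intros cr ch cj)
qed

lemma tube_inj:
  assumes K: "K \<in> components \<Gamma>" "K' \<in> components \<Gamma>" and \<delta>: "0 < \<delta>" "\<delta> \<le> \<delta>0"
    and p: "p \<in> strip0 K" "p' \<in> strip0 K'" and eq: "tube (zK K) \<delta> p = tube (zK K') \<delta> p'"
  shows "K = K' \<and> p = p'"
proof -
  have s: "p \<in> strip K" "p' \<in> strip K'" using p by (auto simp: strip0_def)
  have *: "zK K (p $ 1) = zK K' (p' $ 1) \<and> \<delta> * p $ 2 = \<delta> * p' $ 2"
    using eq unfolding tube_def
    by (intro tube_injective zK_Gamma K tube_param[OF \<delta> s(1)] tube_param[OF \<delta> s(2)])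
  have t: "p $ 1 \<in> {0..<TK K}" "p' $ 1 \<in> {0..<TK K'}" using p by (auto simp: strip0_def mem_strip)
  have "zK K (p $ 1) \<in> K" "zK K' (p' $ 1) \<in> K'" using the_orbit(5)[OF K(1)] the_orbit(5)[OF K(2)] t by blast+
  then have "K \<inter> K' \<noteq> {}" using * by auto
  then have KK: "K = K'" using components_eq[OF K] by simp
  then have "p $ 1 = p' $ 1" using inj_onD[OF the_orbit(4)[OF K(1)]] * t by blast
  with * KK \<delta> show ?thesis by (simp add: vec_eq_iff forall_2)
qed

text \<open>The function extended by zero is integrated over the images of the half-open strips,
  which are pairwise disjoint and contain every point of \<Omega> where \<kappa> is nonzero; on each
  image the change of variables produces \<open>integrand\<close>.\<close>

lemma tube_formula:
  assumes \<delta>: "0 < \<delta>" "\<delta> \<le> \<delta>0" and h: "continuous_on (closure \<Omega>) h"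
  shows "((\<lambda>x. \<kappa> \<delta> x * h x) has_integral (\<Sum>K\<in>components \<Gamma>. integral (strip K) (integrand K h \<delta>))) \<Omega>"
proof -
  let ?f = "\<lambda>x. if x \<in> \<Omega> then \<kappa> \<delta> x * h x else 0"
  let ?T = "\<lambda>K. tube (zK K) \<delta> ` strip0 K"
  have K: "(?f has_integral integral (strip K) (integrand K h \<delta>)) (?T K)" if K: "K \<in> components \<Gamma>" for K
  proof -
    note z = the_orbit(1)[OF K]
    let ?I = "\<lambda>p. \<bar>det (matrix (tube' (zK K) \<delta> p))\<bar> * ?f (tube (zK K) \<delta> p)"
    have eq: "?I p = integrand K h \<delta> p" if "p \<in> strip K" for p
      using tube_Omega[OF K \<delta> that] \<delta> by (simp add: det_tube' integrand_def \<kappa>_def abs_mult)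
    have "integrand K h \<delta> absolutely_integrable_on strip K"
      using integrand_continuous[OF K \<delta> h] unfolding strip_def by (rule absolutely_integrable_continuous)
    then have "?I absolutely_integrable_on strip K"
      using eq by (rule_tac absolutely_integrable_spike[OF _ negligible_empty]) auto
    then have ai: "?I absolutely_integrable_on strip0 K"
      by (rule set_integrable_subset) (use strip0_lebesgue in \<open>auto simp: strip0_def\<close>)
    have "inj_on (tube (zK K) \<delta>) (strip0 K)" using tube_inj[OF K K \<delta>] by (auto simp: inj_on_def)
    from change_of_variables_real2[OF strip0_lebesgue tube_deriv[OF z] this ai]
    have "(?f has_integral integral (strip0 K) ?I) (?T K)" .
    moreover have "integral (strip0 K) ?I = integral (strip K) ?I"
      by (rule integral_subset_negligible) (use negligible_strip_diff in \<open>auto simp: strip0_def\<close>)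
    moreover have "integral (strip K) ?I = integral (strip K) (integrand K h \<delta>)"
      using eq by (rule integral_cong)
    ultimately show ?thesis by simp
  qed
  have "(?f has_integral (\<Sum>K\<in>components \<Gamma>. integral (strip K) (integrand K h \<delta>))) (\<Union>K\<in>components \<Gamma>. ?T K)"
  proof (rule has_integral_UN[OF finite_components_Gamma K])
    show "pairwise (\<lambda>K K'. negligible (?T K \<inter> ?T K')) (components \<Gamma>)"
    proof (rule pairwiseI)
      fix K K' assume "K \<in> components \<Gamma>" "K' \<in> components \<Gamma>" "K \<noteq> K'"
      then have "?T K \<inter> ?T K' = {}" using tube_inj[OF _ _ \<delta>] by blast
      then show "negligible (?T K \<inter> ?T K')" by simp
    qed
  qed
  moreover have "?f x = 0" if x: "x \<notin> (\<Union>K\<in>components \<Gamma>. ?T K)" for x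
  proof (rule ccontr)
    assume nz: "?f x \<noteq> 0"
    then have xO: "x \<in> \<Omega>" and "ramp' (- g x / \<delta>) \<noteq> 0" by (auto simp: \<kappa>_def split: if_splits)
    then have "1 < - g x / \<delta>" "- g x / \<delta> < 2" using ramp'_eq_0[of "- g x / \<delta>"] by linarith+
    then have "\<delta> \<le> - g x" "- g x \<le> 2 * \<delta>" using \<delta> by (auto simp: field_simps)
    then obtain q \<sigma> where q: "q \<in> \<Gamma>" "\<alpha> \<le> \<sigma>" "\<sigma> \<le> \<beta>" "x = q - (\<delta> * \<sigma>) *\<^sub>R G q"
      using tube_covers_\<delta>0[OF \<delta> xO] by blast
    obtain K where K: "K \<in> components \<Gamma>" "q \<in> K" using q(1) Union_components by blast
    then obtain t where t: "t \<in> {0..<TK K}" "q = zK K t" using the_orbit(5)[OF K(1)] by blast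
    let ?p = "vector [t, \<sigma>] :: real^2"
    have "?p \<in> strip0 K" using t q by (simp add: strip0_def mem_strip)
    moreover have "tube (zK K) \<delta> ?p = x" using q t by (simp add: tube_def)
    ultimately show False using x K(1) by blast
  qed
  ultimately have "(?f has_integral (\<Sum>K\<in>components \<Gamma>. integral (strip K) (integrand K h \<delta>))) UNIV"
    by (rule has_integral_on_superset) auto
  then show ?thesis by (simp only: has_integral_restrict_UNIV)
qed

text \<open>Write a for norm G at the base point. Then - g / \<delta> tends to \<sigma> a^2 and the
  Jacobian factor to a^2, so the limit integrand is a^2 ramp'(\<sigma> a^2) h. Its integral over
  \<sigma> is (ramp (\<beta> a^2) - ramp (\<alpha> a^2)) h = (1 - 0) h, which leaves h in orbit
  time.\<close>

lemma tube_limit: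
  assumes K: "K \<in> components \<Gamma>" and h: "continuous_on (closure \<Omega>) h"
    and d: "\<And>n::nat. 0 < d n" "\<And>n. d n \<le> \<delta>0" "d \<longlonglongrightarrow> 0"
  shows "(\<lambda>n. integral (strip K) (integrand K h (d n))) \<longlonglongrightarrow> integral {0..TK K} (\<lambda>t. h (zK K t))"
proof -
  note z = the_orbit(1)[OF K]
  let ?a = "\<lambda>p::real^2. norm (G (zK K (p $ 1)))"
  let ?F = "\<lambda>p. (?a p)\<^sup>2 * (ramp' (p $ 2 * (?a p)\<^sup>2) * h (zK K (p $ 1)))"
  have inclos: "zK K t \<in> closure \<Omega>" for t using zK_Gamma[OF K, of t] by (simp add: frontier_def)
  obtain B where B: "\<And>x. x \<in> closure \<Omega> \<Longrightarrow> norm (h x) \<le> B" "B \<ge> 0"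
  proof -
    have "bounded (h ` closure \<Omega>)"
      using compact_continuous_image[OF h compact_closure_Omega] by (rule compact_imp_bounded)
    then obtain B where B: "\<And>x. x \<in> closure \<Omega> \<Longrightarrow> norm (h x) \<le> B" by (auto simp: bounded_iff)
    moreover have "B \<ge> 0" using B[OF inclos[of 0]] norm_ge_zero order_trans by blast
    ultimately show thesis using that by blast
  qed
  have lim: "(\<lambda>n. integrand K h (d n) p) \<longlonglongrightarrow> ?F p" if p: "p \<in> strip K" for p
  proof -
    have q: "zK K (p $ 1) \<in> \<Gamma>" by (rule zK_Gamma[OF K])
    have "(\<lambda>n. jac (zK K) (d n) p) \<longlonglongrightarrow> (?a p)\<^sup>2 - 0 * p $ 2 * (W (zK K) (p $ 1) \<bullet> rot (G (zK K (p $ 1))))"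
      unfolding jac_def by (intro tendsto_intros d)
    then have j: "(\<lambda>n. \<bar>jac (zK K) (d n) p\<bar>) \<longlonglongrightarrow> \<bar>(?a p)\<^sup>2\<bar>" by (intro tendsto_rabs) simp
    have "(\<lambda>n. tube (zK K) (d n) p) \<longlonglongrightarrow> zK K (p $ 1) - (0 * p $ 2) *\<^sub>R G (zK K (p $ 1))"
      unfolding tube_def by (intro tendsto_intros d)
    then have t: "(\<lambda>n. tube (zK K) (d n) p) \<longlonglongrightarrow> zK K (p $ 1)" by simp
    have th: "(\<lambda>n. h (tube (zK K) (d n) p)) \<longlonglongrightarrow> h (zK K (p $ 1))"
      by (rule continuous_on_tendsto_compose[OF h t inclos])
        (use tube_Omega[OF K d(1,2) p] closure_subset in \<open>auto intro!: always_eventually\<close>)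
    have "(\<lambda>n. - g (tube (zK K) (d n) p) / d n) \<longlonglongrightarrow> p $ 2 * (?a p)\<^sup>2"
    proof (rule LIM_zero_cancel, rule Lim_null_comparison[OF always_eventually], rule allI)
      fix n
      let ?s = "d n * p $ 2"
      have s: "0 < ?s" "?s \<le> e0" by (rule tube_param[OF d(1,2) p])+
      have "tube (zK K) (d n) p \<in> cball (zK K (p $ 1)) R" unfolding tube_def by (rule tube_in_Omega(2)[OF q s])
      then have "\<bar>g (tube (zK K) (d n) p) - g (zK K (p $ 1)) - (tube (zK K) (d n) p - zK K (p $ 1)) \<bullet> G (zK K (p $ 1))\<bar>
          \<le> 2 * M * (norm (tube (zK K) (d n) p - zK K (p $ 1)))\<^sup>2"
        using R(1) by (intro g_taylor[OF convex_cball R(2)[OF q]]) auto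
      then have *: "\<bar>g (tube (zK K) (d n) p) + ?s * (?a p)\<^sup>2\<bar> \<le> 2 * M * (?s * ?a p)\<^sup>2"
        using g_zero_on_frontier[OF q] d(1)[of n] zero_less_mult_pos[OF s(1) d(1)]
        by (simp add: tube_def power2_norm_eq_inner abs_mult)
      have "- g (tube (zK K) (d n) p) / d n - p $ 2 * (?a p)\<^sup>2 = - (g (tube (zK K) (d n) p) + ?s * (?a p)\<^sup>2) / d n"
        using d(1)[of n] by (simp add: field_simps)
      then have "norm (- g (tube (zK K) (d n) p) / d n - p $ 2 * (?a p)\<^sup>2) = \<bar>g (tube (zK K) (d n) p) + ?s * (?a p)\<^sup>2\<bar> / d n"
        using d(1)[of n] by (simp add: abs_divide)
      also have "\<dots> \<le> 2 * M * (?s * ?a p)\<^sup>2 / d n" using * d(1)[of n] by (intro divide_right_mono) auto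
      also have "\<dots> = d n * (2 * M * (p $ 2 * ?a p)\<^sup>2)" using d(1)[of n] by (simp add: power2_eq_square field_simps)
      finally show "norm (- g (tube (zK K) (d n) p) / d n - p $ 2 * (?a p)\<^sup>2) \<le> d n * (2 * M * (p $ 2 * ?a p)\<^sup>2)" .
    next
      show "(\<lambda>n. d n * (2 * M * (p $ 2 * ?a p)\<^sup>2)) \<longlonglongrightarrow> 0"
        using tendsto_mult_left_zero[OF d(3)] by simp
    qed
    then have tr: "(\<lambda>n. ramp' (- g (tube (zK K) (d n) p) / d n)) \<longlonglongrightarrow> ramp' (p $ 2 * (?a p)\<^sup>2)"
      by (intro continuous_on_tendsto_compose[OF ramp'_continuous[of UNIV]]) auto
    from tendsto_mult[OF j tendsto_mult[OF tr th]] show ?thesis by (simp add: integrand_def)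
  qed
  \<comment> \<open>A dominating constant free of n: \<open>W_bound\<close> and \<delta> \<sigma>
    \<le> e0 bound the Jacobian factor, \<open>ramp'\<close> is at most 2, and B bounds h.\<close>
  define C where "C = (M\<^sup>2 + e0 * (2 * M * M * M)) * (2 * B)"
  have bound: "norm (integrand K h (d n) p) \<le> C" if p: "p \<in> strip K" for n p
  proof -
    have s: "0 < d n * p $ 2" "d n * p $ 2 \<le> e0" by (rule tube_param[OF d(1,2) p])+
    let ?w = "W (zK K) (p $ 1) \<bullet> rot (G (zK K (p $ 1)))"
    have "\<bar>jac (zK K) (d n) p\<bar> \<le> (?a p)\<^sup>2 + d n * p $ 2 * \<bar>?w\<bar>"
      unfolding jac_def using abs_triangle_ineq4[of "(?a p)\<^sup>2" "d n * p $ 2 * ?w"] d(1)[of n]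
        zero_less_mult_pos[OF s(1) d(1)] by (simp add: abs_mult)
    also have "\<dots> \<le> M\<^sup>2 + e0 * (2 * M * M * M)"
      using s e0(1) W_bound[OF z] norm_G_Gamma[OF zK_Gamma[OF K]] by (intro add_mono mult_mono power_mono) auto
    finally have 1: "\<bar>jac (zK K) (d n) p\<bar> \<le> M\<^sup>2 + e0 * (2 * M * M * M)" .
    have "tube (zK K) (d n) p \<in> closure \<Omega>" using tube_Omega[OF K d(1,2) p] closure_subset by blast
    from B(1)[OF this] have 2: "\<bar>ramp' (- g (tube (zK K) (d n) p) / d n) * h (tube (zK K) (d n) p)\<bar> \<le> 2 * B"
      unfolding abs_mult using ramp'_nonneg ramp'_le by (intro mult_mono) auto
    show ?thesis
      unfolding integrand_def C_def real_norm_def abs_mult[of "\<bar>jac _ _ _\<bar>"]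
      using 1 2 M_pos e0(1) by (intro mult_mono) auto
  qed
  have "(\<lambda>n. integral (strip K) (integrand K h (d n))) \<longlonglongrightarrow> integral (strip K) ?F"
  proof (rule dominated_convergence(2)[OF _ _ bound lim])
    show "integrand K h (d n) integrable_on strip K" for n
      using integrand_continuous[OF K d(1,2) h] unfolding strip_def by (rule integrable_continuous)
    show "(\<lambda>p. C) integrable_on strip K" unfolding strip_def by (rule integrable_const)
  qed
  moreover have "integral (strip K) ?F = integral {0..TK K} (\<lambda>t. h (zK K t))"
  proof -
    have cz: "continuous_on (strip K) (\<lambda>p. zK K (p $ 1))"
      by (rule continuous_on_compose2[OF orbit_continuous[OF z, of UNIV]]) (auto intro!: continuous_intros)
    have cG: "continuous_on (strip K) (\<lambda>p. G (zK K (p $ 1)))"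
      by (rule continuous_on_compose2[OF G_continuous cz]) (use zK_Gamma[OF K] Gamma_subset_D in auto)
    have ch: "continuous_on (strip K) (\<lambda>p. h (zK K (p $ 1)))"
      by (rule continuous_on_compose2[OF h cz]) (use inclos in auto)
    have cr: "continuous_on (strip K) (\<lambda>p. ramp' (p $ 2 * (?a p)\<^sup>2))"
      by (rule continuous_on_compose2[OF ramp'_continuous[of UNIV]]) (auto intro!: continuous_intros cG)
    have "continuous_on (strip K) ?F" by (intro continuous_intros cG ch cr)
    then have "integral (strip K) ?F = integral {0..TK K} (\<lambda>t. integral {\<alpha>..\<beta>} (\<lambda>\<sigma>. ?F (vector [t, \<sigma>])))"
      unfolding strip_def by (rule integral_cbox_real2)
    also have "\<dots> = integral {0..TK K} (\<lambda>t. h (zK K t))"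
    proof (rule integral_cong)
      fix t
      let ?b = "(norm (G (zK K t)))\<^sup>2"
      have a: "m \<le> norm (G (zK K t))" "norm (G (zK K t)) \<le> M" using norm_G_Gamma[OF zK_Gamma[OF K]] by auto
      have "m\<^sup>2 \<le> ?b" "?b \<le> M\<^sup>2" using a m by (auto intro!: power_mono)
      then have "?b \<le> 2 * M\<^sup>2" "2 * m\<^sup>2 \<le> 3 * ?b"
        using zero_le_power2[of M] zero_le_power2[of m] by linarith+
      then have lo: "\<alpha> * ?b \<le> 1" and hi: "2 \<le> \<beta> * ?b" using m M_pos by (simp_all add: \<alpha>_def \<beta>_def field_simps)
      have "((\<lambda>\<sigma>. ?b * ramp' (\<sigma> * ?b)) has_integral ramp (\<beta> * ?b) - ramp (\<alpha> * ?b)) {\<alpha>..\<beta>}"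
      proof (rule fundamental_theorem_of_calculus[OF \<alpha>_le_\<beta>])
        fix \<sigma>
        have "((\<lambda>\<sigma>. ramp (\<sigma> * ?b)) has_real_derivative ramp' (\<sigma> * ?b) * ?b) (at \<sigma> within {\<alpha>..\<beta>})"
          by (rule DERIV_chain2[OF ramp_DERIV]) (auto intro!: derivative_eq_intros)
        then show "((\<lambda>\<sigma>. ramp (\<sigma> * ?b)) has_vector_derivative ?b * ramp' (\<sigma> * ?b)) (at \<sigma> within {\<alpha>..\<beta>})"
          by (simp add: has_real_derivative_iff_has_vector_derivative mult.commute)
      qed
      then have "((\<lambda>\<sigma>. ?b * ramp' (\<sigma> * ?b) * h (zK K t)) has_integral 1 * h (zK K t)) {\<alpha>..\<beta>}"
        using lo hi by (intro has_integral_mult_left) (simp add: ramp_eq_0 ramp_eq_1)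
      from integral_unique[OF this] show "integral {\<alpha>..\<beta>} (\<lambda>\<sigma>. ?F (vector [t, \<sigma>])) = h (zK K t)"
        by (simp only: vector_2 mult.assoc mult_1_left)
    qed
    finally show ?thesis .
  qed
  ultimately show ?thesis by simp
qed

text \<open>Integration in orbit time amounts to the weight \<open>1 / norm G\<close> against arc length.\<close>

definition bdry :: "(real^2 \<Rightarrow> real) \<Rightarrow> real" where
  "bdry h = (\<Sum>K\<in>components \<Gamma>. integral {0..TK K} (\<lambda>t. h (zK K t)))"

lemma boundary_limit:
  assumes h: "continuous_on (closure \<Omega>) h" and d: "\<And>n::nat. 0 < d n" "\<And>n. d n \<le> \<delta>0" "d \<longlonglongrightarrow> 0"
  shows "(\<lambda>n. integral \<Omega> (\<lambda>x. \<kappa> (d n) x * h x)) \<longlonglongrightarrow> bdry h"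
  unfolding bdry_def integral_unique[OF tube_formula[OF d(1,2) h]]
  by (intro tendsto_sum tube_limit[OF _ h d])

end

section \<open>Energy estimate\<close>

lemma integral_lebesgue_on_support:
  fixes F :: "'a::euclidean_space \<Rightarrow> real"
  assumes "S \<in> sets lebesgue" "T \<in> sets lebesgue" "T \<subseteq> S" "\<And>x. x \<in> S - T \<Longrightarrow> F x = 0"
  shows "integral\<^sup>L (lebesgue_on S) F = integral\<^sup>L (lebesgue_on T) F"
proof -
  have "(\<lambda>x. indicator S x *\<^sub>R F x) = (\<lambda>x. indicator T x *\<^sub>R F x)"
    using assms(3,4) by (auto simp: indicator_def fun_eq_iff)
  then show ?thesis using assms by (simp add: integral_restrict_space)
qed

lemma locally_integrable_on_subset:
  assumes f: "locally_integrable_on S f" and "open S" "open T" "T \<subseteq> S"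
  shows "locally_integrable_on T f"
  unfolding locally_integrable_on_def
proof (intro allI impI)
  fix K assume K: "compact K \<and> K \<subseteq> T"
  then have "integrable (lebesgue_on S) (\<lambda>x. indicator K x * f x)"
    using f assms(4) unfolding locally_integrable_on_def by blast
  moreover have "(\<lambda>x. indicator S x *\<^sub>R (indicator K x * f x)) = (\<lambda>x. indicator T x *\<^sub>R (indicator K x * f x))"
    using K assms(4) by (auto simp: indicator_def fun_eq_iff)
  ultimately show "integrable (lebesgue_on T) (\<lambda>x. indicator K x * f x)"
    using assms by (simp add: integrable_restrict_space)
qed

text \<open>The smaller set T is there because the state equation holds on D while the comparison
  takes place on \<Omega>. The diagonal of the weak Hessian is integrated by parts, and the weak
  gradient is replaced by the continuous G.\<close>

lemma strong_solution_test:
  fixes y :: "real^'n \<Rightarrow> real"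
  assumes S: "open S" and T: "open T" "T \<subseteq> S" and p: "p \<ge> 1" and y: "strong_solution p S r y"
    and r: "r \<in> borel_measurable (lebesgue_on S)"
    and G: "\<And>x. x \<in> S \<Longrightarrow> GDERIV y x :> G x" "continuous_on S G" and \<psi>: "C1c T \<psi> \<psi>'"
  shows "integral\<^sup>L (lebesgue_on T) (\<lambda>x. G x \<bullet> \<psi>' x) = integral\<^sup>L (lebesgue_on T) (\<lambda>x. (r x - y x) * \<psi> x)"
proof -
  obtain V H where VH: "W2p_derivs p S y V H" and eq: "AE x in lebesgue_on S. - (\<Sum>i\<in>UNIV. H x $ i $ i) + y x = r x"
    using y unfolding strong_solution_def by blast
  have V: "weak_grad p S y V" and H: "\<And>i. weak_grad p S (\<lambda>x. V x $ i) (\<lambda>x. H x $ i)"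
    using VH unfolding W2p_derivs_def by blast+
  have VG: "AE x in lebesgue_on S. V x = G x" by (rule weak_grad_AE_classical[OF S G V p])
  have \<psi>S: "C1c S \<psi> \<psi>'" by (rule C1c_mono[OF \<psi> T(2)])
  obtain K where K: "compact K" "K \<subseteq> T" "\<And>x. x \<notin> K \<Longrightarrow> \<psi> x = 0" "\<And>x. x \<notin> K \<Longrightarrow> \<psi>' x = 0"
    using \<psi> unfolding C1c_def by blast
  have KS: "K \<subseteq> S" using K(2) T(2) by (rule subset_trans)
  have zT: "\<psi> x = 0" "\<psi>' x = 0" if "x \<in> S - T" for x
    using that K(2) K(3)[of x] K(4)[of x] by blast+
  have c: "continuous_on UNIV \<psi>" "continuous_on UNIV \<psi>'" using C1c_continuous[OF \<psi>] \<psi> by (auto simp: C1c_def)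
  have cy: "continuous_on S y" using G(1) by (rule GDERIV_continuous_on)
  have sm: "S \<in> sets lebesgue" "T \<in> sets lebesgue" using S T by auto
  have [measurable]: "\<psi> \<in> borel_measurable (lebesgue_on S)" "y \<in> borel_measurable (lebesgue_on S)"
    "(\<lambda>x. G x \<bullet> \<psi>' x) \<in> borel_measurable (lebesgue_on S)" "r \<in> borel_measurable (lebesgue_on S)"
    using sm r cy G(2)
    by (auto intro!: continuous_imp_measurable_on_sets_lebesgue continuous_intros intro: continuous_on_subset[OF c(1)] continuous_on_subset[OF c(2)])
  have iV: "integrable (lebesgue_on S) (\<lambda>x. V x $ i * \<psi>' x $ i)" for i
    by (rule integrable_mult_compact_support[OF S in_Lp_locally_integrable[OF S weak_gradD(2)[OF V] p] K(1) KS])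
      (use c K in \<open>auto intro!: continuous_intros\<close>)
  have iH: "integrable (lebesgue_on S) (\<lambda>x. H x $ i $ i * \<psi> x)" for i
    by (rule integrable_mult_compact_support[OF S in_Lp_locally_integrable[OF S weak_gradD(2)[OF H] p] K(1) KS c(1) K(3)])
  have "integral\<^sup>L (lebesgue_on S) (\<lambda>x. G x \<bullet> \<psi>' x) = integral\<^sup>L (lebesgue_on S) (\<lambda>x. \<Sum>i\<in>UNIV. V x $ i * \<psi>' x $ i)"
  proof (rule integral_cong_AE)
    show "(\<lambda>x. \<Sum>i\<in>UNIV. V x $ i * \<psi>' x $ i) \<in> borel_measurable (lebesgue_on S)"
      by (rule borel_measurable_sum) (rule borel_measurable_integrable[OF iV])
    show "AE x in lebesgue_on S. G x \<bullet> \<psi>' x = (\<Sum>i\<in>UNIV. V x $ i * \<psi>' x $ i)"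
      using VG by eventually_elim (simp add: inner_vec_def)
  qed measurable
  also have "\<dots> = (\<Sum>i\<in>UNIV. integral\<^sup>L (lebesgue_on S) (\<lambda>x. V x $ i * \<psi>' x $ i))"
    using iV by simp
  also have "\<dots> = (\<Sum>i\<in>UNIV. - integral\<^sup>L (lebesgue_on S) (\<lambda>x. H x $ i $ i * \<psi> x))"
    using weak_grad_C1c[OF S H p \<psi>S] by simp
  also have "\<dots> = integral\<^sup>L (lebesgue_on S) (\<lambda>x. - (\<Sum>i\<in>UNIV. H x $ i $ i * \<psi> x))"
    using iH by (simp add: sum_negf)
  also have "\<dots> = integral\<^sup>L (lebesgue_on S) (\<lambda>x. (r x - y x) * \<psi> x)"
  proof (rule integral_cong_AE)
    show "(\<lambda>x. - (\<Sum>i\<in>UNIV. H x $ i $ i * \<psi> x)) \<in> borel_measurable (lebesgue_on S)"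
      by (intro borel_measurable_uminus borel_measurable_sum) (rule borel_measurable_integrable[OF iH])
    show "AE x in lebesgue_on S. - (\<Sum>i\<in>UNIV. H x $ i $ i * \<psi> x) = (r x - y x) * \<psi> x"
      using eq
    proof eventually_elim
      case (elim x)
      then have "r x - y x = - (\<Sum>i\<in>UNIV. H x $ i $ i)" by simp
      then show ?case by (simp add: sum_distrib_right)
    qed
  qed measurable
  finally have "integral\<^sup>L (lebesgue_on S) (\<lambda>x. G x \<bullet> \<psi>' x) = integral\<^sup>L (lebesgue_on S) (\<lambda>x. (r x - y x) * \<psi> x)" .
  moreover have "integral\<^sup>L (lebesgue_on S) (\<lambda>x. G x \<bullet> \<psi>' x) = integral\<^sup>L (lebesgue_on T) (\<lambda>x. G x \<bullet> \<psi>' x)"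
    by (rule integral_lebesgue_on_support[OF sm T(2)]) (simp add: zT)
  moreover have "integral\<^sup>L (lebesgue_on S) (\<lambda>x. (r x - y x) * \<psi> x) = integral\<^sup>L (lebesgue_on T) (\<lambda>x. (r x - y x) * \<psi> x)"
    by (rule integral_lebesgue_on_support[OF sm T(2)]) (simp add: zT)
  ultimately show ?thesis by simp
qed

section \<open>Extended-valued integrals\<close>

lemma ext_integral_nonneg:
  assumes "integrable N h" "\<And>x. x \<in> space N \<Longrightarrow> 0 \<le> h x"
  shows "ext_integral N h = ereal (integral\<^sup>L N h)"
proof -
  have "(\<integral>\<^sup>+x. ennreal (h x) \<partial>N) = ennreal (integral\<^sup>L N h)"
    using assms by (intro nn_integral_eq_integral) (auto intro: AE_I2)
  moreover have "(\<integral>\<^sup>+x. ennreal (- h x) \<partial>N) = (\<integral>\<^sup>+x. 0 \<partial>N)"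
    using assms(2) by (intro nn_integral_cong) (simp add: ennreal_neg)
  moreover have "0 \<le> integral\<^sup>L N h" using assms(2) by (rule Bochner_Integration.integral_nonneg)
  ultimately show ?thesis by (simp add: ext_integral_def enn2ereal_ennreal zero_ennreal.rep_eq)
qed

text \<open>Only the integral of the negative part has to be bounded, and monotonicity of the
  nonnegative integral holds for arbitrary functions. This matters because a Caratheodory integrand
  restricted to a boundary curve, which is a null set of the plane, may fail to be
  measurable.\<close>

lemma ext_integral_lower_bound:
  assumes "integrable N w" "\<And>x. x \<in> space N \<Longrightarrow> 0 \<le> w x" "\<And>x. x \<in> space N \<Longrightarrow> - w x \<le> h x"
  shows "ereal (- integral\<^sup>L N w) \<le> ext_integral N h"
proof -
  have "(\<integral>\<^sup>+x. ennreal (- h x) \<partial>N) \<le> (\<integral>\<^sup>+x. ennreal (w x) \<partial>N)"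
    using assms(3) by (intro nn_integral_mono ennreal_leI) force
  also have "\<dots> = ennreal (integral\<^sup>L N w)"
    using assms by (intro nn_integral_eq_integral) (auto intro: AE_I2)
  finally have "enn2ereal (\<integral>\<^sup>+x. ennreal (- h x) \<partial>N) \<le> enn2ereal (ennreal (integral\<^sup>L N w))"
    by (simp add: less_eq_ennreal.rep_eq)
  moreover have "0 \<le> integral\<^sup>L N w" using assms(2) by (rule Bochner_Integration.integral_nonneg)
  ultimately have *: "enn2ereal (\<integral>\<^sup>+x. ennreal (- h x) \<partial>N) \<le> ereal (integral\<^sup>L N w)"
    by (simp add: enn2ereal_ennreal)
  have "0 - ereal (integral\<^sup>L N w) \<le> ext_integral N h"
    unfolding ext_integral_def by (intro ereal_minus_mono * enn2ereal_nonneg)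
  then show ?thesis by simp
qed

lemma ereal_sequence_bounded_above:
  fixes s :: "nat \<Rightarrow> ereal"
  assumes "\<And>k. s k < \<infinity>" "s \<longlonglongrightarrow> l" "l < \<infinity>"
  obtains A :: real where "\<And>k. s k \<le> ereal A"
proof -
  have "\<exists>b. s k \<le> ereal b" for k using assms(1)[of k] by (cases "s k") auto
  then obtain b where b: "\<And>k. s k \<le> ereal (b k)" by metis
  obtain B where B: "l < ereal B" using assms(3) less_PInf_Ex_of_nat by (metis ereal_dense2)
  obtain N where N: "\<And>k. k \<ge> N \<Longrightarrow> s k < ereal B"
    using order_tendstoD(2)[OF assms(2) B] by (auto simp: eventually_sequentially)
  have "s k \<le> ereal (max B (\<Sum>i<N. \<bar>b i\<bar>))" for k
  proof (cases "k < N")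
    case True
    then have "\<bar>b k\<bar> \<le> (\<Sum>i<N. \<bar>b i\<bar>)" by (intro member_le_sum) auto
    then have "b k \<le> max B (\<Sum>i<N. \<bar>b i\<bar>)" by linarith
    then have "ereal (b k) \<le> ereal (max B (\<Sum>i<N. \<bar>b i\<bar>))" by (simp only: ereal_less_eq)
    with b[of k] show ?thesis by (rule order_trans)
  next
    case False
    then have "s k \<le> ereal B" using N[of k] by simp
    then show ?thesis by (rule order_trans) simp
  qed
  then show thesis by (rule that)
qed

context level_domain
begin

lemma Omega_subset_D: "\<Omega> \<subseteq> D"
  using Omega_subset by blast

lemma Omega_lebesgue: "\<Omega> \<in> sets lebesgue"
  using open_Omega by simp

lemma integrable_Omega:
  fixes F :: "real^2 \<Rightarrow> real"
  assumes "continuous_on \<Omega> F" "\<And>x. x \<in> \<Omega> \<Longrightarrow> \<bar>F x\<bar> \<le> B"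
  shows "integrable (lebesgue_on \<Omega>) F"
proof -
  have "\<Omega> \<in> lmeasurable" using bounded_Omega open_Omega by (simp add: lmeasurable_open)
  then have "finite_measure (lebesgue_on \<Omega>)" by (rule finite_measure_lebesgue_on)
  then show ?thesis
    using assms Omega_lebesgue
    by (intro finite_measure.integrable_const_bound[of _ _ B] AE_I2 continuous_imp_measurable_on_sets_lebesgue) auto
qed

lemma closure_bound:
  fixes F :: "real^2 \<Rightarrow> real"
  assumes "continuous_on (closure \<Omega>) F"
  obtains B where "B \<ge> 0" "\<And>x. x \<in> closure \<Omega> \<Longrightarrow> \<bar>F x\<bar> \<le> B"
proof -
  have "bounded (F ` closure \<Omega>)"
    using compact_continuous_image[OF assms compact_closure_Omega] by (rule compact_imp_bounded)
  then obtain B where "\<And>x. x \<in> closure \<Omega> \<Longrightarrow> \<bar>F x\<bar> \<le> B" by (auto simp: bounded_iff)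
  then show thesis using that[of "max B 0"] by force
qed

lemma continuous_on_Omega: "continuous_on (closure \<Omega>) F \<Longrightarrow> continuous_on \<Omega> F"
  and continuous_on_Gamma: "continuous_on (closure \<Omega>) F \<Longrightarrow> continuous_on \<Gamma> F"
  using closure_subset by (auto intro: continuous_on_subset simp: frontier_def)

section \<open>Cut-offs built from g and Gauss's theorem on \<Omega>\<close>

definition \<eta> :: "real \<Rightarrow> real^2 \<Rightarrow> real" where "\<eta> \<delta> x = ramp (- g x / \<delta>)"

lemma \<eta>_continuous: "continuous_on \<Omega> (\<eta> \<delta>)"
proof -
  have "continuous_on UNIV ramp" 
    by (intro continuous_at_imp_continuous_on ballI DERIV_isCont[OF ramp_DERIV])
  then show ?thesis
    unfolding \<eta>_def divide_inverse
    by (rule continuous_on_compose2) (auto intro!: continuous_intros g_continuous_Omega)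
qed

lemma \<eta>_bounds: "0 \<le> \<eta> \<delta> x" "\<eta> \<delta> x \<le> 1"
  by (simp_all add: \<eta>_def ramp_bounds)

lemma \<kappa>_bounds: "\<delta> > 0 \<Longrightarrow> \<bar>\<kappa> \<delta> x\<bar> \<le> 2 / \<delta>"
  using ramp'_le[of "- g x / \<delta>"] ramp'_nonneg[of "- g x / \<delta>"] by (simp add: \<kappa>_def divide_right_mono)

lemma integrable_mult_closure:
  assumes k: "continuous_on \<Omega> k" "\<And>x. \<bar>k x\<bar> \<le> B" and q: "continuous_on (closure \<Omega>) q"
  shows "integrable (lebesgue_on \<Omega>) (\<lambda>x. k x * q x :: real)"
proof -
  obtain C where C: "C \<ge> 0" "\<And>x. x \<in> closure \<Omega> \<Longrightarrow> \<bar>q x\<bar> \<le> C" by (rule closure_bound[OF q], rule that)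
  have "B \<ge> 0" using k(2)[of 0] by linarith
  then show ?thesis
    using C closure_subset[of \<Omega>] k(2)
    by (intro integrable_Omega[where B = "B * C"] continuous_on_mult k continuous_on_Omega q)
      (auto simp: abs_mult intro!: mult_mono)
qed

lemma integrable_closure: "continuous_on (closure \<Omega>) q \<Longrightarrow> integrable (lebesgue_on \<Omega>) (q :: _ \<Rightarrow> real)"
  using integrable_mult_closure[of "\<lambda>x. 1" 1 q] by simp

lemma integrable_\<kappa>: "\<delta> > 0 \<Longrightarrow> continuous_on (closure \<Omega>) q \<Longrightarrow> integrable (lebesgue_on \<Omega>) (\<lambda>x. \<kappa> \<delta> x * q x)"
  by (rule integrable_mult_closure[OF \<kappa>_continuous \<kappa>_bounds])

lemma integrable_\<eta>: "continuous_on (closure \<Omega>) q \<Longrightarrow> integrable (lebesgue_on \<Omega>) (\<lambda>x. \<eta> \<delta> x * q x)"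
  using \<eta>_bounds by (intro integrable_mult_closure[OF \<eta>_continuous, of _ 1]) auto

lemma \<eta>_deriv:
  assumes "x \<in> \<Omega>" "\<delta> > 0" shows "GDERIV (\<eta> \<delta>) x :> - \<kappa> \<delta> x *\<^sub>R G x"
proof -
  have "x \<in> D" using assms Omega_subset by blast
  have "((\<lambda>s. ramp (- s / \<delta>)) has_real_derivative ramp' (- g x / \<delta>) * (- 1 / \<delta>)) (at (g x))"
    using assms(2) by (intro DERIV_chain2[OF ramp_DERIV]) (auto intro!: derivative_eq_intros)
  from GDERIV_DERIV_compose[OF g_deriv[OF \<open>x \<in> D\<close>] this]
  show ?thesis by (simp add: \<eta>_def[abs_def] \<kappa>_def)
qed

text \<open>Since g vanishes on \<Gamma>, the set where g \<le> - \<delta> in the closure of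
  \<Omega> is a compact subset of \<Omega>, and the cut-off vanishes off it.\<close>

lemma cutoff_C1c:
  assumes \<delta>: "\<delta> > 0" and Y: "\<And>x. x \<in> \<Omega> \<Longrightarrow> GDERIV Y x :> Y' x" "continuous_on \<Omega> Y'"
  shows "C1c \<Omega> (\<lambda>x. if x \<in> \<Omega> then \<eta> \<delta> x * Y x else 0)
    (\<lambda>x. if x \<in> \<Omega> then \<eta> \<delta> x *\<^sub>R Y' x + Y x *\<^sub>R (- \<kappa> \<delta> x *\<^sub>R G x) else 0)"
proof (rule C1c_extend[OF open_Omega])
  let ?K = "{x \<in> closure \<Omega>. g x \<le> - \<delta>}"
  have "closed ?K"
    using continuous_closed_preimage[of "closure \<Omega>" g "{..- \<delta>}"] continuous_on_subset[OF g_continuous closure_Omega_subset]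
    by (simp add: vimage_def Int_def)
  moreover have "bounded ?K" using compact_imp_bounded[OF compact_closure_Omega] by (rule bounded_subset) auto
  ultimately show "compact ?K" by (simp add: compact_eq_bounded_closed)
  show "?K \<subseteq> \<Omega>"
  proof
    fix x assume x: "x \<in> ?K"
    then have "x \<notin> \<Gamma>" using g_zero_on_frontier[of x] \<delta> by auto
    then show "x \<in> \<Omega>" using x open_Omega by (auto simp: frontier_def interior_open)
  qed
  show "\<eta> \<delta> x * Y x = 0" if "x \<in> \<Omega> - ?K" for x
  proof -
    have "- g x < \<delta>" using that closure_subset[of \<Omega>] by auto
    then have "- g x / \<delta> \<le> 1" by (subst pos_divide_le_eq[OF \<delta>]) simp
    then show ?thesis by (simp add: \<eta>_def ramp_eq_0)
  qed
  show "GDERIV (\<lambda>x. \<eta> \<delta> x * Y x) x :> \<eta> \<delta> x *\<^sub>R Y' x + Y x *\<^sub>R (- \<kappa> \<delta> x *\<^sub>R G x)" if "x \<in> \<Omega>" for x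
    by (rule GDERIV_mult[OF \<eta>_deriv[OF that \<delta>] Y(1)[OF that]])
  have "continuous_on \<Omega> Y" using Y(1) by (rule GDERIV_continuous_on)
  moreover have "continuous_on \<Omega> G" by (rule continuous_on_subset[OF G_continuous Omega_subset_D])
  ultimately show "continuous_on \<Omega> (\<lambda>x. \<eta> \<delta> x *\<^sub>R Y' x + Y x *\<^sub>R (- \<kappa> \<delta> x *\<^sub>R G x))"
    by (intro continuous_intros Y(2) \<eta>_continuous \<kappa>_continuous)
qed

lemma G_closure_continuous: "continuous_on (closure \<Omega>) G"
  using G_continuous closure_Omega_subset by (rule continuous_on_subset)

text \<open>The gradient of \<eta> Y has integral zero; it splits into Y' weighted by \<eta> and - Y
  G weighted by \<kappa>. As \<delta> tends to 0 this becomes Gauss's theorem, one component at a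
  time.\<close>

lemma cutoff_partial_integral:
  assumes \<delta>: "\<delta> > 0" and Y: "\<And>x. x \<in> \<Omega> \<Longrightarrow> GDERIV Y x :> Y' x" "continuous_on (closure \<Omega>) Y" "continuous_on (closure \<Omega>) Y'"
  shows "integral\<^sup>L (lebesgue_on \<Omega>) (\<lambda>x. \<kappa> \<delta> x * (Y x * G x $ i)) = integral\<^sup>L (lebesgue_on \<Omega>) (\<lambda>x. \<eta> \<delta> x * Y' x $ i)"
proof -
  let ?H = "\<lambda>x. if x \<in> \<Omega> then \<eta> \<delta> x *\<^sub>R Y' x + Y x *\<^sub>R (- \<kappa> \<delta> x *\<^sub>R G x) else 0"
  note F = cutoff_C1c[OF \<delta> Y(1) continuous_on_Omega[OF Y(3)]]
  have i1: "integrable (lebesgue_on \<Omega>) (\<lambda>x. \<kappa> \<delta> x * (Y x * G x $ i))"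
    by (intro integrable_\<kappa> \<delta> continuous_intros Y G_closure_continuous)
  have i2: "integrable (lebesgue_on \<Omega>) (\<lambda>x. \<eta> \<delta> x * Y' x $ i)"
    by (intro integrable_\<eta> continuous_intros Y)
  have "(\<lambda>x. ?H x $ i) \<in> borel_measurable borel"
    using F by (intro borel_measurable_continuous_onI continuous_intros) (auto simp: C1c_def)
  then have "integral\<^sup>L lebesgue (\<lambda>x. ?H x $ i) = integral\<^sup>L lborel (\<lambda>x. ?H x $ i)"
    by (intro integral_completion) simp
  also have "\<dots> = 0" by (rule integral_C1c_gradient[OF C1c_mono[OF F subset_UNIV]])
  also have "(\<lambda>x. ?H x $ i) = (\<lambda>x. indicator \<Omega> x *\<^sub>R (\<eta> \<delta> x * Y' x $ i - \<kappa> \<delta> x * (Y x * G x $ i)))"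
    by (auto simp: fun_eq_iff)
  finally have "integral\<^sup>L (lebesgue_on \<Omega>) (\<lambda>x. \<eta> \<delta> x * Y' x $ i - \<kappa> \<delta> x * (Y x * G x $ i)) = 0"
    using Omega_lebesgue by (simp add: integral_restrict_space)
  then show ?thesis using i1 i2 by simp
qed

definition dn :: "nat \<Rightarrow> real" where "dn n = \<delta>0 / real (Suc n)"

lemma dn: "0 < dn n" "dn n \<le> \<delta>0" "dn \<longlonglongrightarrow> 0"
proof -
  show "0 < dn n" using \<delta>0(1) by (simp add: dn_def)
  have "\<delta>0 * 1 \<le> \<delta>0 * real (Suc n)" using \<delta>0(1) by (intro mult_left_mono) auto
  then show "dn n \<le> \<delta>0" by (simp add: dn_def divide_le_eq)
  have "(\<lambda>n. \<delta>0 * (1 / real (Suc n))) \<longlonglongrightarrow> 0" by (rule tendsto_mult_right_zero[OF LIMSEQ_Suc[OF lim_1_over_n]])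
  then show "dn \<longlonglongrightarrow> 0" by (simp add: dn_def[abs_def])
qed

lemma boundary_limit_lebesgue:
  assumes h: "continuous_on (closure \<Omega>) h"
  shows "(\<lambda>n. integral\<^sup>L (lebesgue_on \<Omega>) (\<lambda>x. \<kappa> (dn n) x * h x)) \<longlonglongrightarrow> bdry h"
proof -
  have "integrable (lebesgue_on \<Omega>) (\<lambda>x. \<kappa> (dn n) x * h x)" for n
    by (rule integrable_\<kappa>[OF dn(1) h])
  then have "integral\<^sup>L (lebesgue_on \<Omega>) (\<lambda>x. \<kappa> (dn n) x * h x) = integral \<Omega> (\<lambda>x. \<kappa> (dn n) x * h x)" for n
    using Omega_lebesgue by (rule lebesgue_integral_eq_integral)
  then show ?thesis using boundary_limit[OF h dn] by simp
qed

lemma \<eta>_limit: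
  assumes F: "continuous_on (closure \<Omega>) F"
  shows "(\<lambda>n. integral\<^sup>L (lebesgue_on \<Omega>) (\<lambda>x. \<eta> (dn n) x * F x)) \<longlonglongrightarrow> integral\<^sup>L (lebesgue_on \<Omega>) F"
proof (rule integral_dominated_convergence)
  show "integrable (lebesgue_on \<Omega>) (\<lambda>x. \<bar>F x\<bar>)" using integrable_closure[OF F] by simp
  show "F \<in> borel_measurable (lebesgue_on \<Omega>)" using integrable_closure[OF F] by simp
  show "(\<lambda>x. \<eta> (dn n) x * F x) \<in> borel_measurable (lebesgue_on \<Omega>)" for n
    by (rule borel_measurable_integrable[OF integrable_\<eta>[OF F]])
  show "AE x in lebesgue_on \<Omega>. norm (\<eta> (dn n) x * F x) \<le> \<bar>F x\<bar>" for n
    using \<eta>_bounds[of "dn n"] by (intro AE_I2) (simp add: abs_mult mult_left_le_one_le)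
  show "AE x in lebesgue_on \<Omega>. (\<lambda>n. \<eta> (dn n) x * F x) \<longlonglongrightarrow> F x"
  proof (rule AE_I2)
    fix x assume "x \<in> space (lebesgue_on \<Omega>)"
    then have neg: "g x < 0" using g_neg_on_Omega by simp
    have "\<forall>\<^sub>F n in sequentially. dn n < - g x / 2" using order_tendstoD(2)[OF dn(3), of "- g x / 2"] neg by simp
    then have "\<forall>\<^sub>F n in sequentially. F x = \<eta> (dn n) x * F x"
    proof eventually_elim
      case (elim n)
      then have "2 \<le> - g x / dn n" by (subst pos_le_divide_eq[OF dn(1)]) simp
      then show ?case by (simp add: \<eta>_def ramp_eq_1)
    qed
    then show "(\<lambda>n. \<eta> (dn n) x * F x) \<longlonglongrightarrow> F x" by (rule Lim_transform_eventually[OF tendsto_const])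
  qed
qed

lemma orbit_comp_continuous:
  assumes "continuous_on \<Gamma> h" "K \<in> components \<Gamma>"
  shows "continuous_on S (\<lambda>t. h (zK K t))"
  by (rule continuous_on_compose2[OF assms(1) orbit_continuous[OF the_orbit(1)[OF assms(2)]]])
    (use zK_Gamma[OF assms(2)] in auto)

lemma bdry_mono:
  assumes "continuous_on \<Gamma> h" "continuous_on \<Gamma> k" "\<And>x. x \<in> \<Gamma> \<Longrightarrow> h x \<le> k x"
  shows "bdry h \<le> bdry k"
  unfolding bdry_def
  by (intro sum_mono integral_le integrable_continuous_real orbit_comp_continuous assms zK_Gamma)

lemma bdry_cong: "(\<And>x. x \<in> \<Gamma> \<Longrightarrow> h x = k x) \<Longrightarrow> bdry h = bdry k"
  unfolding bdry_def by (intro sum.cong refl integral_cong) (simp add: zK_Gamma)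

lemma bdry_add:
  assumes "continuous_on \<Gamma> h" "continuous_on \<Gamma> k"
  shows "bdry (\<lambda>x. h x + k x) = bdry h + bdry k"
  unfolding bdry_def sum.distrib[symmetric]
  by (intro sum.cong refl integral_add integrable_continuous_real orbit_comp_continuous assms)

lemma bdry_cmult: "bdry (\<lambda>x. c * h x) = c * bdry h"
  by (simp add: bdry_def sum_distrib_left)

text \<open>The divergence theorem for the field \<open>Y G\<close>, whose flux density through \<open>\<Gamma>\<close> is \<open>Y * norm G\<close>;
  in terms of the time parameter of the orbits it becomes \<open>Y * (norm G)\<^sup>2\<close>.\<close>

lemma flux_bound:
  assumes Y: "\<And>x. x \<in> \<Omega> \<Longrightarrow> GDERIV Y x :> Y' x" "continuous_on (closure \<Omega>) Y" "continuous_on (closure \<Omega>) Y'"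
    and F: "continuous_on (closure \<Omega>) F" "\<And>x. x \<in> \<Omega> \<Longrightarrow> M * norm (Y' x) + 2 * M * \<bar>Y x\<bar> \<le> F x"
  shows "bdry (\<lambda>x. Y x * (norm (G x))\<^sup>2) \<le> integral\<^sup>L (lebesgue_on \<Omega>) F"
proof -
  have H_cont': "continuous_on (closure \<Omega>) (H i)" for i
    using H_cont closure_Omega_subset by (rule continuous_on_subset)
  have cGi: "continuous_on (closure \<Omega>) (\<lambda>x. G x $ i)" for i
    by (intro continuous_intros G_closure_continuous)
  have dYG: "GDERIV (\<lambda>x. Y x * G x $ i) x :> Y x *\<^sub>R H i x + G x $ i *\<^sub>R Y' x" if "x \<in> \<Omega>" for x i
    using that Omega_subset by (intro GDERIV_mult Y(1) G_deriv) auto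
  let ?div = "\<lambda>x. \<Sum>i\<in>UNIV. (Y x *\<^sub>R H i x + G x $ i *\<^sub>R Y' x) $ i"
  have cdiv: "continuous_on (closure \<Omega>) ?div" by (intro continuous_intros Y H_cont' cGi)
  have div_eq: "?div x = Y x * (H 1 x $ 1 + H 2 x $ 2) + G x \<bullet> Y' x" for x
    by (simp add: sum_2 inner_2 algebra_simps)
  \<comment> \<open>Here \<open>?div\<close> is the divergence of Y G: Y times the Laplacian of g,
    which is at most 2 M in modulus, plus the inner product of G with Y', where norm G \<le>
    M.\<close>
  have div_le: "\<bar>?div x\<bar> \<le> F x" if x: "x \<in> \<Omega>" for x
  proof -
    have xD: "x \<in> D" using x Omega_subset by blast
    have "\<bar>H 1 x $ 1\<bar> \<le> M" "\<bar>H 2 x $ 2\<bar> \<le> M"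
      using component_le_norm_cart[of "H 1 x" 1] component_le_norm_cart[of "H 2 x" 2] H_le[OF xD, of 1] H_le[OF xD, of 2] by linarith+
    then have "\<bar>H 1 x $ 1 + H 2 x $ 2\<bar> \<le> 2 * M" by linarith
    then have "\<bar>Y x\<bar> * \<bar>H 1 x $ 1 + H 2 x $ 2\<bar> \<le> \<bar>Y x\<bar> * (2 * M)" by (intro mult_left_mono) auto
    moreover have "\<bar>G x \<bullet> Y' x\<bar> \<le> M * norm (Y' x)"
      using Cauchy_Schwarz_ineq2[of "G x" "Y' x"] mult_right_mono[OF G_le[OF xD], of "norm (Y' x)"] by simp
    moreover have "\<bar>?div x\<bar> \<le> \<bar>Y x\<bar> * \<bar>H 1 x $ 1 + H 2 x $ 2\<bar> + \<bar>G x \<bullet> Y' x\<bar>"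
      unfolding div_eq abs_mult[symmetric] by (rule abs_triangle_ineq)
    ultimately show ?thesis using F(2)[OF x] by (simp add: mult_ac)
  qed
  have step: "integral\<^sup>L (lebesgue_on \<Omega>) (\<lambda>x. \<kappa> (dn n) x * (Y x * (norm (G x))\<^sup>2)) \<le> integral\<^sup>L (lebesgue_on \<Omega>) F" for n
  proof -
    have ik: "integrable (lebesgue_on \<Omega>) (\<lambda>x. \<kappa> (dn n) x * ((Y x * G x $ i) * G x $ i))" for i
      by (intro integrable_\<kappa> dn continuous_intros Y G_closure_continuous)
    have ie: "integrable (lebesgue_on \<Omega>) (\<lambda>x. \<eta> (dn n) x * (Y x *\<^sub>R H i x + G x $ i *\<^sub>R Y' x) $ i)" for i
      by (intro integrable_\<eta> continuous_intros Y H_cont' G_closure_continuous)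
    have "integral\<^sup>L (lebesgue_on \<Omega>) (\<lambda>x. \<kappa> (dn n) x * (Y x * (norm (G x))\<^sup>2)) =
        integral\<^sup>L (lebesgue_on \<Omega>) (\<lambda>x. \<Sum>i\<in>UNIV. \<kappa> (dn n) x * ((Y x * G x $ i) * G x $ i))"
      by (simp add: power2_norm_eq_inner inner_2 sum_2 algebra_simps)
    also have "\<dots> = (\<Sum>i\<in>UNIV. integral\<^sup>L (lebesgue_on \<Omega>) (\<lambda>x. \<kappa> (dn n) x * ((Y x * G x $ i) * G x $ i)))"
      using ik by (rule Bochner_Integration.integral_sum)
    also have "\<dots> = (\<Sum>i\<in>UNIV. integral\<^sup>L (lebesgue_on \<Omega>) (\<lambda>x. \<eta> (dn n) x * (Y x *\<^sub>R H i x + G x $ i *\<^sub>R Y' x) $ i))"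
      by (intro sum.cong refl cutoff_partial_integral dn dYG continuous_intros Y H_cont' cGi)
    also have "\<dots> = integral\<^sup>L (lebesgue_on \<Omega>) (\<lambda>x. \<Sum>i\<in>UNIV. \<eta> (dn n) x * (Y x *\<^sub>R H i x + G x $ i *\<^sub>R Y' x) $ i)"
      using ie by (rule Bochner_Integration.integral_sum[symmetric])
    also have "\<dots> = integral\<^sup>L (lebesgue_on \<Omega>) (\<lambda>x. \<eta> (dn n) x * ?div x)"
      by (simp add: sum_distrib_left)
    also have "\<dots> \<le> integral\<^sup>L (lebesgue_on \<Omega>) F"
    proof (rule Bochner_Integration.integral_mono[OF integrable_\<eta>[OF cdiv] integrable_closure[OF F(1)]])
      fix x assume "x \<in> space (lebesgue_on \<Omega>)"
      then have x: "x \<in> \<Omega>" by simp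
      have "\<eta> (dn n) x * ?div x \<le> \<bar>\<eta> (dn n) x\<bar> * \<bar>?div x\<bar>" unfolding abs_mult[symmetric] by (rule abs_ge_self)
      also have "\<dots> \<le> 1 * F x" using \<eta>_bounds[of "dn n" x] div_le[OF x] by (intro mult_mono) auto
      finally show "\<eta> (dn n) x * ?div x \<le> F x" by simp
    qed
    finally show ?thesis .
  qed
  have "continuous_on (closure \<Omega>) (\<lambda>x. Y x * (norm (G x))\<^sup>2)"
    by (intro continuous_intros Y G_closure_continuous)
  from boundary_limit_lebesgue[OF this] show ?thesis
    by (rule LIMSEQ_le_const2) (use step in blast)
qed

lemma measure_Omega_le: "measure lebesgue \<Omega> \<le> measure lebesgue D"
  using Omega_subset bounded_Omega open_Omega boundedD openD
  by (intro measure_mono_fmeasurable) (auto simp: lmeasurable_open)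

text \<open>The orbits have speed norm G, so the left side is arc length. Times m it is at most the
  flux of G through \<Gamma>, and the divergence of G is at most 2 M in modulus. This makes the
  lower bound for the boundary cost uniform in g.\<close>

lemma boundary_length: "bdry (\<lambda>x. norm (G x)) \<le> 2 * M / m * measure lebesgue D"
proof -
  have c: "continuous_on \<Gamma> (\<lambda>x. norm (G x))" by (intro continuous_intros continuous_on_Gamma G_closure_continuous)
  have "m * bdry (\<lambda>x. norm (G x)) = bdry (\<lambda>x. m * norm (G x))" by (rule bdry_cmult[symmetric])
  also have "\<dots> \<le> bdry (\<lambda>x. 1 * (norm (G x))\<^sup>2)"
  proof (rule bdry_mono)
    show "m * norm (G x) \<le> 1 * (norm (G x))\<^sup>2" if "x \<in> \<Gamma>" for x
      using norm_G_Gamma[OF that] mult_right_mono[of m "norm (G x)" "norm (G x)"] by (simp add: power2_eq_square)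
  qed (intro continuous_intros c)+
  also have "\<dots> \<le> integral\<^sup>L (lebesgue_on \<Omega>) (\<lambda>x. 2 * M)"
    by (rule flux_bound[where Y' = "\<lambda>x. 0"]) (auto intro: GDERIV_const)
  also have "\<dots> = 2 * M * measure lebesgue \<Omega>"
    using Omega_lebesgue by (simp add: measure_restrict_space)
  also have "\<dots> \<le> 2 * M * measure lebesgue D" using measure_Omega_le M_pos by (intro mult_left_mono) auto
  finally show ?thesis using m by (simp add: field_simps)
qed

text \<open>Testing the weak equation with \<open>w\<close> gives \<open>I = \<integral> w \<partial>w/\<partial>n\<close>; the trace bound
  \<open>\<integral> w\<^sup>2 \<le> C I\<close> comes from the flux of \<open>w\<^sup>2 G\<close>.\<close>

lemma energy_estimate:
  assumes w: "\<And>x. x \<in> \<Omega> \<Longrightarrow> GDERIV w x :> w' x" "continuous_on (closure \<Omega>) w" "continuous_on (closure \<Omega>) w'"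
    and weak: "\<And>\<psi> \<psi>'. C1c \<Omega> \<psi> \<psi>' \<Longrightarrow> integral\<^sup>L (lebesgue_on \<Omega>) (\<lambda>x. w' x \<bullet> \<psi>' x) = - integral\<^sup>L (lebesgue_on \<Omega>) (\<lambda>x. w x * \<psi> x)"
  defines "I \<equiv> integral\<^sup>L (lebesgue_on \<Omega>) (\<lambda>x. (w x)\<^sup>2 + (norm (w' x))\<^sup>2)"
  shows "I \<le> 3 * M * bdry (\<lambda>x. (w' x \<bullet> (G x /\<^sub>R norm (G x)))\<^sup>2)"
proof -
  let ?e = "\<lambda>x. (w x)\<^sup>2 + (norm (w' x))\<^sup>2"
  have ce: "continuous_on (closure \<Omega>) ?e" by (intro continuous_intros w)
  have cwg: "continuous_on (closure \<Omega>) (\<lambda>x. w x * (w' x \<bullet> G x))" by (intro continuous_intros w G_closure_continuous)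
  \<comment> \<open>The test function is w times the cut-off; the gradient of the cut-off yields the
    right-hand side, the future boundary term.\<close>
  have step: "integral\<^sup>L (lebesgue_on \<Omega>) (\<lambda>x. \<eta> (dn n) x * ?e x) = integral\<^sup>L (lebesgue_on \<Omega>) (\<lambda>x. \<kappa> (dn n) x * (w x * (w' x \<bullet> G x)))" for n
  proof -
    note i1 = integrable_\<kappa>[OF dn(1) cwg, of n] and i2 = integrable_\<eta>
    let ?\<psi> = "\<lambda>x. if x \<in> \<Omega> then \<eta> (dn n) x * w x else 0"
    let ?\<psi>' = "\<lambda>x. if x \<in> \<Omega> then \<eta> (dn n) x *\<^sub>R w' x + w x *\<^sub>R (- \<kappa> (dn n) x *\<^sub>R G x) else 0"
    have "integral\<^sup>L (lebesgue_on \<Omega>) (\<lambda>x. w' x \<bullet> ?\<psi>' x) = - integral\<^sup>L (lebesgue_on \<Omega>) (\<lambda>x. w x * ?\<psi> x)"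
      by (rule weak[OF cutoff_C1c[OF dn(1) w(1) continuous_on_Omega[OF w(3)]]])
    moreover have "integral\<^sup>L (lebesgue_on \<Omega>) (\<lambda>x. w' x \<bullet> ?\<psi>' x) =
        integral\<^sup>L (lebesgue_on \<Omega>) (\<lambda>x. \<eta> (dn n) x * (norm (w' x))\<^sup>2 - \<kappa> (dn n) x * (w x * (w' x \<bullet> G x)))"
      by (rule Bochner_Integration.integral_cong) (auto simp: inner_diff_right power2_norm_eq_inner)
    moreover have "\<dots> = integral\<^sup>L (lebesgue_on \<Omega>) (\<lambda>x. \<eta> (dn n) x * (norm (w' x))\<^sup>2) -
        integral\<^sup>L (lebesgue_on \<Omega>) (\<lambda>x. \<kappa> (dn n) x * (w x * (w' x \<bullet> G x)))"
      by (intro Bochner_Integration.integral_diff i1 i2 continuous_intros w)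
    moreover have "integral\<^sup>L (lebesgue_on \<Omega>) (\<lambda>x. w x * ?\<psi> x) = integral\<^sup>L (lebesgue_on \<Omega>) (\<lambda>x. \<eta> (dn n) x * (w x)\<^sup>2)"
      by (rule Bochner_Integration.integral_cong) (auto simp: power2_eq_square)
    moreover have "integral\<^sup>L (lebesgue_on \<Omega>) (\<lambda>x. \<eta> (dn n) x * ?e x) =
        integral\<^sup>L (lebesgue_on \<Omega>) (\<lambda>x. \<eta> (dn n) x * (w x)\<^sup>2) + integral\<^sup>L (lebesgue_on \<Omega>) (\<lambda>x. \<eta> (dn n) x * (norm (w' x))\<^sup>2)"
      unfolding distrib_left by (intro Bochner_Integration.integral_add i2 continuous_intros w)
    ultimately show ?thesis by linarith
  qed
  have "(\<lambda>n. integral\<^sup>L (lebesgue_on \<Omega>) (\<lambda>x. \<eta> (dn n) x * ?e x)) \<longlonglongrightarrow> I"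
    unfolding I_def by (rule \<eta>_limit[OF ce])
  moreover have "(\<lambda>n. integral\<^sup>L (lebesgue_on \<Omega>) (\<lambda>x. \<eta> (dn n) x * ?e x)) \<longlonglongrightarrow> bdry (\<lambda>x. w x * (w' x \<bullet> G x))"
    unfolding step by (rule boundary_limit_lebesgue[OF cwg])
  ultimately have I: "I = bdry (\<lambda>x. w x * (w' x \<bullet> G x))" by (rule LIMSEQ_unique)
  \<comment> \<open>The gradient of w^2 contributes M, by 2 \<bar>w\<bar> norm w' \<le> w^2 + (norm
    w')^2, and the Laplacian of g contributes 2 M; together 3 M.\<close>
  have trace: "bdry (\<lambda>x. (w x)\<^sup>2 * (norm (G x))\<^sup>2) \<le> 3 * M * I"
  proof -
    have "bdry (\<lambda>x. (w x)\<^sup>2 * (norm (G x))\<^sup>2) \<le> integral\<^sup>L (lebesgue_on \<Omega>) (\<lambda>x. 3 * M * ?e x)"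
    proof (rule flux_bound[where Y' = "\<lambda>x. (2 * w x) *\<^sub>R w' x"])
      show "GDERIV (\<lambda>x. (w x)\<^sup>2) x :> (2 * w x) *\<^sub>R w' x" if "x \<in> \<Omega>" for x
        using GDERIV_mult[OF w(1)[OF that] w(1)[OF that]] by (simp add: power2_eq_square scaleR_left_distrib[symmetric])
      show "continuous_on (closure \<Omega>) (\<lambda>x. (w x)\<^sup>2)" "continuous_on (closure \<Omega>) (\<lambda>x. (2 * w x) *\<^sub>R w' x)"
        "continuous_on (closure \<Omega>) (\<lambda>x. 3 * M * ?e x)"
        by (intro continuous_intros w)+
      fix x
      have "0 \<le> (\<bar>w x\<bar> - norm (w' x))\<^sup>2" by simp
      then have "2 * (\<bar>w x\<bar> * norm (w' x)) \<le> ?e x" by (simp add: power2_diff)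
      then have "M * (2 * (\<bar>w x\<bar> * norm (w' x))) \<le> M * ?e x" using M_pos by (intro mult_left_mono) auto
      moreover have "2 * M * (w x)\<^sup>2 \<le> 2 * M * ?e x" using M_pos by (intro mult_left_mono) auto
      ultimately show "M * norm ((2 * w x) *\<^sub>R w' x) + 2 * M * \<bar>(w x)\<^sup>2\<bar> \<le> 3 * M * ?e x"
        by (simp add: abs_mult mult.assoc)
    qed
    then show ?thesis by (simp add: I_def)
  qed
  let ?b = "\<lambda>x. w' x \<bullet> (G x /\<^sub>R norm (G x))"
  have nz: "norm (G x) \<noteq> 0" if "x \<in> \<Gamma>" for x using norm_G_Gamma[OF that] m by auto
  have cG: "continuous_on \<Gamma> G" and cw: "continuous_on \<Gamma> w" and cw': "continuous_on \<Gamma> w'"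
    by (intro continuous_on_Gamma G_closure_continuous w)+
  have c1: "continuous_on \<Gamma> (\<lambda>x. 1 / (6 * M) * ((w x)\<^sup>2 * (norm (G x))\<^sup>2))"
    by (intro continuous_intros cG cw)
  have c2: "continuous_on \<Gamma> (\<lambda>x. 3 * M / 2 * (?b x)\<^sup>2)"
    by (intro continuous_intros cG cw') (use nz in auto)
  \<comment> \<open>Young's inequality, weighted so that 1 / (6 M) times the trace bound 3 M I is I
    / 2, which is then absorbed on the left.\<close>
  have "bdry (\<lambda>x. w x * (w' x \<bullet> G x)) \<le> bdry (\<lambda>x. 1 / (6 * M) * ((w x)\<^sup>2 * (norm (G x))\<^sup>2) + 3 * M / 2 * (?b x)\<^sup>2)"
  proof (rule bdry_mono)
    show "continuous_on \<Gamma> (\<lambda>x. w x * (w' x \<bullet> G x))" by (intro continuous_on_Gamma cwg)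
    show "continuous_on \<Gamma> (\<lambda>x. 1 / (6 * M) * ((w x)\<^sup>2 * (norm (G x))\<^sup>2) + 3 * M / 2 * (?b x)\<^sup>2)"
      by (rule continuous_on_add[OF c1 c2])
    fix x assume x: "x \<in> \<Gamma>"
    define a where "a = w x * norm (G x)"
    have eq: "w x * (w' x \<bullet> G x) = a * ?b x" using nz[OF x] by (simp add: a_def)
    have "0 \<le> (a - 3 * M * ?b x)\<^sup>2" by simp
    then have "2 * (3 * M) * (a * ?b x) \<le> a\<^sup>2 + (3 * M)\<^sup>2 * (?b x)\<^sup>2"
      by (simp add: power2_diff power_mult_distrib algebra_simps)
    then have "(2 * (3 * M) * (a * ?b x)) / (6 * M) \<le> (a\<^sup>2 + (3 * M)\<^sup>2 * (?b x)\<^sup>2) / (6 * M)"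
      using M_pos by (intro divide_right_mono) auto
    moreover have "(2 * (3 * M) * (a * ?b x)) / (6 * M) = a * ?b x" using M_pos by simp
    moreover have "(a\<^sup>2 + (3 * M)\<^sup>2 * (?b x)\<^sup>2) / (6 * M) = 1 / (6 * M) * a\<^sup>2 + 3 * M / 2 * (?b x)\<^sup>2"
      using M_pos by (simp add: field_simps power2_eq_square)
    ultimately show "w x * (w' x \<bullet> G x) \<le> 1 / (6 * M) * ((w x)\<^sup>2 * (norm (G x))\<^sup>2) + 3 * M / 2 * (?b x)\<^sup>2"
      unfolding eq by (simp add: a_def power_mult_distrib)
  qed
  also have "\<dots> = 1 / (6 * M) * bdry (\<lambda>x. (w x)\<^sup>2 * (norm (G x))\<^sup>2) + 3 * M / 2 * bdry (\<lambda>x. (?b x)\<^sup>2)"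
    unfolding bdry_add[OF c1 c2] bdry_cmult ..
  also have "\<dots> \<le> 1 / (6 * M) * (3 * M * I) + 3 * M / 2 * bdry (\<lambda>x. (?b x)\<^sup>2)"
    using trace M_pos by (intro add_right_mono mult_left_mono) auto
  also have "1 / (6 * M) * (3 * M * I) = I / 2" using M_pos by simp
  finally show ?thesis unfolding I[symmetric] by simp
qed

text \<open>\<open>H1_norm\<close> picks an arbitrary weak gradient; any such choice agrees with w'
  almost everywhere, so the norm is the classical one.\<close>

lemma H1_classical:
  assumes w: "\<And>x. x \<in> \<Omega> \<Longrightarrow> GDERIV w x :> w' x" "continuous_on (closure \<Omega>) w" "continuous_on (closure \<Omega>) w'"
  shows "in_H1 \<Omega> w" "H1_norm \<Omega> w = sqrt (integral\<^sup>L (lebesgue_on \<Omega>) (\<lambda>x. (w x)\<^sup>2 + (norm (w' x))\<^sup>2))"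
proof -
  note int = integrable_closure
  have Lp: "in_Lp 2 \<Omega> F" if F: "continuous_on (closure \<Omega>) F" for F :: "real^2 \<Rightarrow> real"
  proof -
    have "(\<lambda>x. \<bar>F x\<bar> powr 2) = (\<lambda>x. (F x)\<^sup>2)" by (simp add: powr_numeral)
    moreover have "integrable (lebesgue_on \<Omega>) (\<lambda>x. (F x)\<^sup>2)" by (intro int continuous_intros F)
    ultimately show ?thesis using int[OF F] by (simp add: in_Lp_def)
  qed
  have wg: "weak_grad 2 \<Omega> w w'"
    unfolding weak_grad_def
  proof (intro conjI allI impI)
    show "in_Lp 2 \<Omega> w" by (rule Lp[OF w(2)])
    show "in_Lp 2 \<Omega> (\<lambda>x. w' x $ i)" for i by (intro Lp continuous_intros w)
    show "integral\<^sup>L (lebesgue_on \<Omega>) (\<lambda>x. w x * grad \<phi> x $ i) = - integral\<^sup>L (lebesgue_on \<Omega>) (\<lambda>x. w' x $ i * \<phi> x)"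
      if "test_function \<Omega> \<phi>" for \<phi> i
      by (rule classical_weak_identity[OF open_Omega w(1) continuous_on_Omega[OF w(3)] test_function_C1c[OF that]])
  qed
  then show "in_H1 \<Omega> w" unfolding in_H1_def by blast
  define V where "V = (SOME V. weak_grad 2 \<Omega> w V)"
  have V: "weak_grad 2 \<Omega> w V" unfolding V_def by (rule someI[of "weak_grad 2 \<Omega> w", OF wg])
  have AE: "AE x in lebesgue_on \<Omega>. V x = w' x"
    by (rule weak_grad_AE_classical[OF open_Omega w(1) continuous_on_Omega[OF w(3)] V]) simp_all
  have mV: "(\<lambda>x. (norm (V x))\<^sup>2) \<in> borel_measurable (lebesgue_on \<Omega>)"
  proof -
    have [measurable]: "(\<lambda>x. V x $ i) \<in> borel_measurable (lebesgue_on \<Omega>)" for i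
      using weak_gradD(2)[OF V, of i] unfolding in_Lp_def by (rule conjunct1)
    have "(\<lambda>x. (norm (V x))\<^sup>2) = (\<lambda>x. (V x $ 1)\<^sup>2 + (V x $ 2)\<^sup>2)"
      by (rule ext, subst power2_norm_eq_inner, simp only: inner_2 power2_eq_square)
    then show ?thesis by simp
  qed
  have iw: "integrable (lebesgue_on \<Omega>) (\<lambda>x. (norm (w' x))\<^sup>2)" "integrable (lebesgue_on \<Omega>) (\<lambda>x. (w x)\<^sup>2)"
    by (intro int continuous_intros w)+
  have "integral\<^sup>L (lebesgue_on \<Omega>) (\<lambda>x. (norm (V x))\<^sup>2) = integral\<^sup>L (lebesgue_on \<Omega>) (\<lambda>x. (norm (w' x))\<^sup>2)"
    by (rule integral_cong_AE[OF mV borel_measurable_integrable[OF iw(1)]]) (use AE in eventually_elim, simp)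
  then show "H1_norm \<Omega> w = sqrt (integral\<^sup>L (lebesgue_on \<Omega>) (\<lambda>x. (w x)\<^sup>2 + (norm (w' x))\<^sup>2))"
    unfolding H1_norm_def V_def[symmetric] Let_def Bochner_Integration.integral_add[OF iw(2,1)] by simp
qed

lemma boundary_integral_nonneg:
  assumes "continuous_on \<Gamma> \<phi>" "\<And>x. x \<in> \<Gamma> \<Longrightarrow> 0 \<le> \<phi> x"
  shows "boundary_integral D E g \<phi> = ereal (bdry (\<lambda>x. \<phi> x * norm (G x)))"
proof -
  have "ext_integral (lebesgue_on {0..TK K}) (\<lambda>t. \<phi> (zK K t) * norm (G (zK K t))) =
      ereal (integral {0..TK K} (\<lambda>t. \<phi> (zK K t) * norm (G (zK K t))))" if K: "K \<in> components \<Gamma>" for K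
  proof -
    have "continuous_on \<Gamma> (\<lambda>x. \<phi> x * norm (G x))" by (intro continuous_intros assms continuous_on_Gamma G_closure_continuous)
    then have i: "integrable (lebesgue_on {0..TK K}) (\<lambda>t. \<phi> (zK K t) * norm (G (zK K t)))"
      by (intro continuous_imp_integrable_real orbit_comp_continuous[OF _ K])
    have "ext_integral (lebesgue_on {0..TK K}) (\<lambda>t. \<phi> (zK K t) * norm (G (zK K t))) =
      ereal (integral\<^sup>L (lebesgue_on {0..TK K}) (\<lambda>t. \<phi> (zK K t) * norm (G (zK K t))))"
      using assms(2)[OF zK_Gamma[OF K]] by (intro ext_integral_nonneg[OF i]) simp
    then show ?thesis using lebesgue_integral_eq_integral[OF i] by simp
  qed
  then show ?thesis unfolding boundary_integral_eq bdry_def by simp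
qed

lemma boundary_integral_lower_bound:
  assumes "c \<ge> 0" "\<And>x. x \<in> \<Gamma> \<Longrightarrow> - c \<le> \<phi> x"
  shows "ereal (- (c * bdry (\<lambda>x. norm (G x)))) \<le> boundary_integral D E g \<phi>"
proof -
  have "ereal (- integral {0..TK K} (\<lambda>t. c * norm (G (zK K t)))) \<le>
      ext_integral (lebesgue_on {0..TK K}) (\<lambda>t. \<phi> (zK K t) * norm (G (zK K t)))" if K: "K \<in> components \<Gamma>" for K
  proof -
    have "continuous_on \<Gamma> (\<lambda>x. c * norm (G x))" by (intro continuous_intros continuous_on_Gamma G_closure_continuous)
    then have i: "integrable (lebesgue_on {0..TK K}) (\<lambda>t. c * norm (G (zK K t)))"
      by (intro continuous_imp_integrable_real orbit_comp_continuous[OF _ K])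
    have "- (c * norm (G (zK K t))) \<le> \<phi> (zK K t) * norm (G (zK K t))" for t
      using mult_right_mono[OF assms(2)[OF zK_Gamma[OF K]], of "norm (G (zK K t))"] by simp
    then have "ereal (- integral\<^sup>L (lebesgue_on {0..TK K}) (\<lambda>t. c * norm (G (zK K t)))) \<le>
        ext_integral (lebesgue_on {0..TK K}) (\<lambda>t. \<phi> (zK K t) * norm (G (zK K t)))"
      using assms(1) by (intro ext_integral_lower_bound[OF i]) auto
    moreover have "integral\<^sup>L (lebesgue_on {0..TK K}) (\<lambda>t. c * norm (G (zK K t))) = integral {0..TK K} (\<lambda>t. c * norm (G (zK K t)))"
      by (rule lebesgue_integral_eq_integral[OF i]) simp
    ultimately show ?thesis by (simp only:)
  qed
  then have "(\<Sum>K\<in>components \<Gamma>. ereal (- integral {0..TK K} (\<lambda>t. c * norm (G (zK K t))))) \<le> boundary_integral D E g \<phi>"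
    unfolding boundary_integral_eq by (rule sum_mono)
  moreover have "(\<Sum>K\<in>components \<Gamma>. - integral {0..TK K} (\<lambda>t. c * norm (G (zK K t)))) = - (c * bdry (\<lambda>x. norm (G x)))"
    by (simp add: bdry_def sum_negf sum_distrib_left)
  ultimately show ?thesis by (simp only: sum_ereal)
qed

end

section \<open>The penalized problem\<close>

text \<open>\<open>Ck_closure\<close> only provides some gradients of first and second order; on D
  they coincide with those formed by \<open>grad\<close>, to which the uniform bound refers.\<close>

lemma bounded_in_C2_level_domain:
  fixes D E :: "(real^2) set"
  assumes D: "domain D" "bounded D" and E: "domain E" "closure E \<subseteq> D"
    and g: "Ck_closure 2 D g" and bd: "\<forall>x\<in>D. \<bar>g x\<bar> \<le> M \<and> norm (grad g x) \<le> M \<and> (\<forall>i. norm (grad (\<lambda>y. grad g y $ i) x) \<le> M)"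
    and sgn: "\<forall>x\<in>E. g x \<le> 0" "\<forall>x\<in>frontier D. g x > 0"
    and m: "m > 0" "\<forall>x\<in>D. g x = 0 \<longrightarrow> norm (grad g x) \<ge> m"
  obtains H where "level_domain D E g (grad g) H m M"
proof -
  have oD: "open D" using D by (simp add: domain_def)
  obtain G where cg: "continuous_on (closure D) g" and G: "\<And>x. x \<in> D \<Longrightarrow> GDERIV g x :> G x"
    and G1: "\<And>i. Ck_closure (Suc 0) D (\<lambda>x. G x $ i)"
    using g by (auto simp: numeral_2_eq_2 simp del: One_nat_def)
  have gr: "grad g x = G x" if "x \<in> D" for x using G[OF that] by (rule grad_eqI)
  have "\<exists>H. (\<forall>x\<in>D. GDERIV (\<lambda>x. G x $ i) x :> H x) \<and> (\<forall>j. continuous_on (closure D) (\<lambda>x. H x $ j))" for i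
    using G1[of i] by simp
  then obtain H where H: "\<And>i x. x \<in> D \<Longrightarrow> GDERIV (\<lambda>x. G x $ i) x :> H i x"
    and cH: "\<And>i j. continuous_on (closure D) (\<lambda>x. H i x $ j)" by metis
  have H': "GDERIV (\<lambda>x. grad g x $ i) x :> H i x" if "x \<in> D" for i x
    by (rule GDERIV_transform_open[OF H[OF that] oD that]) (simp add: gr)
  have "level_domain D E g (grad g) H m M"
  proof
    show "open D" "bounded D" "open E" "connected E" "E \<noteq> {}" using D E by (auto simp: domain_def)
    show "E \<subseteq> D" using E(2) closure_subset by blast
    show "continuous_on (closure D) g" by fact
    show "GDERIV g x :> grad g x" if "x \<in> D" for x using G[OF that] gr[OF that] by simp
    show "GDERIV (\<lambda>x. grad g x $ i) x :> H i x" if "x \<in> D" for i x using that by (rule H')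
    show "continuous_on D (H i)" for i
      by (intro continuous_on_vecI continuous_on_subset[OF cH closure_subset])
    show "norm (grad g x) \<le> M" if "x \<in> D" for x using bd that by blast
    show "norm (H i x) \<le> M" if "x \<in> D" for i x
    proof -
      have "norm (grad (\<lambda>y. grad g y $ i) x) \<le> M" using bd that by blast
      then show ?thesis unfolding grad_eqI[OF H'[OF that]] .
    qed
    show "g x \<le> 0" if "x \<in> E" for x using sgn that by blast
    show "g x > 0" if "x \<in> frontier D" for x using sgn that by blast
    show "0 < m" by fact
    show "m \<le> norm (grad g x)" if "x \<in> D" "g x = 0" for x using m that by blast
  qed
  then show thesis by (rule that)
qed

context level_domain
begin

text \<open>\<open>energy_estimate\<close> bounds the squared H^1 norm by 3 M times the squared
  normal derivative of y integrated in orbit time. The penalty integral is in arc length, which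
  carries the extra weight norm G \<ge> m; hence the factor 1 / m.\<close>

lemma solutions_difference_estimate:
  assumes p: "p \<ge> 1" and f: "in_Lp p D f"
    and v: "neumann_solution p \<Omega> f v"
    and r: "in_Lp p D (\<lambda>x. (max (g x) 0)\<^sup>2 * u x)" and y: "strong_solution p D (\<lambda>x. f x + (max (g x) 0)\<^sup>2 * u x) y"
    and pen: "boundary_integral D E g (\<lambda>x. (grad y x \<bullet> (G x /\<^sub>R norm (G x)))\<^sup>2) \<le> ereal P"
  shows "in_H1 \<Omega> (\<lambda>x. v x - y x)" "H1_norm \<Omega> (\<lambda>x. v x - y x) \<le> sqrt (3 * M / m * P)"
proof -
  let ?r = "\<lambda>x. f x + (max (g x) 0)\<^sup>2 * u x"
  obtain Gv where Gv: "continuous_on (closure \<Omega>) Gv" "\<And>x. x \<in> \<Omega> \<Longrightarrow> GDERIV v x :> Gv x"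
    "\<And>x n. x \<in> \<Gamma> \<Longrightarrow> outward_normal \<Omega> x n \<Longrightarrow> Gv x \<bullet> n = 0" and vs: "strong_solution p \<Omega> f v"
    using v unfolding neumann_solution_def by blast
  have cv: "continuous_on (closure \<Omega>) v" using vs by (simp add: strong_solution_def)
  obtain Gy where Gy: "\<And>x. x \<in> D \<Longrightarrow> GDERIV y x :> Gy x" "\<And>i. continuous_on (closure D) (\<lambda>x. Gy x $ i)"
    using y unfolding strong_solution_def by auto
  have cGy: "continuous_on D Gy" by (intro continuous_on_vecI continuous_on_subset[OF Gy(2) closure_subset])
  have cy: "continuous_on D y" using Gy(1) by (rule GDERIV_continuous_on)
  have gry: "grad y x = Gy x" if "x \<in> D" for x using Gy(1)[OF that] by (rule grad_eqI)
  let ?w = "\<lambda>x. v x - y x" and ?w' = "\<lambda>x. Gv x - Gy x"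
  have w: "\<And>x. x \<in> \<Omega> \<Longrightarrow> GDERIV ?w x :> ?w' x" "continuous_on (closure \<Omega>) ?w" "continuous_on (closure \<Omega>) ?w'"
    using Omega_subset_D
    by (auto intro!: GDERIV_diff Gv Gy continuous_intros cv continuous_on_subset[OF cy closure_Omega_subset]
        continuous_on_subset[OF cGy closure_Omega_subset])
  have weak: "integral\<^sup>L (lebesgue_on \<Omega>) (\<lambda>x. ?w' x \<bullet> \<psi>' x) = - integral\<^sup>L (lebesgue_on \<Omega>) (\<lambda>x. ?w x * \<psi> x)"
    if \<psi>: "C1c \<Omega> \<psi> \<psi>'" for \<psi> \<psi>'
  proof -
    obtain K where K: "compact K" "K \<subseteq> \<Omega>" "\<And>x. x \<notin> K \<Longrightarrow> \<psi> x = 0" "\<And>x. x \<notin> K \<Longrightarrow> \<psi>' x = 0"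
      using \<psi> unfolding C1c_def by blast
    have c\<psi>: "continuous_on UNIV \<psi>" "continuous_on UNIV \<psi>'" using C1c_continuous[OF \<psi>] \<psi> by (auto simp: C1c_def)
    have lf: "locally_integrable_on \<Omega> f"
      by (rule locally_integrable_on_subset[OF in_Lp_locally_integrable[OF openD f p] openD open_Omega Omega_subset_D])
    note int = integrable_mult_compact_support[OF open_Omega _ K(1,2) c\<psi>(1) K(3)]
    have i\<psi>: "integrable (lebesgue_on \<Omega>) (\<lambda>x. f x * \<psi> x)"
      by (rule int[OF lf])
    moreover have "integrable (lebesgue_on \<Omega>) (\<lambda>x. v x * \<psi> x)"
      by (rule int[OF continuous_locally_integrable[OF open_Omega continuous_on_Omega[OF cv]]])
    moreover have "integrable (lebesgue_on \<Omega>) (\<lambda>x. y x * \<psi> x)"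
      by (rule int[OF continuous_locally_integrable[OF open_Omega continuous_on_subset[OF cy Omega_subset_D]]])
    ultimately have i\<psi>: "integrable (lebesgue_on \<Omega>) (\<lambda>x. f x * \<psi> x)" "integrable (lebesgue_on \<Omega>) (\<lambda>x. v x * \<psi> x)"
      "integrable (lebesgue_on \<Omega>) (\<lambda>x. y x * \<psi> x)" by iprover+
    have iG: "integrable (lebesgue_on \<Omega>) (\<lambda>x. A x \<bullet> \<psi>' x)" if A: "continuous_on (closure \<Omega>) A" for A
    proof -
      have c: "continuous_on (closure \<Omega>) (\<lambda>x. A x \<bullet> \<psi>' x)"
        by (intro continuous_intros A continuous_on_subset[OF c\<psi>(2)]) simp
      show ?thesis by (rule integrable_closure[OF c])
    qed
    have ev: "integral\<^sup>L (lebesgue_on \<Omega>) (\<lambda>x. Gv x \<bullet> \<psi>' x) = integral\<^sup>L (lebesgue_on \<Omega>) (\<lambda>x. (f x - v x) * \<psi> x)"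
    proof (rule strong_solution_test[OF open_Omega open_Omega subset_refl p vs _ Gv(2) continuous_on_Omega[OF Gv(1)] \<psi>])
      have "f \<in> borel_measurable (lebesgue_on D)" using f by (simp add: in_Lp_def)
      then show "f \<in> borel_measurable (lebesgue_on \<Omega>)"
        using Omega_lebesgue Omega_subset_D by (rule_tac measurable_restrict_mono) auto
    qed
    have "integral\<^sup>L (lebesgue_on \<Omega>) (\<lambda>x. Gy x \<bullet> \<psi>' x) = integral\<^sup>L (lebesgue_on \<Omega>) (\<lambda>x. (?r x - y x) * \<psi> x)"
      by (rule strong_solution_test[OF openD open_Omega Omega_subset_D p y _ Gy(1) cGy \<psi>])
        (use f r in \<open>auto simp: in_Lp_def intro: borel_measurable_add\<close>)
    also have "\<dots> = integral\<^sup>L (lebesgue_on \<Omega>) (\<lambda>x. (f x - y x) * \<psi> x)"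
    proof (rule Bochner_Integration.integral_cong[OF refl])
      fix x assume "x \<in> space (lebesgue_on \<Omega>)"
      then have "g x < 0" using g_neg_on_Omega by simp
      then show "(?r x - y x) * \<psi> x = (f x - y x) * \<psi> x" by simp
    qed
    finally have ey: "integral\<^sup>L (lebesgue_on \<Omega>) (\<lambda>x. Gy x \<bullet> \<psi>' x) = integral\<^sup>L (lebesgue_on \<Omega>) (\<lambda>x. (f x - y x) * \<psi> x)" .
    have "integral\<^sup>L (lebesgue_on \<Omega>) (\<lambda>x. ?w' x \<bullet> \<psi>' x) =
        integral\<^sup>L (lebesgue_on \<Omega>) (\<lambda>x. Gv x \<bullet> \<psi>' x) - integral\<^sup>L (lebesgue_on \<Omega>) (\<lambda>x. Gy x \<bullet> \<psi>' x)"
      unfolding inner_diff_left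
      by (intro Bochner_Integration.integral_diff iG Gv continuous_on_subset[OF cGy closure_Omega_subset])
    then show ?thesis
      unfolding ev ey left_diff_distrib using i\<psi> by simp
  qed
  show "in_H1 \<Omega> ?w" by (rule H1_classical(1)[OF w])
  have cn: "continuous_on \<Gamma> (\<lambda>x. G x /\<^sub>R norm (G x))"
  proof -
    have "norm (G x) \<noteq> 0" if "x \<in> \<Gamma>" for x using norm_G_Gamma[OF that] m by auto
    then show ?thesis by (intro continuous_intros continuous_on_Gamma G_closure_continuous) auto
  qed
  have cGyb: "continuous_on \<Gamma> Gy" using cGy Gamma_subset_D by (rule continuous_on_subset)
  let ?q = "\<lambda>x. (Gy x \<bullet> (G x /\<^sub>R norm (G x)))\<^sup>2"
  have cq: "continuous_on \<Gamma> ?q" by (intro continuous_intros cGyb cn)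
  have "bdry (\<lambda>x. (?w' x \<bullet> (G x /\<^sub>R norm (G x)))\<^sup>2) = bdry ?q"
  proof (rule bdry_cong)
    fix x assume x: "x \<in> \<Gamma>"
    show "(?w' x \<bullet> (G x /\<^sub>R norm (G x)))\<^sup>2 = ?q x"
      by (simp only: inner_diff_left Gv(3)[OF x outward_normal_Gamma[OF x]] diff_0 power2_minus)
  qed
  also have "m * bdry ?q = bdry (\<lambda>x. m * ?q x)" by (rule bdry_cmult[symmetric])
  also have "\<dots> \<le> bdry (\<lambda>x. ?q x * norm (G x))"
  proof (rule bdry_mono)
    show "continuous_on \<Gamma> (\<lambda>x. m * ?q x)" by (rule continuous_on_mult_left[OF cq])
    show "continuous_on \<Gamma> (\<lambda>x. ?q x * norm (G x))" by (intro continuous_on_mult cq continuous_intros continuous_on_Gamma G_closure_continuous)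
    show "m * ?q x \<le> ?q x * norm (G x)" if "x \<in> \<Gamma>" for x
      using mult_left_mono[OF conjunct1[OF norm_G_Gamma[OF that]], of "?q x"] by (simp add: mult.commute)
  qed
  also have "\<dots> \<le> P"
  proof -
    have "boundary_integral D E g (\<lambda>x. (grad y x \<bullet> (G x /\<^sub>R norm (G x)))\<^sup>2) =
        ereal (bdry (\<lambda>x. (grad y x \<bullet> (G x /\<^sub>R norm (G x)))\<^sup>2 * norm (G x)))"
    proof (rule boundary_integral_nonneg)
      show "continuous_on \<Gamma> (\<lambda>x. (grad y x \<bullet> (G x /\<^sub>R norm (G x)))\<^sup>2)"
        by (rule continuous_on_cong[THEN iffD1, OF refl _ cq]) (use gry Gamma_subset_D in auto)
    qed simp
    also have "bdry (\<lambda>x. (grad y x \<bullet> (G x /\<^sub>R norm (G x)))\<^sup>2 * norm (G x)) = bdry (\<lambda>x. ?q x * norm (G x))"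
      by (rule bdry_cong) (use gry Gamma_subset_D in auto)
    finally show ?thesis using pen by simp
  qed
  finally have "bdry (\<lambda>x. (?w' x \<bullet> (G x /\<^sub>R norm (G x)))\<^sup>2) \<le> P / m"
    using m by (simp add: pos_le_divide_eq mult.commute)
  then have "3 * M * bdry (\<lambda>x. (?w' x \<bullet> (G x /\<^sub>R norm (G x)))\<^sup>2) \<le> 3 * M * (P / m)"
    using M_pos by (intro mult_left_mono) auto
  with energy_estimate[OF w weak]
  have le: "integral\<^sup>L (lebesgue_on \<Omega>) (\<lambda>x. (?w x)\<^sup>2 + (norm (?w' x))\<^sup>2) \<le> 3 * M / m * P" by simp
  have "H1_norm \<Omega> ?w = sqrt (integral\<^sup>L (lebesgue_on \<Omega>) (\<lambda>x. (?w x)\<^sup>2 + (norm (?w' x))\<^sup>2))"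
    by (rule H1_classical(2)[OF w])
  with real_sqrt_le_mono[OF le] show "H1_norm \<Omega> ?w \<le> sqrt (3 * M / m * P)" by linarith
qed

end

theorem proposition3p2:
  fixes D E :: "(real^2) set" and p :: real and f :: "real^2 \<Rightarrow> real"
    and J j :: "real^2 \<Rightarrow> real \<Rightarrow> real" and F :: "(real^2 \<Rightarrow> real) set"
    and m \<epsilon>\<^sub>0 :: real and yP gP :: "nat \<Rightarrow> real^2 \<Rightarrow> real"
  assumes D: "domain D" "bounded D" "C11_boundary D"
    and E: "domain E" "closure E \<subseteq> D"
    and f: "p > 2" "in_Lp p D f"
    and J: "caratheodory D J" "\<exists>c. \<forall>x\<in>D. \<forall>s. c \<le> J x s"
    and j: "caratheodory D j" "\<exists>c. \<forall>x\<in>D. \<forall>s. c \<le> j x s"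
    and F: "bounded_in_C2 D F"
      "\<forall>g\<in>F. (\<forall>x\<in>E. g x \<le> 0) \<and> (\<forall>x\<in>frontier D. g x > 0)"
    and m: "m > 0" "\<forall>g\<in>F. \<forall>x\<in>D. g x = 0 \<longrightarrow> norm (grad g x) \<ge> m"
    and P_seq: "minimizing_sequence (P_cost D E J j) (P_admissible D E p f F) (\<lambda>k. (yP k, gP k))"
    and eps0: "\<epsilon>\<^sub>0 > 0"
  shows "\<exists>C>0. \<forall>\<epsilon>. 0 < \<epsilon> \<and> \<epsilon> \<le> \<epsilon>\<^sub>0 \<longrightarrow>
    (\<forall>(y :: nat \<Rightarrow> real^2 \<Rightarrow> real) g u (n :: nat \<Rightarrow> nat).
       minimizing_sequence (Peps_cost D E J j \<epsilon>) (Peps_admissible D p f F) (\<lambda>k. (y k, g k, u k)) \<and>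
       strict_mono n \<and>
       (\<forall>k. Peps_cost D E J j \<epsilon> (y (n k), g (n k), u (n k)) \<le> P_cost D E J j (yP k, gP k)) \<longrightarrow>
       (\<forall>k v. neumann_solution p (Omega D E (g (n k))) f v \<longrightarrow>
          in_H1 (Omega D E (g (n k))) (\<lambda>x. v x - y (n k) x) \<and>
          H1_norm (Omega D E (g (n k))) (\<lambda>x. v x - y (n k) x) \<le> C * \<epsilon> powr (1/4)))"
proof -
  obtain M0 where FM0: "\<forall>g\<in>F. Ck_closure 2 D g"
    "\<And>g x. g \<in> F \<Longrightarrow> x \<in> D \<Longrightarrow> \<bar>g x\<bar> \<le> M0 \<and> norm (grad g x) \<le> M0 \<and> (\<forall>i. norm (grad (\<lambda>y. grad g y $ i) x) \<le> M0)"
    using F(1) unfolding bounded_in_C2_def by blast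
  \<comment> \<open>The maximum makes M positive before any g is at hand.\<close>
  define M where "M = max M0 1"
  have M: "M > 0" "M0 \<le> M" by (auto simp: M_def)
  have level: "\<exists>H. level_domain D E g (grad g) H m M" if g: "g \<in> F" for g
  proof -
    have "\<forall>x\<in>D. \<bar>g x\<bar> \<le> M \<and> norm (grad g x) \<le> M \<and> (\<forall>i. norm (grad (\<lambda>y. grad g y $ i) x) \<le> M)"
      using FM0(2)[OF g] M(2) order_trans by blast
    moreover have "Ck_closure 2 D g" "\<forall>x\<in>E. g x \<le> 0" "\<forall>x\<in>frontier D. g x > 0"
      "\<forall>x\<in>D. g x = 0 \<longrightarrow> norm (grad g x) \<ge> m"
      using FM0(1) F(2) m(2) g by blast+
    ultimately show ?thesis
      using bounded_in_C2_level_domain[OF D(1,2) E, of g M m] m(1) by metis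
  qed
  obtain cJ where cJ: "\<And>x s. x \<in> D \<Longrightarrow> cJ \<le> J x s" using J(2) by blast
  obtain cj where cj: "\<And>x s. x \<in> D \<Longrightarrow> cj \<le> j x s" using j(2) by blast
  let ?vol = "measure lebesgue D"
  have ED: "E \<subseteq> D" using E(2) closure_subset by blast
  have Dl: "D \<in> lmeasurable" "E \<in> lmeasurable"
    using D E ED bounded_subset[of D E] by (auto simp: domain_def lmeasurable_open)
  have E_lower: "ereal (- (\<bar>cJ\<bar> * ?vol)) \<le> ext_integral (lebesgue_on E) (\<lambda>x. J x (y x))" for y
  proof -
    have fm: "finite_measure (lebesgue_on E)" using Dl(2) by (rule finite_measure_lebesgue_on)
    have "ereal (- integral\<^sup>L (lebesgue_on E) (\<lambda>x. \<bar>cJ\<bar>)) \<le> ext_integral (lebesgue_on E) (\<lambda>x. J x (y x))"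
    proof (rule ext_integral_lower_bound)
      show "integrable (lebesgue_on E) (\<lambda>x. \<bar>cJ\<bar>)" using fm by (rule finite_measure.integrable_const)
      show "- \<bar>cJ\<bar> \<le> J x (y x)" if "x \<in> space (lebesgue_on E)" for x
        using cJ[of x "y x"] that ED by auto
    qed simp
    moreover have "integral\<^sup>L (lebesgue_on E) (\<lambda>x. \<bar>cJ\<bar>) \<le> \<bar>cJ\<bar> * ?vol"
    proof -
      have "measure lebesgue E \<le> ?vol" using Dl ED by (intro measure_mono_fmeasurable) auto
      then have "\<bar>cJ\<bar> * measure lebesgue E \<le> \<bar>cJ\<bar> * ?vol" by (intro mult_left_mono) auto
      then show ?thesis using Dl(2) by (simp add: measure_restrict_space fmeasurableD mult.commute)
    qed
    then have "ereal (- (\<bar>cJ\<bar> * ?vol)) \<le> ereal (- integral\<^sup>L (lebesgue_on E) (\<lambda>x. \<bar>cJ\<bar>))"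
      by (simp only: ereal_less_eq neg_le_iff_le)
    ultimately show ?thesis by (rule order_trans[rotated])
  qed
  \<comment> \<open>The costs along the sequence are finite and converge to a limit below
    \<infinity>, so they have one finite upper bound. As this sequence is fixed before \<epsilon>,
    the bound on the penalized costs of the selected indices does not depend on \<epsilon>.\<close>
  have P_bound: "\<exists>A. \<forall>k. P_cost D E J j (yP k, gP k) \<le> ereal A"
  proof -
    have s: "\<And>k. P_cost D E J j (yP k, gP k) < \<infinity>" "(yP 0, gP 0) \<in> P_admissible D E p f F"
      "(\<lambda>k. P_cost D E J j (yP k, gP k)) \<longlonglongrightarrow> (INF a\<in>P_admissible D E p f F. P_cost D E J j a)"
      using P_seq unfolding minimizing_sequence_def by blast+
    have "(INF a\<in>P_admissible D E p f F. P_cost D E J j a) \<le> P_cost D E J j (yP 0, gP 0)"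
      by (rule INF_lower[OF s(2)])
    then have "(INF a\<in>P_admissible D E p f F. P_cost D E J j a) < \<infinity>" using s(1)[of 0] by (rule le_less_trans)
    from ereal_sequence_bounded_above[OF s(1) s(3) this] show ?thesis by blast
  qed
  then obtain A where A: "\<And>k. P_cost D E J j (yP k, gP k) \<le> ereal A" by blast
  \<comment> \<open>The budget left for the penalty term once the lower bounds of the two cost
    integrals are subtracted from A; the maximum with 1 keeps C positive.\<close>
  define Q where "Q = max 1 (A + \<bar>cJ\<bar> * ?vol + \<bar>cj\<bar> * (2 * M / m * ?vol))"
  have Q: "Q > 0" "A + \<bar>cJ\<bar> * ?vol + \<bar>cj\<bar> * (2 * M / m * ?vol) \<le> Q" by (auto simp: Q_def)
  \<comment> \<open>The estimate is of order sqrt \<epsilon> = \<epsilon> powr (1/4) * \<epsilon>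
    powr (1/4); one factor is bounded by \<open>\<epsilon>\<^sub>0 powr (1/4)\<close> and goes into
    the constant.\<close>
  define C where "C = sqrt (3 * M / m * Q) * \<epsilon>\<^sub>0 powr (1/4)"
  have C: "C > 0" using M Q m(1) eps0 by (simp add: C_def)
  show ?thesis
  proof (intro exI[of _ C] conjI C allI impI)
    fix \<epsilon> and y g u :: "nat \<Rightarrow> real^2 \<Rightarrow> real" and n :: "nat \<Rightarrow> nat" and k v
    assume \<epsilon>: "0 < \<epsilon> \<and> \<epsilon> \<le> \<epsilon>\<^sub>0"
    assume *: "minimizing_sequence (Peps_cost D E J j \<epsilon>) (Peps_admissible D p f F) (\<lambda>k. (y k, g k, u k)) \<and>
       strict_mono n \<and>
       (\<forall>k. Peps_cost D E J j \<epsilon> (y (n k), g (n k), u (n k)) \<le> P_cost D E J j (yP k, gP k))"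
    assume v: "neumann_solution p (Omega D E (g (n k))) f v"
    let ?g = "g (n k)" and ?y = "y (n k)" and ?u = "u (n k)"
    have adm: "(?y, ?g, ?u) \<in> Peps_admissible D p f F"
      using * unfolding minimizing_sequence_def by blast
    then have gF: "?g \<in> F" and r: "in_Lp p D (\<lambda>x. (max (?g x) 0)\<^sup>2 * ?u x)"
      and ys: "strong_solution p D (\<lambda>x. f x + (max (?g x) 0)\<^sup>2 * ?u x) ?y"
      unfolding Peps_admissible_def dirichlet_solution_def by auto
    obtain H where "level_domain D E ?g (grad ?g) H m M" using level[OF gF] by blast
    then interpret L: level_domain D E ?g "grad ?g" H m M .
    let ?pen = "boundary_integral D E ?g (\<lambda>x. (grad ?y x \<bullet> (grad ?g x /\<^sub>R norm (grad ?g x)))\<^sup>2)"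
    have cost: "ext_integral (lebesgue_on E) (\<lambda>x. J x (?y x)) + boundary_integral D E ?g (\<lambda>x. j x (?y x)) +
        ereal (1 / \<epsilon>) * ?pen \<le> ereal A"
    proof -
      have "Peps_cost D E J j \<epsilon> (?y, ?g, ?u) \<le> P_cost D E J j (yP k, gP k)" using * by blast
      also have "\<dots> \<le> ereal A" by (rule A)
      finally show ?thesis by (simp add: Peps_cost_def)
    qed
    have b1: "ereal (- (\<bar>cj\<bar> * (2 * M / m * ?vol))) \<le> boundary_integral D E ?g (\<lambda>x. j x (?y x))"
    proof -
      have "- \<bar>cj\<bar> \<le> j x (?y x)" if "x \<in> L.\<Gamma>" for x
        using cj[of x "?y x"] that L.Gamma_subset_D by auto
      then have "ereal (- (\<bar>cj\<bar> * L.bdry (\<lambda>x. norm (grad ?g x)))) \<le> boundary_integral D E ?g (\<lambda>x. j x (?y x))"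
        by (intro L.boundary_integral_lower_bound) auto
      moreover have "\<bar>cj\<bar> * L.bdry (\<lambda>x. norm (grad ?g x)) \<le> \<bar>cj\<bar> * (2 * M / m * ?vol)"
        by (intro mult_left_mono L.boundary_length) auto
      then have "ereal (- (\<bar>cj\<bar> * (2 * M / m * ?vol))) \<le> ereal (- (\<bar>cj\<bar> * L.bdry (\<lambda>x. norm (grad ?g x))))"
        by (simp only: ereal_less_eq neg_le_iff_le)
      ultimately show ?thesis by (rule order_trans[rotated])
    qed
    have "ereal (- (\<bar>cJ\<bar> * ?vol)) + ereal (- (\<bar>cj\<bar> * (2 * M / m * ?vol))) + ereal (1 / \<epsilon>) * ?pen \<le> ereal A"
      by (rule order_trans[OF add_right_mono[OF add_mono[OF E_lower b1]] cost])
    \<comment> \<open>The penalty integral is an extended real a priori; the value \<infinity> would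
      contradict the finite bound A.\<close>
    then have pen: "?pen \<le> ereal (\<epsilon> * Q)"
    proof (cases ?pen)
      case (real P)
      then have "P / \<epsilon> \<le> A + \<bar>cJ\<bar> * ?vol + \<bar>cj\<bar> * (2 * M / m * ?vol)"
        using \<open>ereal (- (\<bar>cJ\<bar> * ?vol)) + _ + _ * ?pen \<le> ereal A\<close> by simp
      then have "P / \<epsilon> \<le> Q" using Q(2) by linarith
      then have "P \<le> \<epsilon> * Q" using \<epsilon> by (simp add: pos_divide_le_eq mult.commute)
      then show ?thesis using real by simp
    next
      case PInf
      then show ?thesis using \<open>ereal (- (\<bar>cJ\<bar> * ?vol)) + _ + _ * ?pen \<le> ereal A\<close> \<epsilon> by simp
    qed simp
    have p1: "p \<ge> 1" using f(1) by simp
    note est = L.solutions_difference_estimate[OF p1 f(2) v r ys pen]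
    show "in_H1 (Omega D E ?g) (\<lambda>x. v x - ?y x)" by (rule est(1))
    have "sqrt (3 * M / m * (\<epsilon> * Q)) = sqrt (3 * M / m * Q) * sqrt \<epsilon>"
      by (simp add: real_sqrt_mult[symmetric] mult_ac)
    also have "sqrt \<epsilon> = \<epsilon> powr (1/4) * \<epsilon> powr (1/4)"
      using \<epsilon> by (simp add: powr_add[symmetric] powr_half_sqrt)
    also have "sqrt (3 * M / m * Q) * (\<epsilon> powr (1/4) * \<epsilon> powr (1/4)) \<le>
        sqrt (3 * M / m * Q) * (\<epsilon>\<^sub>0 powr (1/4) * \<epsilon> powr (1/4))"
      using \<epsilon> M Q m(1) by (intro mult_left_mono mult_right_mono powr_mono2) auto
    also have "\<dots> = C * \<epsilon> powr (1/4)" by (simp add: C_def)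
    finally show "H1_norm (Omega D E ?g) (\<lambda>x. v x - ?y x) \<le> C * \<epsilon> powr (1/4)"
      using est(2) by linarith
  qed
qed

end
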